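(* Let $K\subset\mathbb{C}^2$ be compact, and let $L=\{(w,z)\in V: w\in K\}$. Then $$d^{(2)}(L)=d^{(3)}(L)=d(K).$$
   Context: Setting: $w=(w_1,w_2)$, $z=(z_1,z_2)$; $f=(f_1,f_2):\mathbb{C}^2\to\mathbb{C}^2$ is a polynomial map with both components of degree $d\ge1$, $f_1=a_dz_1^d+\cdots+a_0z_2^d+(\text{terms of degree}<d)$, $f_2=b_dz_1^d+\cdots+b_0z_2^d+(\text{terms of degree}<d)$, with generic coefficients $a_j,b_j$; $V=\{(w,z)\in\mathbb{C}^2\times\mathbb{C}^2:w=f(z)\}$. $V$ is irreducible and the projection $(w,z)\mapsto w$ exhibits $V$ as a finite branched cover of $\mathbb{C}^2$. Normal forms: order monomials of $\mathbb{C}[w,z]$ by total degree, then lexicographically within each total degree according to $w_1\prec w_2\prec z_1\prec z_2$ (monomials in $w$ alone precede those containing $z$). $\mathcal{B}$ is the basis of the coordinate ring $\mathbb{C}[V]$ obtained by going through the monomials in increasing order and removing any that is linearly dependent on $V$ on earlier ones; $\mathbb{C}[w,z]_V=\mathrm{span}(\mathcal{B})$. Standing assumptions: $\mathcal{B}=\{w^\alpha z^\beta:\alpha\in\mathbb{N}_0^2,\beta\in\mathcal{I}\}$ with $\mathcal{I}\subset\mathbb{N}_0^2$ finite, $0\in\mathcal{I}$. The basis $\mathcal{B}$ is then given the ordering: $w^\alpha z^\beta\prec w^{\tilde\alpha}z^{\tilde\beta}$ if $d|\alpha|+|\beta|<d|\tilde\alpha|+|\tilde\beta|$; or these are equal and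 $\alpha\prec\tilde\alpha$; or these are equal, $\alpha=\tilde\alpha$ and $\beta\prec\tilde\beta$ (multi-indices compared by degree, then lexicographically). It is assumed that for each $\beta\in\mathcal{I}$ there are $\tilde\beta,\gamma\in\mathbb{N}_0^2$ and a nonzero constant $C_\beta$ such that $z^\beta z^{\tilde\beta}=C_\beta w^\gamma$ plus lower order terms on $V$, which holds for generic coefficients. Transfinite diameters: given a space $A$ of polynomials with ordered monomial basis $\mathbf{e}_1,\mathbf{e}_2,\ldots$ and an increasing filtration $A_0\subset A_1\subset\cdots$ of $A$ by finite-dimensional subspaces compatible with the ordering, let $m_k=\dim A_k$ (the number of basis monomials in $A_k$), $l_k=\sum_{\nu=1}^k\nu(m_\nu-m_{\nu-1})$, $\mathrm{Van}_n(E)=\max\{|\det[\mathbf{e}_j(\zeta_k)]_{j,k=1}^n|:\zeta_j\in E\}$; the associated transfinite diameter of a compact set $E$ is $\limsup_{n\to\infty}(\mathrm{Van}_{m_n}(E))^{1/l_n}$. Then, for compact $E\subset V$: $d^{(2)}(E)$ uses $A_k=\{q\in\mathbb{C}[w,z]_V: q(f(z),z)\in\mathbb{C}[z]_{\le dk}\}$ and the basis $\mathcal{B}$; $d^{(3)}(E)$ uses $A_k=\mathbb{C}[w]_{\le k}$ and the basis $\{w^\alpha\}$. For compact $E\subset\mathbb{C}^2$, $d(E)$ is the Fekete–Leja transfinite diameter, i.e. the one obtained from the filtration of the polynomial ring in two variables by degree, with the basis of all monomials. *)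

theory Defs
  imports
    "HOL-Analysis.Analysis"
    "HOL-Library.Function_Algebras"
    "Jordan_Normal_Form.Determinant"
begin

type_synonym C2 = "complex \<times> complex"
type_synonym mindex = "nat \<times> nat"

text \<open>Polynomials are treated as functions (the field is infinite); the complex functions on a type
  form a complex vector space, and \<open>cfun.span\<close> is the linear span in it.\<close>

global_interpretation cfun: vector_space "\<lambda>(c::complex) (g::'x \<Rightarrow> complex) x. c * g x"
  by unfold_locales (auto simp: fun_eq_iff algebra_simps)

subsection \<open>Monomials and polynomials\<close>

definition mdeg :: "mindex \<Rightarrow> nat" where
  "mdeg \<alpha> = fst \<alpha> + snd \<alpha>"

definition mon2 :: "mindex \<Rightarrow> C2 \<Rightarrow> complex" where
  "mon2 \<alpha> z = fst z ^ fst \<alpha> * snd z ^ snd \<alpha>"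

text \<open>The index \<open>(\<alpha>, \<beta>)\<close> stands for the monomial \<open>w\<^sup>\<alpha> z\<^sup>\<beta>\<close>, a function of \<open>(w, z)\<close>.\<close>

definition mon4 :: "mindex \<times> mindex \<Rightarrow> C2 \<times> C2 \<Rightarrow> complex" where
  "mon4 \<mu> x = mon2 (fst \<mu>) (fst x) * mon2 (snd \<mu>) (snd x)"

definition polys_le :: "nat \<Rightarrow> (C2 \<Rightarrow> complex) set" where
  "polys_le k = cfun.span (mon2 ` {\<alpha>. mdeg \<alpha> \<le> k})"

definition poly_of_degree :: "nat \<Rightarrow> (C2 \<Rightarrow> complex) \<Rightarrow> bool" where
  "poly_of_degree d p \<longleftrightarrow> p \<in> polys_le d \<and> (\<forall>k<d. p \<notin> polys_le k)"

text \<open>Two-variable multi-indices are compared by degree, then lexicographically; the second variable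
  is the larger one, so among indices of equal degree the second exponent decides.\<close>

definition mindex_less :: "(mindex \<times> mindex) set" where
  "mindex_less = inv_image (less_than <*lex*> less_than) (\<lambda>\<alpha>. (mdeg \<alpha>, snd \<alpha>))"

text \<open>The order on all monomials \<open>w\<^sup>\<alpha> z\<^sup>\<beta>\<close>: total degree, then lexicographically with
  \<open>w\<^sub>1 \<prec> w\<^sub>2 \<prec> z\<^sub>1 \<prec> z\<^sub>2\<close>.  The exponent of the largest variable is compared first, so that
  monomials in \<open>w\<close> alone precede all others of the same total degree.\<close>

definition grlex_less :: "((mindex \<times> mindex) \<times> (mindex \<times> mindex)) set" where
  "grlex_less = inv_image (less_than <*lex*> less_than <*lex*> less_than <*lex*> less_than)
     (\<lambda>(\<alpha>, \<beta>). (mdeg \<alpha> + mdeg \<beta>, snd \<beta>, fst \<beta>, snd \<alpha>))"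

text \<open>The order given to the normal form basis afterwards, by the weight \<open>d|\<alpha>| + |\<beta>|\<close>.\<close>

definition weight_less :: "nat \<Rightarrow> ((mindex \<times> mindex) \<times> (mindex \<times> mindex)) set" where
  "weight_less d = inv_image (less_than <*lex*> mindex_less <*lex*> mindex_less)
     (\<lambda>(\<alpha>, \<beta>). (d * mdeg \<alpha> + mdeg \<beta>, \<alpha>, \<beta>))"

subsection \<open>The variety and its normal form basis\<close>

definition graphV :: "(C2 \<Rightarrow> C2) \<Rightarrow> (C2 \<times> C2) set" where
  "graphV f = {(w, z). w = f z}"

definition normal_basis :: "(C2 \<Rightarrow> C2) \<Rightarrow> (mindex \<times> mindex) set" where
  "normal_basis f = {\<mu>. \<not> (\<exists>q \<in> cfun.span (mon4 ` {\<nu>. (\<nu>, \<mu>) \<in> grlex_less}).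
                            \<forall>x \<in> graphV f. mon4 \<mu> x = q x)}"

definition normal_forms :: "(C2 \<Rightarrow> C2) \<Rightarrow> (C2 \<times> C2 \<Rightarrow> complex) set" where
  "normal_forms f = cfun.span (mon4 ` normal_basis f)"

definition lower_terms :: "(C2 \<Rightarrow> C2) \<Rightarrow> nat \<Rightarrow> mindex \<times> mindex \<Rightarrow> (C2 \<times> C2 \<Rightarrow> complex) set" where
  "lower_terms f d \<mu> = cfun.span (mon4 ` {\<nu> \<in> normal_basis f. (\<nu>, \<mu>) \<in> weight_less d})"

subsection \<open>Transfinite diameters\<close>

text \<open>The element of \<open>S\<close> with exactly \<open>n\<close> predecessors in \<open>S\<close>, so indices start at 0.  All orders used
  here are total orders in which every element has finitely many predecessors.\<close>

definition enum_by :: "('i \<times> 'i) set \<Rightarrow> 'i set \<Rightarrow> nat \<Rightarrow> 'i" where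
  "enum_by r S n = (THE s. s \<in> S \<and> card {t \<in> S. (t, s) \<in> r} = n)"

definition Van :: "(nat \<Rightarrow> 'x \<Rightarrow> complex) \<Rightarrow> nat \<Rightarrow> 'x set \<Rightarrow> real" where
  "Van e n E = (SUP \<zeta> \<in> {\<zeta> :: nat \<Rightarrow> 'x. \<forall>k<n. \<zeta> k \<in> E}.
                  cmod (Determinant.det (Matrix.mat n n (\<lambda>(j, k). e j (\<zeta> k)))))"

text \<open>\<open>filt_m\<close> counts the basis elements lying in \<open>A k\<close>; this is \<open>dim (A k)\<close> as soon as the filtration
  is compatible with the basis, i.e. these basis elements span \<open>A k\<close>.\<close>

definition filt_m :: "(nat \<Rightarrow> 'x \<Rightarrow> complex) \<Rightarrow> (nat \<Rightarrow> ('x \<Rightarrow> complex) set) \<Rightarrow> nat \<Rightarrow> nat" where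
  "filt_m e A k = card {j. e j \<in> A k}"

definition filt_l :: "(nat \<Rightarrow> 'x \<Rightarrow> complex) \<Rightarrow> (nat \<Rightarrow> ('x \<Rightarrow> complex) set) \<Rightarrow> nat \<Rightarrow> real" where
  "filt_l e A k = (\<Sum>\<nu>=1..k. real \<nu> * (real (filt_m e A \<nu>) - real (filt_m e A (\<nu> - 1))))"

definition transfinite_diameter ::
    "(nat \<Rightarrow> 'x \<Rightarrow> complex) \<Rightarrow> (nat \<Rightarrow> ('x \<Rightarrow> complex) set) \<Rightarrow> 'x set \<Rightarrow> ereal" where
  "transfinite_diameter e A E =
     limsup (\<lambda>n. ereal (Van e (filt_m e A n) E powr (1 / filt_l e A n)))"

text \<open>The Fekete--Leja transfinite diameter of a compact subset of \<open>\<complex>\<^sup>2\<close>.\<close>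

definition fekete_leja :: "C2 set \<Rightarrow> ereal" where
  "fekete_leja E = transfinite_diameter (\<lambda>j. mon2 (enum_by mindex_less UNIV j)) polys_le E"

definition tdiam2 :: "(C2 \<Rightarrow> C2) \<Rightarrow> nat \<Rightarrow> (C2 \<times> C2) set \<Rightarrow> ereal" where
  "tdiam2 f d E = transfinite_diameter
     (\<lambda>j. mon4 (enum_by (weight_less d) (normal_basis f) j))
     (\<lambda>k. {q \<in> normal_forms f. (\<lambda>z. q (f z, z)) \<in> polys_le (d * k)}) E"

definition tdiam3 :: "(C2 \<times> C2) set \<Rightarrow> ereal" where
  "tdiam3 E = transfinite_diameter
     (\<lambda>j (w, z). mon2 (enum_by mindex_less UNIV j) w)
     (\<lambda>k. {q. \<exists>p \<in> polys_le k. q = (\<lambda>(w, z). p w)}) E"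

end

theory Submission
  imports
    Defs
    "HOL-Computational_Algebra.Fundamental_Theorem_Algebra"
    "HOL-Real_Asymp.Real_Asymp"
begin

text \<open>Every fibre of \<open>f\<close> is nonempty because \<open>\<complex>[z]\<close> is a free \<open>\<complex>[w]\<close>-module on the \<open>z\<^sup>\<beta>\<close>, \<open>\<beta> \<in> I\<close>; so
  evaluating on \<open>L\<close> or on \<open>K\<close> makes no difference for polynomials in \<open>w\<close>, which is the second equality.

  For the first one, let \<open>n = |I|\<close>, let \<open>v\<^sub>k\<close> be the Vandermonde supremum on \<open>K\<close> for the monomials of
  degree at most \<open>k\<close> and \<open>X\<^sub>k\<close> the one on \<open>L\<close> for the basis monomials of weight at most \<open>d k\<close>.  Up to
  factors \<open>exp (O(k\<^sup>2))\<close> and bounded shifts of \<open>k\<close>, \<open>X\<^sub>k\<close> equals \<open>v\<^sub>k\<^sup>n\<close>, and the exponents \<open>l\<^sub>k\<close> are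
  asymptotic to \<open>n k\<^sup>3 / 3\<close> and \<open>k\<^sup>3 / 3\<close>.  Laplace expansion along the blocks of rows with \<open>\<beta>\<close> fixed
  bounds \<open>X\<^sub>k\<close> from above.  For the lower bound, take all \<open>n\<close> points over each point of a configuration
  in \<open>K\<close>.  The determinant of the basis over a fibre is bounded below by a power of a fixed nonzero
  polynomial \<open>P(w)\<close>, obtained from minimal equations of \<open>z\<^sub>1\<close> and \<open>z\<^sub>2\<close> over \<open>\<complex>(w)\<close>, and replacing the
  monomials \<open>w\<^sup>\<alpha>\<close> by \<open>P w\<^sup>\<alpha>\<close> costs, by Laplace expansion again, only \<open>O(k)\<close> additional rows.\<close>

section \<open>Determinants indexed by finite sets\<close>

text \<open>The obstacle is that K is an arbitrary compact set: it may lie where fibres have fewer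
  than n points, or inside the zero set of P, so bad base points can be neither discarded nor
  perturbed. Weighting the rows by P deals with them. A configuration with P(w_j) = 0 for some j
  contributes zero, and at every other base point the fibre is reduced and its basis determinant is
  bounded below. If P vanishes on K, the comparison forces v_k = 0 for all large k. Such a P exists
  because the derivative of a minimal equation does not vanish identically in characteristic 0, and
  because every nonzero element of C[z] divides a nonzero element of C[w]. All estimates may be
  crude, since a loss of exp(O(k^2)) disappears against the cubic l_k: Laplace expansions have at
  most 2^N terms with N = O(k^2), and r = O(k) additional rows cost r! times the r-th power of a
  bound M^O(k). Determinants are indexed by finite sets because the rows form products, shifts and
  differences of sets of multi-indices that have no convenient numbering.\<close>

definition sdet :: "'i set \<Rightarrow> ('i \<Rightarrow> 'i \<Rightarrow> complex) \<Rightarrow> complex" where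
  "sdet A M = (\<Sum>p | p permutes A. of_int (sign p) * (\<Prod>i\<in>A. M i (p i)))"

lemma sdet_cong:
  assumes "\<And>i j. i \<in> A \<Longrightarrow> j \<in> A \<Longrightarrow> M i j = N i j"
  shows "sdet A M = sdet A N"
  unfolding sdet_def
  by (intro sum.cong arg_cong2[where f="(*)"] prod.cong refl) (auto simp: assms permutes_in_image)

lemma sdet_empty [simp]: "sdet {} M = 1"
  by (simp add: sdet_def)

lemma sdet_eq_det: "Determinant.det (Matrix.mat n n (\<lambda>(i, j). M i j)) = sdet {..<n} M"
  unfolding sdet_def Determinant.det_def
  by (auto intro!: sum.cong prod.cong simp: lessThan_atLeast0 permutes_in_image)

text \<open>Conjugating permutations by \<open>g\<close> preserves signs, so the labels do not
  matter as long as rows and columns share them.\<close>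

lemma sdet_reindex:
  assumes g: "bij_betw g A B" and fin: "finite A"
  shows "sdet B M = sdet A (\<lambda>i j. M (g i) (g j))"
proof -
  let ?g' = "inv_into A g"
  have g': "bij_betw ?g' B A" by (rule bij_betw_inv_into[OF g])
  have inj: "inj_on g A" using g by (auto simp: bij_betw_def)
  have "sdet A (\<lambda>i j. M (g i) (g j)) =
    (\<Sum>p | p permutes A. of_int (sign (map_permutation A g p)) * (\<Prod>i\<in>B. M i (map_permutation A g p i)))"
    unfolding sdet_def
  proof (rule sum.cong[OF refl], clarify)
    fix p assume p: "p permutes A"
    have "(\<Prod>i\<in>B. M i (map_permutation A g p i)) = (\<Prod>i\<in>A. M (g i) (map_permutation A g p (g i)))"
      using prod.reindex_bij_betw[OF g, of "\<lambda>i. M i (map_permutation A g p i)"] by simp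
    also have "\<dots> = (\<Prod>i\<in>A. M (g i) (g (p i)))"
      by (intro prod.cong refl) (simp add: map_permutation_apply[OF inj])
    finally show "of_int (sign p) * (\<Prod>i\<in>A. M (g i) (g (p i))) =
      of_int (sign (map_permutation A g p)) * (\<Prod>i\<in>B. M i (map_permutation A g p i))"
      using sign_map_permutation[OF inj p fin] by simp
  qed
  also have "\<dots> = sdet B M"
    unfolding sdet_def
  proof (rule sum.reindex_bij_witness[where i="map_permutation B ?g'" and j="map_permutation A g"])
    fix p assume "p \<in> {p. p permutes A}"
    then show "map_permutation B ?g' (map_permutation A g p) = p"
      using map_permutation_compose_inv[OF g, of p ?g'] inj by (simp add: inv_into_f_f)
    show "map_permutation A g p \<in> {p. p permutes B}"
      using map_permutation_permutes[OF g] \<open>p \<in> _\<close> by simp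
  next
    fix p assume "p \<in> {p. p permutes B}"
    then show "map_permutation A g (map_permutation B ?g' p) = p"
      using map_permutation_compose_inv[OF g', of p g] g by (simp add: bij_betw_inv_into_right)
    show "map_permutation B ?g' p \<in> {p. p permutes A}"
      using map_permutation_permutes[OF g'] \<open>p \<in> _\<close> by simp
  qed auto
  finally show ?thesis by simp
qed

lemma sdet_mult:
  assumes fin: "finite A"
  shows "sdet A (\<lambda>i j. \<Sum>k\<in>A. M i k * N k j) = sdet A M * sdet A N"
proof -
  obtain g where g: "bij_betw g {..<card A} A"
    using ex_bij_betw_nat_finite[OF fin] by (auto simp: atLeast0LessThan)
  let ?n = "card A"
  let ?M = "Matrix.mat ?n ?n (\<lambda>(i, j). M (g i) (g j))"
  let ?N = "Matrix.mat ?n ?n (\<lambda>(i, j). N (g i) (g j))"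
  have "?M * ?N = Matrix.mat ?n ?n (\<lambda>(i, j). \<Sum>k\<in>A. M (g i) k * N k (g j))"
    by (rule eq_matI)
       (auto simp: scalar_prod_def sum.reindex_bij_betw[OF g, symmetric] atLeast0LessThan intro!: sum.cong)
  then have "Determinant.det (Matrix.mat ?n ?n (\<lambda>(i, j). \<Sum>k\<in>A. M (g i) k * N k (g j))) =
      Determinant.det ?M * Determinant.det ?N"
    using Determinant.det_mult[of ?M ?n ?N] by simp
  then show ?thesis
    by (simp add: sdet_eq_det sdet_reindex[OF g])
qed

lemma sdet_transpose:
  assumes "finite A"
  shows "sdet A (\<lambda>i j. M j i) = sdet A M"
proof -
  have "sdet A (\<lambda>i j. M j i) = (\<Sum>p | p permutes A. of_int (sign (Hilbert_Choice.inv p)) * (\<Prod>i\<in>A. M (Hilbert_Choice.inv p i) i))"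
    unfolding sdet_def
    by (subst sum_permutations_inverse) simp
  also have "\<dots> = sdet A M"
    unfolding sdet_def
  proof (intro sum.cong refl, clarify)
    fix p assume p: "p permutes A"
    have "(\<Prod>i\<in>A. M (Hilbert_Choice.inv p i) i) = (\<Prod>i\<in>A. M (Hilbert_Choice.inv p (p i)) (p i))"
      using prod.reindex_bij_betw[OF permutes_imp_bij[OF p], of "\<lambda>i. M (Hilbert_Choice.inv p i) i"] by simp
    then show "of_int (sign (Hilbert_Choice.inv p)) * (\<Prod>i\<in>A. M (Hilbert_Choice.inv p i) i) = of_int (sign p) * (\<Prod>i\<in>A. M i (p i))"
      using sign_inverse[of p] p assms by (auto simp: permutes_inverses permutation_permutes)
  qed
  finally show ?thesis .
qed

text \<open>Permutations of the disjoint union that preserve \<open>A\<close> split uniquely into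
  one of \<open>A\<close> and one of \<open>B\<close>, with multiplicative sign. Both the block
  formula and the Laplace bound rest on this sum.\<close>

lemma sum_permutes_preserving:
  assumes fin: "finite A" "finite B" and disj: "A \<inter> B = {}"
  shows "(\<Sum>p | p permutes (A \<union> B) \<and> p ` A = A. of_int (sign p) * (\<Prod>i\<in>A\<union>B. M i (p i)))
      = sdet A M * sdet B M"
proof -
  have "sdet A M * sdet B M = (\<Sum>(p, q)\<in>{p. p permutes A} \<times> {q. q permutes B}.
      (of_int (sign p) * (\<Prod>i\<in>A. M i (p i))) * (of_int (sign q) * (\<Prod>i\<in>B. M i (q i))))"
    unfolding sdet_def by (simp add: sum_product sum.cartesian_product)
  also have "\<dots> = (\<Sum>p | p permutes (A \<union> B) \<and> p ` A = A. of_int (sign p) * (\<Prod>i\<in>A\<union>B. M i (p i)))"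
  proof (rule sum.reindex_bij_witness[where i="\<lambda>p. (restrict_id p A, restrict_id p B)" and j="\<lambda>(p, q). p \<circ> q"])
    fix pq assume "pq \<in> {p. p permutes A} \<times> {q. q permutes B}"
    then obtain p q where pq: "pq = (p, q)" and p: "p permutes A" and q: "q permutes B" by auto
    have qA: "q i = i" if "i \<in> A" for i
      using permutes_not_in[OF q] that disj by blast
    have pB: "p i = i" if "i \<in> B" for i
      using permutes_not_in[OF p] that disj by blast
    have qB: "q i \<in> B \<longleftrightarrow> i \<in> B" for i using permutes_in_image[OF q] .
    show "(\<lambda>p. (restrict_id p A, restrict_id p B)) (case pq of (p, q) \<Rightarrow> p \<circ> q) = pq"
      unfolding pq using qA pB qB permutes_not_in[OF p] permutes_not_in[OF q]
      by (auto simp: fun_eq_iff restrict_id_def)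
    have pq': "p \<circ> q permutes A \<union> B"
      by (intro permutes_compose permutes_subset[OF p] permutes_subset[OF q]) auto
    have "(p \<circ> q) ` A = A"
      using qA permutes_image[OF p] by (auto simp: image_iff)
    with pq' show "(case pq of (p, q) \<Rightarrow> p \<circ> q) \<in> {p. p permutes A \<union> B \<and> p ` A = A}"
      by (simp add: pq)
    have "(\<Prod>i\<in>A\<union>B. M i ((p \<circ> q) i)) = (\<Prod>i\<in>A. M i (p i)) * (\<Prod>i\<in>B. M i (q i))"
      using fin disj qA pB qB by (simp add: prod.union_disjoint)
    moreover have "sign (p \<circ> q) = sign p * sign q"
      using p q fin by (intro sign_compose) (auto simp: permutation_permutes)
    ultimately show "of_int (sign (case pq of (p, q) \<Rightarrow> p \<circ> q)) *
         (\<Prod>i\<in>A \<union> B. M i ((case pq of (p, q) \<Rightarrow> p \<circ> q) i)) =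
         (case pq of (p, q) \<Rightarrow> of_int (sign p) * (\<Prod>i\<in>A. M i (p i)) * (of_int (sign q) * (\<Prod>i\<in>B. M i (q i))))"
      by (simp add: pq)
  next
    fix p assume "p \<in> {p. p permutes A \<union> B \<and> p ` A = A}"
    then have p: "p permutes A \<union> B" and pA: "p ` A = A" by auto
    have "p ` (A \<union> B) = A \<union> B" by (rule permutes_image[OF p])
    have inj: "inj p" using permutes_inj[OF p] .
    have pB: "p ` B = B"
    proof -
      have "B = (A \<union> B) - A" using disj by auto
      then have "p ` B = p ` (A \<union> B) - p ` A" using inj by (metis image_set_diff)
      then show ?thesis using \<open>p ` (A \<union> B) = A \<union> B\<close> pA disj by auto
    qed
    have rA: "restrict_id p A permutes A"
      by (rule permutes_restrict_id) (use pA inj in \<open>auto simp: bij_betw_def intro: inj_on_subset\<close>)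
    have rB: "restrict_id p B permutes B"
      by (rule permutes_restrict_id) (use pB inj in \<open>auto simp: bij_betw_def intro: inj_on_subset\<close>)
    show "(restrict_id p A, restrict_id p B) \<in> {p. p permutes A} \<times> {q. q permutes B}"
      using rA rB by simp
    show "(case (restrict_id p A, restrict_id p B) of (p, q) \<Rightarrow> p \<circ> q) = p"
    proof
      fix x
      show "(case (restrict_id p A, restrict_id p B) of (p, q) \<Rightarrow> p \<circ> q) x = p x"
        using pA pB disj permutes_not_in[OF p, of x] by (auto simp: restrict_id_def)
    qed
  qed
  finally show ?thesis by simp
qed

text \<open>A permutation that does not preserve \<open>A\<close> sends some row of \<open>A\<close>
  to a column of \<open>B\<close>, where the entry is zero.\<close>

lemma sdet_block:
  assumes fin: "finite A" "finite B" and disj: "A \<inter> B = {}"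
    and zero: "\<And>i j. i \<in> A \<Longrightarrow> j \<in> B \<Longrightarrow> M i j = 0"
  shows "sdet (A \<union> B) M = sdet A M * sdet B M"
proof -
  have "sdet (A \<union> B) M = (\<Sum>p | p permutes (A \<union> B) \<and> p ` A = A. of_int (sign p) * (\<Prod>i\<in>A\<union>B. M i (p i)))"
    unfolding sdet_def
  proof (rule sum.mono_neutral_right)
    show "finite {p. p permutes A \<union> B}" using fin by (intro finite_permutations) auto
    show "\<forall>p\<in>{p. p permutes A \<union> B} - {p. p permutes A \<union> B \<and> p ` A = A}.
        of_int (sign p) * (\<Prod>i\<in>A \<union> B. M i (p i)) = 0"
    proof
      fix p assume "p\<in>{p. p permutes A \<union> B} - {p. p permutes A \<union> B \<and> p ` A = A}"
      then have p: "p permutes A \<union> B" and ne: "p ` A \<noteq> A" by auto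
      have "\<not> p ` A \<subseteq> A"
        using ne endo_inj_surj[OF fin(1) _ inj_on_subset[OF permutes_inj[OF p]]] by blast
      then obtain i where i: "i \<in> A" "p i \<notin> A" by auto
      have "p i \<in> A \<union> B" using i permutes_in_image[OF p] by blast
      then have "M i (p i) = 0" using i zero by auto
      then show "of_int (sign p) * (\<Prod>i\<in>A \<union> B. M i (p i)) = 0"
        using i fin by (auto simp: prod_zero_iff)
    qed
  qed auto
  then show ?thesis using sum_permutes_preserving[OF fin disj] by simp
qed

text \<open>Blocks are indexed by the second component here and by the first in the primed version;
  the two factors of the determinant over full fibres need one of each.\<close>

lemma sdet_block_diagonal:
  assumes "finite A" "finite I"
    and "\<And>a b c e. a \<in> A \<Longrightarrow> c \<in> A \<Longrightarrow> b \<in> I \<Longrightarrow> e \<in> I \<Longrightarrow> b \<noteq> e \<Longrightarrow> M (a, b) (c, e) = 0"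
  shows "sdet (A \<times> I) M = (\<Prod>b\<in>I. sdet A (\<lambda>a c. M (a, b) (c, b)))"
  using assms(2,3)
proof (induction I rule: finite_induct)
  case empty
  then show ?case by simp
next
  case (insert b I)
  have "A \<times> insert b I = A \<times> {b} \<union> A \<times> I" by auto
  moreover have "sdet (A \<times> {b} \<union> A \<times> I) M = sdet (A \<times> {b}) M * sdet (A \<times> I) M"
    by (rule sdet_block) (use insert assms in auto)
  moreover have "sdet (A \<times> {b}) M = sdet A (\<lambda>a c. M (a, b) (c, b))"
    by (rule sdet_reindex) (use assms in \<open>auto simp: bij_betw_def inj_on_def\<close>)
  moreover have "sdet (A \<times> I) M = (\<Prod>b\<in>I. sdet A (\<lambda>a c. M (a, b) (c, b)))"
    by (rule insert.IH) (use insert in auto)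
  ultimately show ?case using insert.hyps by simp
qed

lemma sdet_block_diagonal':
  assumes "finite A" "finite I"
    and "\<And>a b c e. a \<in> A \<Longrightarrow> c \<in> A \<Longrightarrow> b \<in> I \<Longrightarrow> e \<in> I \<Longrightarrow> a \<noteq> c \<Longrightarrow> M (a, b) (c, e) = 0"
  shows "sdet (A \<times> I) M = (\<Prod>a\<in>A. sdet I (\<lambda>b e. M (a, b) (a, e)))"
proof -
  have "sdet (A \<times> I) M = sdet (I \<times> A) (\<lambda>i j. M (prod.swap i) (prod.swap j))"
    by (rule sdet_reindex) (use assms in \<open>auto simp: bij_betw_def\<close>)
  also have "\<dots> = (\<Prod>a\<in>A. sdet I (\<lambda>b e. M (a, b) (a, e)))"
    by (subst sdet_block_diagonal) (use assms in auto)
  finally show ?thesis .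
qed

text \<open>Measuring triangularity by an injective \<open>key\<close> spares an enumeration of
  \<open>A\<close>; a diagonal matrix qualifies for every such key.\<close>

lemma sdet_triangular:
  fixes key :: "'i \<Rightarrow> nat"
  assumes fin: "finite A" and inj: "inj_on key A"
    and zero: "\<And>i j. i \<in> A \<Longrightarrow> j \<in> A \<Longrightarrow> key i < key j \<Longrightarrow> M i j = 0"
  shows "sdet A M = (\<Prod>i\<in>A. M i i)"
proof -
  have "sdet A M = (\<Sum>p\<in>{id}. of_int (sign p) * (\<Prod>i\<in>A. M i (p i)))"
    unfolding sdet_def
  proof (rule sum.mono_neutral_right)
    show "finite {p. p permutes A}" using fin by (rule finite_permutations)
    show "{id} \<subseteq> {p. p permutes A}" by (auto simp: permutes_id)
    show "\<forall>p\<in>{p. p permutes A} - {id}. of_int (sign p) * (\<Prod>i\<in>A. M i (p i)) = 0"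
    proof (rule ballI, rule ccontr)
      fix p assume "p \<in> {p. p permutes A} - {id}"
        and nz: "of_int (sign p) * (\<Prod>i\<in>A. M i (p i)) \<noteq> 0"
      then have p: "p permutes A" and "p \<noteq> id" by auto
      have le: "key (p i) \<le> key i" if "i \<in> A" for i
        using nz fin that zero permutes_in_image[OF p] by (metis mult_zero_right not_le prod_zero_iff)
      \<comment> \<open>A permutation only rearranges the keys. Termwise inequality with equal sums
        forces equality, and injectivity then makes the permutation trivial.\<close>
      have "(\<Sum>i\<in>A. key (p i)) = (\<Sum>i\<in>A. key i)"
        by (rule sum.reindex_bij_betw[OF permutes_imp_bij[OF p]])
      then have "key (p i) = key i" if "i \<in> A" for i
        using sum_mono_inv[of "\<lambda>i. key (p i)" A key i] le fin that by auto
      then have "p i = i" if "i \<in> A" for i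
        using inj that permutes_in_image[OF p] by (metis inj_onD)
      then have "p = id" using permutes_not_in[OF p] by fastforce
      with \<open>p \<noteq> id\<close> show False by simp
    qed
  qed
  then show ?thesis by simp
qed

lemma norm_sdet_le:
  assumes fin: "finite A" and bd: "\<And>i j. i \<in> A \<Longrightarrow> j \<in> A \<Longrightarrow> cmod (M i j) \<le> C"
  shows "cmod (sdet A M) \<le> fact (card A) * C ^ card A"
proof -
  have "cmod (sdet A M) \<le> (\<Sum>p | p permutes A. C ^ card A)"
    unfolding sdet_def
  proof (rule order.trans[OF norm_sum], rule sum_mono, clarify)
    fix p assume p: "p permutes A"
    have "cmod (\<Prod>i\<in>A. M i (p i)) \<le> (\<Prod>i\<in>A. C)"
      unfolding prod_norm[symmetric] using p bd by (intro prod_mono) (auto simp: permutes_in_image)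
    then show "cmod (of_int (sign p) * (\<Prod>i\<in>A. M i (p i))) \<le> C ^ card A"
      by (cases p rule: sign_cases) (auto simp: norm_mult)
  qed
  then show ?thesis using card_permutations[OF refl fin] by simp
qed

text \<open>The Laplace expansion, with the \<open>2 ^ N\<close> possible images of \<open>A\<close> merely counted.\<close>

lemma norm_sdet_union_le:
  assumes fin: "finite A" "finite B" and disj: "A \<inter> B = {}"
    and VA: "\<And>q. q permutes (A \<union> B) \<Longrightarrow> cmod (sdet A (\<lambda>i j. M i (q j))) \<le> VA"
    and VB: "\<And>q. q permutes (A \<union> B) \<Longrightarrow> cmod (sdet B (\<lambda>i j. M i (q j))) \<le> VB"
  shows "cmod (sdet (A \<union> B) M) \<le> 2 ^ (card A + card B) * (VA * VB)"
proof -
  let ?P = "{p. p permutes (A \<union> B)}"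
  let ?t = "\<lambda>p. of_int (sign p) * (\<Prod>i\<in>A \<union> B. M i (p i))"
  have finP: "finite ?P" using fin by (intro finite_permutations) auto
  have "0 \<le> VA" using VA[OF permutes_id] by (rule order.trans[rotated]) simp
  moreover have "0 \<le> VB" using VB[OF permutes_id] by (rule order.trans[rotated]) simp
  ultimately have nn: "0 \<le> VA * VB" by simp
  \<comment> \<open>Permutations are grouped by the image of \<open>A\<close>, that is, by the set
    of columns that meet these rows.\<close>
  have "sdet (A \<union> B) M = (\<Sum>S\<in>(\<lambda>p. p ` A) ` ?P. \<Sum>p | p \<in> ?P \<and> p ` A = S. ?t p)"
    unfolding sdet_def by (rule sum.image_gen[OF finP])
  also have "cmod \<dots> \<le> (\<Sum>S\<in>(\<lambda>p. p ` A) ` ?P. VA * VB)"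
  proof (rule order.trans[OF norm_sum], rule sum_mono)
    fix S assume "S \<in> (\<lambda>p. p ` A) ` ?P"
    then obtain q where q: "q permutes (A \<union> B)" and S: "S = q ` A" by auto
    \<comment> \<open>One \<open>q\<close> with image \<open>S\<close> is fixed. Every other one is
      \<open>q \<circ> p\<close> with \<open>p\<close> preserving \<open>A\<close>, so the group
      sums to a signed product of two complementary minors.\<close>
    have "(\<Sum>p | p \<in> ?P \<and> p ` A = S. ?t p) =
        (\<Sum>p | p permutes (A \<union> B) \<and> p ` A = A. ?t (q \<circ> p))"
    proof (rule sum.reindex_bij_witness[where i="\<lambda>p. q \<circ> p" and j="\<lambda>p. Hilbert_Choice.inv q \<circ> p"])
      fix p assume "p \<in> {p. p \<in> ?P \<and> p ` A = S}"
      then have p: "p permutes A \<union> B" "p ` A = q ` A" using S by auto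
      show qp: "q \<circ> (Hilbert_Choice.inv q \<circ> p) = p"
        using permutes_inverses[OF q] by (simp add: fun_eq_iff)
      have "(Hilbert_Choice.inv q \<circ> p) ` A = Hilbert_Choice.inv q ` q ` A"
        unfolding image_comp[symmetric] p(2) ..
      then show "Hilbert_Choice.inv q \<circ> p \<in> {p. p permutes (A \<union> B) \<and> p ` A = A}"
        using permutes_compose[OF p(1) permutes_inv[OF q]] permutes_inverses[OF q]
        by (simp add: image_image)
      show "?t (q \<circ> (Hilbert_Choice.inv q \<circ> p)) = ?t p" by (simp only: qp)
    next
      fix p assume p: "p \<in> {p. p permutes (A \<union> B) \<and> p ` A = A}"
      then have "(q \<circ> p) ` A = S" by (simp add: S image_comp[symmetric] del: o_apply)
      with p show "q \<circ> p \<in> {p. p \<in> ?P \<and> p ` A = S}"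
        using permutes_compose[OF _ q] by blast
      show "Hilbert_Choice.inv q \<circ> (q \<circ> p) = p"
        using permutes_inverses[OF q] by (simp add: fun_eq_iff)
    qed
    also have "\<dots> = of_int (sign q) *
        (\<Sum>p | p permutes (A \<union> B) \<and> p ` A = A. of_int (sign p) * (\<Prod>i\<in>A \<union> B. M i (q (p i))))"
      unfolding sum_distrib_left
    proof (intro sum.cong refl, clarify)
      fix p assume "p permutes A \<union> B"
      then have "sign (q \<circ> p) = sign q * sign p"
        using q fin by (intro sign_compose) (auto simp: permutation_permutes)
      then show "?t (q \<circ> p) = of_int (sign q) * (of_int (sign p) * (\<Prod>i\<in>A \<union> B. M i (q (p i))))"
        by (simp add: mult.assoc)
    qed
    also have "\<dots> = of_int (sign q) * (sdet A (\<lambda>i j. M i (q j)) * sdet B (\<lambda>i j. M i (q j)))"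
      by (subst sum_permutes_preserving[OF fin disj, of "\<lambda>i j. M i (q j)"]) simp
    also have "cmod \<dots> = cmod (sdet A (\<lambda>i j. M i (q j))) * cmod (sdet B (\<lambda>i j. M i (q j)))"
      by (cases q rule: sign_cases) (auto simp: norm_mult)
    also have "\<dots> \<le> VA * VB"
      using VA[OF q] VB[OF q] \<open>0 \<le> VA\<close> by (intro mult_mono) auto
    finally show "cmod (\<Sum>p | p \<in> ?P \<and> p ` A = S. ?t p) \<le> VA * VB" .
  qed
  also have "\<dots> = real (card ((\<lambda>p. p ` A) ` ?P)) * (VA * VB)" by simp
  also have "card ((\<lambda>p. p ` A) ` ?P) \<le> card (Pow (A \<union> B))"
  proof (rule card_mono)
    show "finite (Pow (A \<union> B))" using fin by simp
    show "(\<lambda>p. p ` A) ` ?P \<subseteq> Pow (A \<union> B)"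
    proof clarify
      fix p x assume "p permutes (A \<union> B)" "x \<in> A" "p x \<notin> B"
      then show "p x \<in> A" using permutes_in_image[of p "A \<union> B" x] by simp
    qed
  qed
  also have "card (Pow (A \<union> B)) = 2 ^ (card A + card B)"
    using fin disj by (simp add: card_Pow card_Un_disjoint)
  finally show ?thesis using nn by (simp add: mult_right_mono)
qed

section \<open>Polynomial functions of two variables\<close>

lemma subspace_pointwise:
  assumes "cfun.subspace S"
  shows subspace_zero: "(\<lambda>x. 0) \<in> S"
    and subspace_add: "\<And>g h. g \<in> S \<Longrightarrow> h \<in> S \<Longrightarrow> (\<lambda>x. g x + h x) \<in> S"
    and subspace_scale: "\<And>g c. g \<in> S \<Longrightarrow> (\<lambda>x. c * g x) \<in> S"
  using cfun.subspace_0[OF assms] cfun.subspace_add[OF assms] cfun.subspace_scale[OF assms]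
  by (auto simp: zero_fun_def plus_fun_def)

lemma subspace_pointwiseI:
  assumes "(\<lambda>x. 0) \<in> S" "\<And>g h. g \<in> S \<Longrightarrow> h \<in> S \<Longrightarrow> (\<lambda>x. g x + h x) \<in> S"
    "\<And>g c. g \<in> S \<Longrightarrow> (\<lambda>x. c * g x) \<in> S"
  shows "cfun.subspace S"
  using assms by (auto simp: cfun.subspace_def zero_fun_def plus_fun_def)

lemma subspace_sum:
  assumes "cfun.subspace S" "\<And>i. i \<in> A \<Longrightarrow> g i \<in> S"
  shows "(\<lambda>x. \<Sum>i\<in>A. g i x) \<in> S"
  using assms(2)
  by (induction A rule: infinite_finite_induct)
     (auto intro: subspace_zero[OF assms(1)] subspace_add[OF assms(1)])

text \<open>Coefficients are attached to indices rather than to elements of the image, so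
  \<open>f\<close> need not be injective on \<open>A\<close>.\<close>

lemma span_image_finite:
  assumes "finite A"
  shows "g \<in> cfun.span (f ` A) \<longleftrightarrow> (\<exists>a. \<forall>x. g x = (\<Sum>i\<in>A. a i * f i x))"
proof
  assume "g \<in> cfun.span (f ` A)"
  moreover have "f ` A \<subseteq> {g. \<exists>a. \<forall>x. g x = (\<Sum>i\<in>A. a i * f i x)}"
  proof clarify
    fix i assume "i \<in> A"
    then show "\<exists>a. \<forall>x. f i x = (\<Sum>j\<in>A. a j * f j x)"
      using assms by (intro exI[of _ "\<lambda>j. if j = i then 1 else 0"]) (simp add: mult_delta_left)
  qed
  moreover have "cfun.subspace {g. \<exists>a. \<forall>x. g x = (\<Sum>i\<in>A. a i * f i x)}"
  proof (rule subspace_pointwiseI; clarsimp)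
    show "\<exists>a. \<forall>x. (\<Sum>i\<in>A. a i * f i x) = 0" by (rule exI[of _ "\<lambda>_. 0"]) simp
  next
    fix g h a b assume "\<forall>x. g x = (\<Sum>i\<in>A. a i * f i x)" "\<forall>x. h x = (\<Sum>i\<in>A. b i * f i x)"
    then show "\<exists>c. \<forall>x. (\<Sum>i\<in>A. a i * f i x) + (\<Sum>i\<in>A. b i * f i x) = (\<Sum>i\<in>A. c i * f i x)"
      by (intro exI[of _ "\<lambda>i. a i + b i"]) (simp add: algebra_simps sum.distrib)
  next
    fix g c a assume "\<forall>x. g x = (\<Sum>i\<in>A. a i * f i x)"
    then show "\<exists>b. \<forall>x. c * (\<Sum>i\<in>A. a i * f i x) = (\<Sum>i\<in>A. b i * f i x)"
      by (intro exI[of _ "\<lambda>i. c * a i"]) (simp add: sum_distrib_left mult.assoc)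
  qed
  ultimately show "\<exists>a. \<forall>x. g x = (\<Sum>i\<in>A. a i * f i x)"
    using cfun.span_minimal by blast
next
  assume "\<exists>a. \<forall>x. g x = (\<Sum>i\<in>A. a i * f i x)"
  then obtain a where "g = (\<lambda>x. \<Sum>i\<in>A. a i * f i x)" by auto
  then show "g \<in> cfun.span (f ` A)"
    by (simp add: subspace_sum[OF cfun.subspace_span] subspace_scale[OF cfun.subspace_span] cfun.span_base)
qed

text \<open>The outer variable is the second coordinate; the coefficients are polynomials in the
  first. This representation lends polynomial functions the integral domain structure of the nested
  polynomial type.\<close>

definition ev2 :: "complex poly poly \<Rightarrow> C2 \<Rightarrow> complex" where
  "ev2 P z = poly (poly P [:snd z:]) (fst z)"

definition PF :: "(C2 \<Rightarrow> complex) set" where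
  "PF = range ev2"

lemma ev2_add: "ev2 (P + Q) z = ev2 P z + ev2 Q z"
  and ev2_mult: "ev2 (P * Q) z = ev2 P z * ev2 Q z"
  by (simp_all add: ev2_def)

text \<open>A polynomial that vanishes as a function has every constant \<open>[:y:]\<close> as a
  root, hence infinitely many roots in the domain of one-variable polynomials.\<close>

lemma ev2_eq_0_iff: "(\<forall>z. ev2 P z = 0) \<longleftrightarrow> P = 0"
proof
  assume "\<forall>z. ev2 P z = 0"
  then have "poly (poly P [:y:]) x = 0" for x y by (simp add: ev2_def)
  then have "poly P [:y:] = 0" for y using poly_all_0_iff_0 by blast
  then have "range (\<lambda>y. [:y:]) \<subseteq> {q. poly P q = 0}" by auto
  moreover have "infinite (range (\<lambda>y::complex. [:y:]))"
    using finite_imageD[of "\<lambda>y::complex. [:y:]" UNIV] infinite_UNIV_char_0[where 'a=complex]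
    by (auto simp: inj_on_def)
  ultimately show "P = 0" using poly_roots_finite[of P] finite_subset by blast
qed (simp add: ev2_def)

lemma PF_const [simp, intro]: "(\<lambda>z. c) \<in> PF"
  unfolding PF_def by (rule range_eqI[of _ _ "[:[:c:]:]"]) (simp add: ev2_def fun_eq_iff)

lemma PF_fst [simp, intro]: "(\<lambda>z. fst z) \<in> PF"
  unfolding PF_def by (rule range_eqI[of _ _ "[:[:0,1:]:]"]) (simp add: ev2_def fun_eq_iff)

lemma PF_snd [simp, intro]: "(\<lambda>z. snd z) \<in> PF"
  unfolding PF_def by (rule range_eqI[of _ _ "[:0,1:]"]) (simp add: ev2_def fun_eq_iff)

lemma PF_add [intro]: "p \<in> PF \<Longrightarrow> q \<in> PF \<Longrightarrow> (\<lambda>z. p z + q z) \<in> PF"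
  unfolding PF_def by (metis (no_types, lifting) ev2_add fun_eq_iff imageE rangeI)

lemma PF_mult [intro]: "p \<in> PF \<Longrightarrow> q \<in> PF \<Longrightarrow> (\<lambda>z. p z * q z) \<in> PF"
  unfolding PF_def by (metis (no_types, lifting) ev2_mult fun_eq_iff imageE rangeI)

lemma PF_diff [intro]: "p \<in> PF \<Longrightarrow> q \<in> PF \<Longrightarrow> (\<lambda>z. p z - q z) \<in> PF"
  using PF_add[of p "\<lambda>z. - 1 * q z"] PF_mult[of "\<lambda>z. -1" q] by simp

lemma PF_sum [intro]: "(\<And>i. i \<in> A \<Longrightarrow> p i \<in> PF) \<Longrightarrow> (\<lambda>z. \<Sum>i\<in>A. p i z) \<in> PF"
  by (induction A rule: infinite_finite_induct) auto

lemma PF_power [intro]: "p \<in> PF \<Longrightarrow> (\<lambda>z. p z ^ n) \<in> PF"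
  by (induction n) auto

lemma PF_mon2 [simp, intro]: "mon2 \<alpha> \<in> PF"
  unfolding mon2_def[abs_def] by (intro PF_mult PF_power PF_fst PF_snd)

lemma PF_nonzero_mult:
  assumes "p \<in> PF" "q \<in> PF" "\<exists>z. p z \<noteq> 0" "\<exists>z. q z \<noteq> 0"
  shows "\<exists>z. p z * q z \<noteq> 0"
proof -
  from assms obtain P Q where "p = ev2 P" "q = ev2 Q" by (auto simp: PF_def)
  with assms have "P * Q \<noteq> 0" using ev2_eq_0_iff[of P] ev2_eq_0_iff[of Q] by auto
  then obtain z where "ev2 (P * Q) z \<noteq> 0" using ev2_eq_0_iff by blast
  then show ?thesis using \<open>p = _\<close> \<open>q = _\<close> by (auto simp: ev2_def)
qed

lemma PF_nonzero_power:
  assumes "p \<in> PF" "\<exists>z. p z \<noteq> 0"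
  shows "\<exists>z. p z ^ n \<noteq> 0"
  using assms by auto

section \<open>The filtration of polynomial functions by degree\<close>

definition midx :: "nat \<Rightarrow> mindex set" where
  "midx k = {\<alpha>. mdeg \<alpha> \<le> k}"

lemma midx_eq: "midx k = (SIGMA a:{..k}. {..k - a})"
  by (auto simp: midx_def mdeg_def)

lemma finite_midx [simp, intro]: "finite (midx k)"
  by (simp add: midx_eq)

lemma polys_le_iff: "p \<in> polys_le k \<longleftrightarrow> (\<exists>a. \<forall>z. p z = (\<Sum>\<alpha>\<in>midx k. a \<alpha> * mon2 \<alpha> z))"
  unfolding polys_le_def midx_def[symmetric] by (rule span_image_finite) simp

lemma subspace_polys_le: "cfun.subspace (polys_le k)"
  unfolding polys_le_def by (rule cfun.subspace_span)

lemma mon2_in_polys_le: "mdeg \<alpha> \<le> k \<Longrightarrow> mon2 \<alpha> \<in> polys_le k"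
  unfolding polys_le_def by (intro cfun.span_base) auto

lemma polys_le_mono: "k \<le> l \<Longrightarrow> polys_le k \<subseteq> polys_le l"
  unfolding polys_le_def by (intro cfun.span_mono) auto

lemma mon2_mult: "mon2 \<alpha> z * mon2 \<beta> z = mon2 (fst \<alpha> + fst \<beta>, snd \<alpha> + snd \<beta>) z"
  by (simp add: mon2_def power_add)

lemma mon2_0 [simp]: "mon2 (0, 0) z = 1"
  by (simp add: mon2_def)

lemma polys_le_mult:
  assumes "p \<in> polys_le k" "q \<in> polys_le l"
  shows "(\<lambda>z. p z * q z) \<in> polys_le (k + l)"
proof -
  obtain a b where a: "\<And>z. p z = (\<Sum>\<alpha>\<in>midx k. a \<alpha> * mon2 \<alpha> z)"
    and b: "\<And>z. q z = (\<Sum>\<alpha>\<in>midx l. b \<alpha> * mon2 \<alpha> z)"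
    using assms unfolding polys_le_iff by blast
  have "(\<lambda>z. p z * q z) = (\<lambda>z. \<Sum>\<alpha>\<in>midx k. \<Sum>\<beta>\<in>midx l. (a \<alpha> * b \<beta>) *
      mon2 (fst \<alpha> + fst \<beta>, snd \<alpha> + snd \<beta>) z)"
    by (simp add: a b sum_product mult.assoc mult.left_commute mon2_mult)
  also have "\<dots> \<in> polys_le (k + l)"
    by (intro subspace_sum[OF subspace_polys_le] subspace_scale[OF subspace_polys_le] mon2_in_polys_le)
       (auto simp: midx_def mdeg_def)
  finally show ?thesis .
qed

lemma polys_le_const: "(\<lambda>z. c) \<in> polys_le k"
  using subspace_scale[OF subspace_polys_le, of "mon2 (0, 0)" k c] mon2_in_polys_le[of "(0, 0)" k]
  by (simp add: mdeg_def)

lemma polys_le_power: "p \<in> polys_le k \<Longrightarrow> (\<lambda>z. p z ^ n) \<in> polys_le (k * n)"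
  by (induction n) (auto simp: polys_le_const dest: polys_le_mult)

lemma polys_le_PF: "p \<in> polys_le k \<Longrightarrow> p \<in> PF"
proof -
  assume "p \<in> polys_le k"
  then obtain a where "\<And>z. p z = (\<Sum>\<alpha>\<in>midx k. a \<alpha> * mon2 \<alpha> z)" unfolding polys_le_iff by blast
  then have "p = (\<lambda>z. \<Sum>\<alpha>\<in>midx k. a \<alpha> * mon2 \<alpha> z)" by auto
  then show "p \<in> PF" by (auto intro!: PF_sum PF_mult)
qed

lemma PF_polys_le:
  assumes "p \<in> PF"
  obtains k where "p \<in> polys_le k"
proof -
  obtain P where P: "p = ev2 P" using assms by (auto simp: PF_def)
  \<comment> \<open>A crude bound for the total degree: the outer degree plus the sum of all inner
    ones.\<close>
  define k where "k = degree P + (\<Sum>i\<le>degree P. degree (coeff P i))"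
  have "p = (\<lambda>z. \<Sum>i\<le>degree P. \<Sum>j\<le>degree (coeff P i). coeff (coeff P i) j * mon2 (j, i) z)"
    unfolding P ev2_def
    by (simp add: poly_altdef[of P] poly_sum poly_altdef[of "coeff P _"] mon2_def sum_distrib_right mult.assoc)
  also have "\<dots> \<in> polys_le k"
  proof (intro subspace_sum[OF subspace_polys_le] subspace_scale[OF subspace_polys_le] mon2_in_polys_le)
    fix i j assume "i \<in> {..degree P}" "j \<in> {..degree (coeff P i)}"
    moreover have "degree (coeff P i) \<le> (\<Sum>i\<le>degree P. degree (coeff P i))"
      using \<open>i \<in> _\<close> by (intro member_le_sum) auto
    ultimately show "mdeg (j, i) \<le> k" by (simp add: k_def mdeg_def)
  qed
  finally show thesis by (rule that)
qed

lemma PF_compose: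
  assumes "p \<in> PF" "(\<lambda>z. fst (g z)) \<in> PF" "(\<lambda>z. snd (g z)) \<in> PF"
  shows "(\<lambda>z. p (g z)) \<in> PF"
proof -
  obtain k where "p \<in> polys_le k" using PF_polys_le[OF assms(1)] .
  then obtain a where "\<And>z. p z = (\<Sum>\<alpha>\<in>midx k. a \<alpha> * mon2 \<alpha> z)" unfolding polys_le_iff by blast
  then have "(\<lambda>z. p (g z)) = (\<lambda>z. \<Sum>\<alpha>\<in>midx k. a \<alpha> * (fst (g z) ^ fst \<alpha> * snd (g z) ^ snd \<alpha>))"
    by (auto simp: mon2_def)
  then show ?thesis using assms(2,3) by (auto intro!: PF_sum PF_mult PF_power)
qed

lemma PF_continuous: "p \<in> PF \<Longrightarrow> continuous_on S p"
proof -
  assume "p \<in> PF"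
  then obtain k where "p \<in> polys_le k" by (rule PF_polys_le)
  then obtain a where "p = (\<lambda>z. \<Sum>\<alpha>\<in>midx k. a \<alpha> * mon2 \<alpha> z)" unfolding polys_le_iff by blast
  then show ?thesis unfolding mon2_def by (auto intro!: continuous_intros)
qed

text \<open>The maximum is taken over the closure of \<open>K\<close>. The normalisation
  \<open>C \<ge> 1\<close> recurs in all later bounds and makes powers increase with the
  exponent.\<close>

lemma PF_bounded:
  assumes "p \<in> PF" "bounded K"
  obtains C where "C \<ge> 1" "\<And>z. z \<in> K \<Longrightarrow> cmod (p z) \<le> C"
proof -
  have "compact (closure K)" using assms(2) by simp
  then have "compact (p ` closure K)" by (intro compact_continuous_image PF_continuous assms)
  then obtain C where C: "\<And>y. y \<in> p ` closure K \<Longrightarrow> norm y \<le> C" using compact_imp_bounded bounded_iff by metis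
  show thesis
  proof (rule that[of "max 1 C"])
    fix z assume "z \<in> K"
    then have "p z \<in> p ` closure K" using closure_subset by blast
    then show "cmod (p z) \<le> max 1 C" using C by fastforce
  qed simp
qed

lemma PF_bounded_finite:
  assumes "finite J" "\<And>i. i \<in> J \<Longrightarrow> p i \<in> PF" "bounded K"
  obtains C where "C \<ge> 1" "\<And>i z. i \<in> J \<Longrightarrow> z \<in> K \<Longrightarrow> cmod (p i z) \<le> C"
proof -
  have "\<exists>C\<ge>1. \<forall>i\<in>J. \<forall>z\<in>K. cmod (p i z) \<le> C"
    using assms(1,2)
  proof (induction J rule: finite_induct)
    case empty
    show ?case by (intro exI[of _ 1]) auto
  next
    case (insert j J)
    then obtain C where C: "C \<ge> 1" "\<forall>i\<in>J. \<forall>z\<in>K. cmod (p i z) \<le> C" by auto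
    obtain D where D: "D \<ge> 1" "\<And>z. z \<in> K \<Longrightarrow> cmod (p j z) \<le> D"
      using PF_bounded[of "p j" K] insert.prems assms(3) by auto
    show ?case using C D by (intro exI[of _ "max C D"]) force
  qed
  then show thesis using that by blast
qed

subsection \<open>Degrees\<close>

lemma mon2_scale: "mon2 \<alpha> (c * fst v, c * snd v) = c ^ mdeg \<alpha> * mon2 \<alpha> v"
  by (simp add: mon2_def mdeg_def power_mult_distrib power_add)

text \<open>Polynomials are functions here, without coefficients attached, so degrees are detected
  by growth along the ray through \<open>v\<close>.\<close>

lemma polys_le_growth:
  assumes "p \<in> polys_le k" "k < m"
  shows "(\<lambda>n. p (of_nat n * fst v, of_nat n * snd v) / of_nat n ^ m) \<longlonglongrightarrow> 0"
proof -
  obtain a where a: "\<And>z. p z = (\<Sum>\<alpha>\<in>midx k. a \<alpha> * mon2 \<alpha> z)"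
    using assms unfolding polys_le_iff by blast
  have "(\<lambda>n. \<Sum>\<alpha>\<in>midx k. (a \<alpha> * mon2 \<alpha> v) * (inverse (of_nat n) ^ (m - mdeg \<alpha>))) \<longlonglongrightarrow>
      (\<Sum>\<alpha>\<in>midx k. (a \<alpha> * mon2 \<alpha> v) * 0)"
  proof (intro tendsto_sum tendsto_mult tendsto_const)
    fix \<alpha> assume "\<alpha> \<in> midx k"
    then have "m - mdeg \<alpha> > 0" using assms(2) by (simp add: midx_def)
    then show "(\<lambda>n. inverse (of_nat n) ^ (m - mdeg \<alpha>)) \<longlonglongrightarrow> (0::complex)"
      using tendsto_power[OF lim_inverse_n[where 'a=complex], of "m - mdeg \<alpha>"] by (simp add: zero_power)
  qed
  then have "(\<lambda>n. \<Sum>\<alpha>\<in>midx k. (a \<alpha> * mon2 \<alpha> v) * (inverse (of_nat n) ^ (m - mdeg \<alpha>))) \<longlonglongrightarrow> 0"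
    by simp
  moreover have "\<forall>\<^sub>F n in sequentially. (\<Sum>\<alpha>\<in>midx k. (a \<alpha> * mon2 \<alpha> v) * (inverse (of_nat n) ^ (m - mdeg \<alpha>)))
     = p (of_nat n * fst v, of_nat n * snd v) / of_nat n ^ m"
    using eventually_gt_at_top[of 0]
  proof eventually_elim
    case (elim n)
    have "(a \<alpha> * mon2 \<alpha> v) * (inverse (of_nat n) ^ (m - mdeg \<alpha>)) =
        a \<alpha> * mon2 \<alpha> (of_nat n * fst v, of_nat n * snd v) / of_nat n ^ m" if "\<alpha> \<in> midx k" for \<alpha>
    proof -
      have "mdeg \<alpha> \<le> m" using that assms(2) by (simp add: midx_def)
      then have "(of_nat n :: complex) ^ m = of_nat n ^ mdeg \<alpha> * of_nat n ^ (m - mdeg \<alpha>)"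
        by (simp add: power_add[symmetric])
      then show ?thesis using elim by (simp add: mon2_scale field_simps power_inverse)
    qed
    then show ?case by (simp add: a sum_divide_distrib)
  qed
  ultimately show ?thesis by (rule Lim_transform_eventually)
qed

text \<open>\<open>T\<close> is the homogeneous part of top degree of \<open>p\<close>.\<close>

lemma poly_of_degree_top:
  assumes "poly_of_degree d p" "d \<ge> 1"
  obtains T where "T \<in> PF" "\<exists>v. T v \<noteq> 0"
    "\<And>v. (\<lambda>n. p (of_nat n * fst v, of_nat n * snd v) / of_nat n ^ d) \<longlonglongrightarrow> T v"
proof -
  have p: "p \<in> polys_le d" "p \<notin> polys_le (d - 1)" using assms by (auto simp: poly_of_degree_def)
  obtain a where a: "\<And>z. p z = (\<Sum>\<alpha>\<in>midx d. a \<alpha> * mon2 \<alpha> z)"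
    using p unfolding polys_le_iff by blast
  define T where "T = (\<lambda>z. \<Sum>\<alpha>\<in>midx d - midx (d - 1). a \<alpha> * mon2 \<alpha> z)"
  define r where "r = (\<lambda>z. \<Sum>\<alpha>\<in>midx (d - 1). a \<alpha> * mon2 \<alpha> z)"
  have sub: "midx (d - 1) \<subseteq> midx d" by (auto simp: midx_def)
  have pT: "p z = r z + T z" for z
    unfolding a T_def r_def using sum.subset_diff[OF sub] by (simp add: add.commute)
  have r: "r \<in> polys_le (d - 1)" unfolding r_def polys_le_iff by blast
  have top: "mdeg \<alpha> = d" if "\<alpha> \<in> midx d - midx (d - 1)" for \<alpha>
    using that by (auto simp: midx_def)
  have hom: "T (of_nat n * fst v, of_nat n * snd v) = of_nat n ^ d * T v" for n v
    unfolding T_def sum_distrib_left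
    by (intro sum.cong refl) (simp add: mon2_scale top del: Diff_iff)
  show thesis
  proof (rule that[of T])
    show "T \<in> PF" unfolding T_def by (auto intro!: PF_sum PF_mult)
    show "\<exists>v. T v \<noteq> 0"
    proof (rule ccontr)
      assume "\<nexists>v. T v \<noteq> 0"
      then have "p = r" using pT by auto
      with r p show False by simp
    qed
    fix v
    have "(\<lambda>n. r (of_nat n * fst v, of_nat n * snd v) / of_nat n ^ d + T v) \<longlonglongrightarrow> 0 + T v"
      by (intro tendsto_add polys_le_growth[OF r] tendsto_const) (use assms in auto)
    moreover have "\<forall>\<^sub>F n in sequentially. r (of_nat n * fst v, of_nat n * snd v) / of_nat n ^ d + T v =
        p (of_nat n * fst v, of_nat n * snd v) / of_nat n ^ d"
      using eventually_gt_at_top[of 0] by eventually_elim (simp add: pT hom add_divide_distrib)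
    ultimately show "(\<lambda>n. p (of_nat n * fst v, of_nat n * snd v) / of_nat n ^ d) \<longlonglongrightarrow> T v"
      by (simp add: Lim_transform_eventually)
  qed
qed

lemma mon2_in_polys_le_iff: "mon2 \<alpha> \<in> polys_le k \<longleftrightarrow> mdeg \<alpha> \<le> k"
proof
  show "mdeg \<alpha> \<le> k" if "mon2 \<alpha> \<in> polys_le k"
  proof (rule ccontr)
    assume "\<not> mdeg \<alpha> \<le> k"
    \<comment> \<open>In direction (1, 1) the monomial has exactly the value n^|\<alpha>|, so this
      quotient is eventually 1.\<close>
    then have "(\<lambda>n. mon2 \<alpha> (of_nat n * fst (1, 1 :: complex), of_nat n * snd (1 :: complex, 1)) / of_nat n ^ mdeg \<alpha>) \<longlonglongrightarrow> 0"
      by (intro polys_le_growth[OF that, where v="(1, 1)"]) auto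
    moreover have "\<forall>\<^sub>F n in sequentially. mon2 \<alpha> (of_nat n * fst (1, 1 :: complex), of_nat n * snd (1 :: complex, 1)) / of_nat n ^ mdeg \<alpha> = 1"
      using eventually_gt_at_top[of 0]
      by eventually_elim (simp only: mon2_scale, simp add: mon2_def)
    ultimately have "(\<lambda>n::nat. 1::complex) \<longlonglongrightarrow> 0" by (rule Lim_transform_eventually)
    then show False by (simp add: LIMSEQ_const_iff)
  qed
qed (rule mon2_in_polys_le)

text \<open>Substituting w = f(z) produces the exact degree d|\<alpha>| + |\<beta>|: the top
  homogeneous parts have a nonzero product because C[z] is a domain. This turns the filtration of
  d^(2) into a bound on the weight.\<close>

lemma weight_monomial_in_polys_le_iff:
  assumes d: "d \<ge> 1" and f1: "poly_of_degree d (\<lambda>z. fst (f z))" and f2: "poly_of_degree d (\<lambda>z. snd (f z))"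
  shows "(\<lambda>z. mon2 \<alpha> (f z) * mon2 \<beta> z) \<in> polys_le k \<longleftrightarrow> d * mdeg \<alpha> + mdeg \<beta> \<le> k"
    (is "?m \<in> _ \<longleftrightarrow> ?w \<le> k")
proof
  have p: "(\<lambda>z. fst (f z)) \<in> polys_le d" "(\<lambda>z. snd (f z)) \<in> polys_le d"
    using f1 f2 by (auto simp: poly_of_degree_def)
  assume "?w \<le> k"
  have "?m \<in> polys_le ((d * fst \<alpha> + d * snd \<alpha>) + mdeg \<beta>)"
    unfolding mon2_def[of \<alpha>] by (intro polys_le_mult polys_le_power p mon2_in_polys_le order.refl)
  moreover have "(d * fst \<alpha> + d * snd \<alpha>) + mdeg \<beta> \<le> k"
    using \<open>?w \<le> k\<close> by (simp add: mdeg_def[of \<alpha>] algebra_simps)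
  ultimately show "?m \<in> polys_le k" using polys_le_mono by blast
next
  obtain T where T: "T \<in> PF" "\<exists>v. T v \<noteq> 0"
    "\<And>v. (\<lambda>n. fst (f (of_nat n * fst v, of_nat n * snd v)) / of_nat n ^ d) \<longlonglongrightarrow> T v"
    using poly_of_degree_top[OF f1 d] by blast
  obtain S where S: "S \<in> PF" "\<exists>v. S v \<noteq> 0"
    "\<And>v. (\<lambda>n. snd (f (of_nat n * fst v, of_nat n * snd v)) / of_nat n ^ d) \<longlonglongrightarrow> S v"
    using poly_of_degree_top[OF f2 d] by blast
  assume m: "?m \<in> polys_le k"
  show "?w \<le> k"
  proof (rule ccontr)
    assume "\<not> ?w \<le> k"
    have "T v ^ fst \<alpha> * S v ^ snd \<alpha> * mon2 \<beta> v = 0" for v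
    proof -
      let ?z = "\<lambda>n. (of_nat n * fst v, of_nat n * snd v)"
      \<comment> \<open>The same quotient tends to 0 by the assumed degree bound and to the product
        of the leading forms by the choice of \<open>T\<close> and \<open>S\<close>.\<close>
      have "(\<lambda>n. ?m (?z n) / of_nat n ^ ?w) \<longlonglongrightarrow> 0"
        by (rule polys_le_growth[OF m]) (use \<open>\<not> ?w \<le> k\<close> in simp)
      moreover have "\<forall>\<^sub>F n in sequentially. ?m (?z n) / of_nat n ^ ?w =
          (fst (f (?z n)) / of_nat n ^ d) ^ fst \<alpha> * (snd (f (?z n)) / of_nat n ^ d) ^ snd \<alpha> * mon2 \<beta> v"
        using eventually_gt_at_top[of 0]
      proof eventually_elim
        case (elim n)
        have "(of_nat n :: complex) ^ ?w = (of_nat n ^ d) ^ fst \<alpha> * (of_nat n ^ d) ^ snd \<alpha> * of_nat n ^ mdeg \<beta>"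
          by (simp add: mdeg_def[of \<alpha>] power_add power_mult algebra_simps)
        then show ?case using elim by (simp add: mon2_scale mon2_def[of \<alpha>] power_divide)
      qed
      ultimately have "(\<lambda>n. (fst (f (?z n)) / of_nat n ^ d) ^ fst \<alpha> * (snd (f (?z n)) / of_nat n ^ d) ^ snd \<alpha> * mon2 \<beta> v)
          \<longlonglongrightarrow> 0" by (rule Lim_transform_eventually)
      moreover have "(\<lambda>n. (fst (f (?z n)) / of_nat n ^ d) ^ fst \<alpha> * (snd (f (?z n)) / of_nat n ^ d) ^ snd \<alpha> * mon2 \<beta> v)
          \<longlonglongrightarrow> T v ^ fst \<alpha> * S v ^ snd \<alpha> * mon2 \<beta> v"
        by (intro tendsto_mult tendsto_power tendsto_const T S)
      ultimately show ?thesis using LIMSEQ_unique by blast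
    qed
    moreover have "\<exists>v. mon2 \<beta> v \<noteq> 0" by (rule exI[of _ "(1, 1)"]) (simp add: mon2_def)
    ultimately show False
      using PF_nonzero_mult[OF PF_mult[OF PF_power[OF T(1)] PF_power[OF S(1)]] PF_mon2,
          of "fst \<alpha>" "snd \<alpha>" \<beta>]
        PF_nonzero_mult[OF PF_power[OF T(1)] PF_power[OF S(1)], of "fst \<alpha>" "snd \<alpha>"]
        PF_nonzero_power[OF T(1,2)] PF_nonzero_power[OF S(1,2)] by blast
  qed
qed

section \<open>The coordinate ring as a free module\<close>

lemma finite_total_max:
  assumes "finite T" "T \<noteq> {}" "trans r"
    and "\<And>x y. x \<in> T \<Longrightarrow> y \<in> T \<Longrightarrow> x \<noteq> y \<Longrightarrow> (x, y) \<in> r \<or> (y, x) \<in> r"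
  shows "\<exists>m\<in>T. \<forall>x\<in>T. x \<noteq> m \<longrightarrow> (x, m) \<in> r"
  using assms(1,2,4)
proof (induction T rule: finite_ne_induct)
  case (singleton x)
  then show ?case by simp
next
  case (insert x T)
  then obtain m where m: "m \<in> T" "\<forall>y\<in>T. y \<noteq> m \<longrightarrow> (y, m) \<in> r" by blast
  have "(x, m) \<in> r \<or> (m, x) \<in> r" using insert m by auto
  then show ?case
  proof
    assume "(x, m) \<in> r"
    with m show ?case by auto
  next
    assume mx: "(m, x) \<in> r"
    have "(y, x) \<in> r" if "y \<in> T" for y
      using m mx that transD[OF \<open>trans r\<close>] by metis
    then show ?case by auto
  qed
qed

lemma grlex_less_trans: "trans grlex_less"
  unfolding grlex_less_def by (intro trans_inv_image trans_lex_prod trans_less_than)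

lemma grlex_less_wf: "wf grlex_less"
  unfolding grlex_less_def by (intro wf_inv_image wf_lex_prod wf_less_than)

lemma grlex_less_total: "\<mu> \<noteq> \<nu> \<Longrightarrow> (\<mu>, \<nu>) \<in> grlex_less \<or> (\<nu>, \<mu>) \<in> grlex_less"
proof -
  assume "\<mu> \<noteq> \<nu>"
  obtain a b c e where \<mu>: "\<mu> = ((a, b), (c, e))" by (metis surj_pair)
  obtain a' b' c' e' where \<nu>: "\<nu> = ((a', b'), (c', e'))" by (metis surj_pair)
  show ?thesis
    using \<open>\<mu> \<noteq> \<nu>\<close> unfolding \<mu> \<nu> by (simp add: grlex_less_def mdeg_def) arith
qed

text \<open>Elimination without division: a vector \<open>t\<close> with nonzero
  \<open>b\<close>-coordinate is the pivot, and the others are cross-multiplied with it to clear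
  that coordinate. It is applied over C, to values at points, and over C[w], to find polynomial
  relations.\<close>

lemma idom_dependent:
  fixes v :: "'s \<Rightarrow> 'b \<Rightarrow> 'a::idom"
  assumes "finite I" "finite S" "card I < card S"
  shows "\<exists>c. (\<exists>s\<in>S. c s \<noteq> 0) \<and> (\<forall>b\<in>I. (\<Sum>s\<in>S. c s * v s b) = 0)"
  using assms
proof (induction I arbitrary: S v rule: finite_induct)
  case empty
  then have "S \<noteq> {}" by auto
  then show ?case by (intro exI[of _ "\<lambda>_. 1"]) auto
next
  case (insert b I)
  show ?case
  proof (cases "\<forall>s\<in>S. v s b = 0")
    case True
    have "card I < card S" using insert by simp
    from insert.IH[OF insert.prems(1) this, of v] True show ?thesis by auto
  next
    case False
    then obtain t where t: "t \<in> S" "v t b \<noteq> 0" by auto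
    define S' where "S' = S - {t}"
    have S': "finite S'" "card I < card S'" "S = insert t S'" "t \<notin> S'"
      using insert t by (auto simp: S'_def)
    from insert.IH[OF S'(1,2), of "\<lambda>s b'. v t b * v s b' - v s b * v t b'"]
    obtain c s0 where c: "s0 \<in> S'" "c s0 \<noteq> 0"
      "\<And>b'. b' \<in> I \<Longrightarrow> (\<Sum>s\<in>S'. c s * (v t b * v s b' - v s b * v t b')) = 0"
      by blast
    \<comment> \<open>A relation among the cleared vectors becomes one among the original ones: its
      coefficients are scaled by the pivot, and \<open>t\<close> absorbs the subtracted
      multiples.\<close>
    define e where "e = (\<lambda>s. if s = t then - (\<Sum>s\<in>S'. c s * v s b) else c s * v t b)"
    have sum_e: "(\<Sum>s\<in>S. e s * v s b') = (\<Sum>s\<in>S'. c s * (v t b * v s b' - v s b * v t b'))" for b'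
    proof -
      have "(\<Sum>s\<in>S. e s * v s b') = e t * v t b' + (\<Sum>s\<in>S'. e s * v s b')"
        using S' by simp
      also have "(\<Sum>s\<in>S'. e s * v s b') = (\<Sum>s\<in>S'. c s * v t b * v s b')"
        using S'(4) by (intro sum.cong) (auto simp: e_def)
      also have "e t * v t b' = - (\<Sum>s\<in>S'. c s * v s b * v t b')"
        by (simp add: e_def sum_distrib_right)
      finally show ?thesis by (simp add: algebra_simps sum_subtractf)
    qed
    have "e s0 \<noteq> 0" "s0 \<in> S" using c t S' by (auto simp: e_def)
    moreover have "(\<Sum>s\<in>S. e s * v s b') = 0" if "b' \<in> insert b I" for b'
      using that c(3) by (auto simp: sum_e mult.commute)
    ultimately show ?thesis by blast
  qed
qed

text \<open>The z^\<beta> with \<beta> in \<open>I\<close> form a basis of C[z] as a module over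
  C[w], where w acts through \<open>f\<close>. Uniqueness yields vanishing of the coefficients at
  every w in C^2, not only on the image of \<open>f\<close>; surjectivity of \<open>f\<close> is
  deduced from this.\<close>

locale finite_cover =
  fixes f :: "C2 \<Rightarrow> C2" and I :: "mindex set"
  assumes f_PF: "(\<lambda>z. fst (f z)) \<in> PF" "(\<lambda>z. snd (f z)) \<in> PF"
    and finite_I: "finite I" and zero_in_I: "(0, 0) \<in> I"
    and normal_form: "p \<in> PF \<Longrightarrow>
      \<exists>c. (\<forall>\<beta>. c \<beta> \<in> PF) \<and> (\<forall>z. p z = (\<Sum>\<beta>\<in>I. c \<beta> (f z) * mon2 \<beta> z))"
    and normal_form_unique: "(\<And>\<beta>. c \<beta> \<in> PF) \<Longrightarrow>
      (\<And>z. (\<Sum>\<beta>\<in>I. c \<beta> (f z) * mon2 \<beta> z) = 0) \<Longrightarrow> \<beta> \<in> I \<Longrightarrow> c \<beta> w = 0"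

text \<open>A monomial outside the basis equals on V a combination of smaller monomials;
  well-founded induction on \<open>grlex_less\<close> rewrites these in turn.\<close>

lemma normal_forms_span:
  assumes "p \<in> PF"
  shows "\<exists>q\<in>normal_forms f. \<forall>z. p z = q (f z, z)"
proof -
  define S where "S = {p. \<exists>q\<in>normal_forms f. \<forall>z. p z = q (f z, z)}"
  have sub: "cfun.subspace (normal_forms f)" unfolding normal_forms_def by (rule cfun.subspace_span)
  have S: "cfun.subspace S"
  proof (rule subspace_pointwiseI)
    show "(\<lambda>x. 0) \<in> S" unfolding S_def using subspace_zero[OF sub] by (auto intro!: bexI[of _ "\<lambda>x. 0"])
  next
    fix g h assume "g \<in> S" "h \<in> S"
    then obtain q r where "q \<in> normal_forms f" "r \<in> normal_forms f" "\<forall>z. g z = q (f z, z)" "\<forall>z. h z = r (f z, z)"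
      by (auto simp: S_def)
    then show "(\<lambda>x. g x + h x) \<in> S"
      unfolding S_def using subspace_add[OF sub, of q r] by (auto intro!: bexI[of _ "\<lambda>x. q x + r x"])
  next
    fix g c assume "g \<in> S"
    then obtain q where "q \<in> normal_forms f" "\<forall>z. g z = q (f z, z)"
      by (auto simp: S_def)
    then show "(\<lambda>x. c * g x) \<in> S"
      unfolding S_def using subspace_scale[OF sub, of q c] by (auto intro!: bexI[of _ "\<lambda>x. c * q x"])
  qed
  have mon: "(\<lambda>z. mon4 \<mu> (f z, z)) \<in> S" for \<mu>
  proof (induction \<mu> rule: wf_induct_rule[OF grlex_less_wf])
    case (1 \<mu>)
    show ?case
    proof (cases "\<mu> \<in> normal_basis f")
      case True
      then show ?thesis unfolding S_def normal_forms_def by (auto intro!: bexI[of _ "mon4 \<mu>"] cfun.span_base)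
    next
      case False
      then obtain q where q: "q \<in> cfun.span (mon4 ` {\<nu>. (\<nu>, \<mu>) \<in> grlex_less})"
        "\<forall>x\<in>graphV f. mon4 \<mu> x = q x"
        by (auto simp: normal_basis_def)
      have "cfun.subspace {q. (\<lambda>z. q (f z, z)) \<in> S}"
        by (rule subspace_pointwiseI) (auto intro: subspace_zero[OF S] subspace_add[OF S] subspace_scale[OF S])
      moreover have "mon4 ` {\<nu>. (\<nu>, \<mu>) \<in> grlex_less} \<subseteq> {q. (\<lambda>z. q (f z, z)) \<in> S}"
        using 1 by auto
      ultimately have "q \<in> {q. (\<lambda>z. q (f z, z)) \<in> S}" using q(1) cfun.span_minimal by blast
      moreover have "(\<lambda>z. mon4 \<mu> (f z, z)) = (\<lambda>z. q (f z, z))" using q(2) unfolding graphV_def by blast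
      ultimately show ?thesis by simp
    qed
  qed
  have "mon2 \<beta> \<in> S" for \<beta> using mon[of "((0, 0), \<beta>)"] by (simp add: mon4_def)
  moreover obtain k where "p \<in> polys_le k" using PF_polys_le[OF assms] .
  ultimately have "p \<in> S" unfolding polys_le_def using cfun.span_minimal[OF _ S] by blast
  then show ?thesis by (simp add: S_def)
qed

lemma normal_forms_coefficients:
  assumes "finite I" and nb: "normal_basis f = {(\<alpha>, \<beta>). \<beta> \<in> I}" and q: "q \<in> normal_forms f"
  shows "\<exists>c. (\<forall>\<beta>. c \<beta> \<in> PF) \<and> (\<forall>w z. q (w, z) = (\<Sum>\<beta>\<in>I. c \<beta> w * mon2 \<beta> z))"
proof -
  let ?S = "{q. \<exists>c. (\<forall>\<beta>. c \<beta> \<in> PF) \<and> (\<forall>w z. q (w, z) = (\<Sum>\<beta>\<in>I. c \<beta> w * mon2 \<beta> z))}"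
  have "cfun.subspace ?S"
  proof (rule subspace_pointwiseI; clarsimp)
    show "\<exists>c. (\<forall>a b. c (a, b) \<in> PF) \<and> (\<forall>a b aa ba. (\<Sum>\<beta>\<in>I. c \<beta> (a, b) * mon2 \<beta> (aa, ba)) = 0)"
      by (rule exI[of _ "\<lambda>_ _. 0"]) simp
  next
    fix g h c e
    assume "\<forall>a b. c (a, b) \<in> PF" "\<forall>a b aa ba. g ((a, b), aa, ba) = (\<Sum>\<beta>\<in>I. c \<beta> (a, b) * mon2 \<beta> (aa, ba))"
      "\<forall>a b. e (a, b) \<in> PF" "\<forall>a b aa ba. h ((a, b), aa, ba) = (\<Sum>\<beta>\<in>I. e \<beta> (a, b) * mon2 \<beta> (aa, ba))"
    then show "\<exists>d. (\<forall>a b. d (a, b) \<in> PF) \<and> (\<forall>a b aa ba. (\<Sum>\<beta>\<in>I. c \<beta> (a, b) * mon2 \<beta> (aa, ba)) +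
         (\<Sum>\<beta>\<in>I. e \<beta> (a, b) * mon2 \<beta> (aa, ba)) = (\<Sum>\<beta>\<in>I. d \<beta> (a, b) * mon2 \<beta> (aa, ba)))"
      by (intro exI[of _ "\<lambda>\<beta> w. c \<beta> w + e \<beta> w"]) (auto simp: algebra_simps sum.distrib)
  next
    fix g s c
    assume "\<forall>a b. c (a, b) \<in> PF" "\<forall>a b aa ba. g ((a, b), aa, ba) = (\<Sum>\<beta>\<in>I. c \<beta> (a, b) * mon2 \<beta> (aa, ba))"
    then show "\<exists>d. (\<forall>a b. d (a, b) \<in> PF) \<and> (\<forall>a b aa ba. s * (\<Sum>\<beta>\<in>I. c \<beta> (a, b) * mon2 \<beta> (aa, ba)) =
         (\<Sum>\<beta>\<in>I. d \<beta> (a, b) * mon2 \<beta> (aa, ba)))"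
      by (intro exI[of _ "\<lambda>\<beta> w. s * c \<beta> w"]) (auto simp: sum_distrib_left mult.assoc)
  qed
  moreover have "mon4 ` normal_basis f \<subseteq> ?S"
  proof clarify
    fix a1 a2 b1 b2 assume "((a1, a2), (b1, b2)) \<in> normal_basis f"
    then have b: "(b1, b2) \<in> I" using nb by simp
    show "\<exists>c. (\<forall>\<beta>. c \<beta> \<in> PF) \<and> (\<forall>w z. mon4 ((a1, a2), (b1, b2)) (w, z) = (\<Sum>\<beta>\<in>I. c \<beta> w * mon2 \<beta> z))"
    proof (intro exI conjI allI)
      let ?c = "\<lambda>\<beta> w. if \<beta> = (b1, b2) then mon2 (a1, a2) w else 0"
      show "?c \<beta> \<in> PF" for \<beta> by (cases "\<beta> = (b1, b2)") auto
      show "mon4 ((a1, a2), (b1, b2)) (w, z) = (\<Sum>\<beta>\<in>I. ?c \<beta> w * mon2 \<beta> z)" for w z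
        using assms(1) b by (simp add: mon4_def mult_delta_left)
    qed
  qed
  ultimately have "q \<in> ?S"
    using q cfun.span_minimal unfolding normal_forms_def by blast
  then show ?thesis by simp
qed

text \<open>A nontrivial relation could be solved for its largest monomial, which would then depend
  on earlier ones and be missing from the basis.\<close>

lemma normal_basis_unique:
  assumes fin: "finite I" and nb: "normal_basis f = {(\<alpha>, \<beta>). \<beta> \<in> I}"
    and c: "\<And>\<beta>. c \<beta> \<in> PF" and zero: "\<And>z. (\<Sum>\<beta>\<in>I. c \<beta> (f z) * mon2 \<beta> z) = 0" and \<beta>: "\<beta> \<in> I"
  shows "c \<beta> w = 0"
proof -
  have "\<forall>\<beta>. \<exists>k. c \<beta> \<in> polys_le k" using c PF_polys_le by metis
  then obtain k where k: "\<And>\<beta>. c \<beta> \<in> polys_le (k \<beta>)" by metis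
  define N where "N = (\<Sum>\<beta>\<in>I. k \<beta>)"
  have "c \<beta> \<in> polys_le N" if "\<beta> \<in> I" for \<beta>
    using k[of \<beta>] polys_le_mono[of "k \<beta>" N] member_le_sum[OF that, of k] fin by (auto simp: N_def)
  then have "\<forall>\<beta>\<in>I. \<exists>a. \<forall>z. c \<beta> z = (\<Sum>\<alpha>\<in>midx N. a \<alpha> * mon2 \<alpha> z)"
    unfolding polys_le_iff by blast
  then obtain a where a: "\<And>\<beta> z. \<beta> \<in> I \<Longrightarrow> c \<beta> z = (\<Sum>\<alpha>\<in>midx N. a \<beta> \<alpha> * mon2 \<alpha> z)" by metis
  define T where "T = {\<mu> \<in> midx N \<times> I. a (snd \<mu>) (fst \<mu>) \<noteq> 0}"
  have finT: "finite T" using fin by (simp add: T_def)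
  have sum0: "(\<Sum>\<mu>\<in>T. a (snd \<mu>) (fst \<mu>) * mon4 \<mu> (f z, z)) = 0" for z
  proof -
    have "(\<Sum>\<mu>\<in>T. a (snd \<mu>) (fst \<mu>) * mon4 \<mu> (f z, z)) = (\<Sum>\<mu>\<in>midx N \<times> I. a (snd \<mu>) (fst \<mu>) * mon4 \<mu> (f z, z))"
      by (rule sum.mono_neutral_left) (use fin in \<open>auto simp: T_def\<close>)
    also have "\<dots> = (\<Sum>\<alpha>\<in>midx N. \<Sum>\<beta>\<in>I. a \<beta> \<alpha> * mon4 (\<alpha>, \<beta>) (f z, z))"
      by (simp add: sum.cartesian_product case_prod_beta)
    also have "\<dots> = (\<Sum>\<beta>\<in>I. \<Sum>\<alpha>\<in>midx N. a \<beta> \<alpha> * mon4 (\<alpha>, \<beta>) (f z, z))"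
      by (rule sum.swap)
    also have "\<dots> = (\<Sum>\<beta>\<in>I. c \<beta> (f z) * mon2 \<beta> z)"
      by (intro sum.cong refl) (simp add: a mon4_def sum_distrib_right mult.assoc)
    finally show ?thesis using zero by simp
  qed
  have "T = {}"
  proof (rule ccontr)
    assume "T \<noteq> {}"
    then obtain \<mu> where \<mu>: "\<mu> \<in> T" and max: "\<And>\<nu>. \<nu> \<in> T \<Longrightarrow> \<nu> \<noteq> \<mu> \<Longrightarrow> (\<nu>, \<mu>) \<in> grlex_less"
      using finite_total_max[OF finT _ grlex_less_trans grlex_less_total] by blast
    let ?a = "\<lambda>\<nu>. a (snd \<nu>) (fst \<nu>)"
    let ?q = "\<lambda>x. \<Sum>\<nu>\<in>T-{\<mu>}. (- ?a \<nu> / ?a \<mu>) * mon4 \<nu> x"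
    have nz: "?a \<mu> \<noteq> 0" using \<mu> by (simp add: T_def)
    have "?q \<in> cfun.span (mon4 ` {\<nu>. (\<nu>, \<mu>) \<in> grlex_less})"
      by (intro subspace_sum[OF cfun.subspace_span] subspace_scale[OF cfun.subspace_span] cfun.span_base)
         (use max in auto)
    moreover have "mon4 \<mu> x = ?q x" if "x \<in> graphV f" for x
    proof -
      have "x = (f (snd x), snd x)" using that by (auto simp: graphV_def)
      then obtain z where x: "x = (f z, z)" by blast
      have "?a \<mu> * mon4 \<mu> x + (\<Sum>\<nu>\<in>T-{\<mu>}. ?a \<nu> * mon4 \<nu> x) = 0"
        using sum0[of z] sum.remove[OF finT \<mu>, of "\<lambda>\<nu>. ?a \<nu> * mon4 \<nu> x"] x by simp
      moreover have "?q x = - (\<Sum>\<nu>\<in>T-{\<mu>}. ?a \<nu> * mon4 \<nu> x) / ?a \<mu>"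
        by (simp add: sum_divide_distrib sum_negf)
      ultimately show ?thesis using nz by (simp add: field_simps add_eq_0_iff)
    qed
    ultimately have "\<mu> \<notin> normal_basis f" by (auto simp: normal_basis_def)
    moreover have "\<mu> \<in> normal_basis f" using \<mu> nb by (auto simp: T_def)
    ultimately show False by simp
  qed
  then have "a \<beta> \<alpha> = 0" if "\<alpha> \<in> midx N" for \<alpha>
    using that \<beta> unfolding T_def by fastforce
  then show ?thesis using a[OF \<beta>, of w] by simp
qed

lemma finite_cover_normal_basis:
  assumes "(\<lambda>z. fst (f z)) \<in> PF" "(\<lambda>z. snd (f z)) \<in> PF" and fin: "finite I" and "(0, 0) \<in> I"
    and nb: "normal_basis f = {(\<alpha>, \<beta>). \<beta> \<in> I}"
  shows "finite_cover f I"
proof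
  fix p assume "p \<in> PF"
  then obtain q where "q \<in> normal_forms f" "\<forall>z. p z = q (f z, z)" using normal_forms_span by blast
  then show "\<exists>c. (\<forall>\<beta>. c \<beta> \<in> PF) \<and> (\<forall>z. p z = (\<Sum>\<beta>\<in>I. c \<beta> (f z) * mon2 \<beta> z))"
    using normal_forms_coefficients[OF fin nb] by metis
qed (use assms normal_basis_unique[OF fin nb] in auto)

text \<open>p - p(a) lies in the ideal of the point a: differences of powers factor, which settles
  monomials, and linear combinations follow.\<close>

lemma PF_difference:
  assumes "p \<in> PF"
  shows "\<exists>A\<in>PF. \<exists>B\<in>PF. \<forall>z. p z - p a = (fst z - fst a) * A z + (snd z - snd a) * B z"
proof -
  let ?S = "{p. \<exists>A\<in>PF. \<exists>B\<in>PF. \<forall>z. p z - p a = (fst z - fst a) * A z + (snd z - snd a) * B z}"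
  have "cfun.subspace ?S"
  proof (rule subspace_pointwiseI)
    show "(\<lambda>x. 0) \<in> ?S" by (auto intro!: bexI[of _ "\<lambda>_. 0"])
  next
    fix g h assume "g \<in> ?S" "h \<in> ?S"
    then obtain A B A' B' where *: "A \<in> PF" "B \<in> PF" "A' \<in> PF" "B' \<in> PF"
      "\<And>z. g z - g a = (fst z - fst a) * A z + (snd z - snd a) * B z"
      "\<And>z. h z - h a = (fst z - fst a) * A' z + (snd z - snd a) * B' z" by blast
    have "(g z + h z) - (g a + h a) = (fst z - fst a) * (A z + A' z) + (snd z - snd a) * (B z + B' z)" for z
    proof -
      have "(g z + h z) - (g a + h a) = (g z - g a) + (h z - h a)" by simp
      then show ?thesis unfolding *(5,6) by (simp add: algebra_simps)
    qed
    then show "(\<lambda>x. g x + h x) \<in> ?S"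
      by (intro CollectI bexI[OF _ PF_add[OF *(1,3)]] bexI[OF _ PF_add[OF *(2,4)]] allI)
  next
    fix g c assume "g \<in> ?S"
    then obtain A B where *: "A \<in> PF" "B \<in> PF"
      "\<And>z. g z - g a = (fst z - fst a) * A z + (snd z - snd a) * B z" by blast
    have "c * g z - c * g a = (fst z - fst a) * (c * A z) + (snd z - snd a) * (c * B z)" for z
    proof -
      have "c * g z - c * g a = c * (g z - g a)" by (simp add: algebra_simps)
      then show ?thesis unfolding *(3) by (simp add: algebra_simps)
    qed
    then show "(\<lambda>x. c * g x) \<in> ?S"
      by (intro CollectI bexI[OF _ PF_mult[OF PF_const *(1)]] bexI[OF _ PF_mult[OF PF_const *(2)]] allI)
  qed
  moreover have "mon2 \<alpha> \<in> ?S" for \<alpha>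
  proof -
    let ?i = "fst \<alpha>" and ?j = "snd \<alpha>"
    let ?A = "\<lambda>z. (\<Sum>k<?i. fst a ^ (?i - Suc k) * fst z ^ k) * snd z ^ ?j"
    let ?B = "\<lambda>z. fst a ^ ?i * (\<Sum>k<?j. snd a ^ (?j - Suc k) * snd z ^ k)"
    have "mon2 \<alpha> z - mon2 \<alpha> a = (fst z - fst a) * ?A z + (snd z - snd a) * ?B z" for z
    proof -
      have "mon2 \<alpha> z - mon2 \<alpha> a =
          (fst z ^ ?i - fst a ^ ?i) * snd z ^ ?j + fst a ^ ?i * (snd z ^ ?j - snd a ^ ?j)"
        by (simp add: mon2_def algebra_simps)
      also have "\<dots> = (fst z - fst a) * ?A z + (snd z - snd a) * ?B z"
        by (simp only: power_diff_sumr2) (simp only: ac_simps)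
      finally show ?thesis .
    qed
    moreover have A: "?A \<in> PF" and B: "?B \<in> PF" by (auto intro!: PF_mult PF_sum PF_power)
    ultimately show ?thesis by (intro CollectI bexI[OF _ A] bexI[OF _ B] allI)
  qed
  moreover obtain k where "p \<in> polys_le k" using PF_polys_le[OF assms] .
  ultimately have "p \<in> ?S" unfolding polys_le_def using cfun.span_minimal[of _ ?S] by blast
  then show ?thesis by simp
qed

section \<open>The ideal of a fibre and its finite-dimensional quotient\<close>

context finite_cover
begin

lemma PF_comp_f: "p \<in> PF \<Longrightarrow> (\<lambda>z. p (f z)) \<in> PF"
  by (rule PF_compose[OF _ f_PF])

text \<open>The ideal of C[z] generated by the two components of f - w; the quotient is the
  coordinate ring of the fibre with multiplicities.\<close>

definition fibre_ideal :: "C2 \<Rightarrow> (C2 \<Rightarrow> complex) set" where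
  "fibre_ideal w = {p. \<exists>A\<in>PF. \<exists>B\<in>PF. \<forall>z. p z = (fst (f z) - fst w) * A z + (snd (f z) - snd w) * B z}"

lemma fibre_idealI:
  "A \<in> PF \<Longrightarrow> B \<in> PF \<Longrightarrow> (\<And>z. p z = (fst (f z) - fst w) * A z + (snd (f z) - snd w) * B z) \<Longrightarrow>
    p \<in> fibre_ideal w"
  unfolding fibre_ideal_def by blast

lemma fibre_ideal_add:
  assumes "p \<in> fibre_ideal w" "q \<in> fibre_ideal w"
  shows "(\<lambda>z. p z + q z) \<in> fibre_ideal w"
proof -
  from assms obtain A B A' B' where *: "A \<in> PF" "B \<in> PF" "A' \<in> PF" "B' \<in> PF"
    "\<And>z. p z = (fst (f z) - fst w) * A z + (snd (f z) - snd w) * B z"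
    "\<And>z. q z = (fst (f z) - fst w) * A' z + (snd (f z) - snd w) * B' z"
    unfolding fibre_ideal_def by blast
  show ?thesis
    by (rule fibre_idealI[of "\<lambda>z. A z + A' z" "\<lambda>z. B z + B' z"]) (simp_all add: * PF_add algebra_simps)
qed

lemma fibre_ideal_mult:
  assumes "p \<in> fibre_ideal w" "q \<in> PF"
  shows "(\<lambda>z. q z * p z) \<in> fibre_ideal w"
proof -
  from assms obtain A B where *: "A \<in> PF" "B \<in> PF"
    "\<And>z. p z = (fst (f z) - fst w) * A z + (snd (f z) - snd w) * B z"
    unfolding fibre_ideal_def by blast
  show ?thesis
    by (rule fibre_idealI[of "\<lambda>z. q z * A z" "\<lambda>z. q z * B z"]) (simp_all add: * PF_mult assms algebra_simps)
qed

lemma fibre_ideal_diff: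
  assumes "p \<in> fibre_ideal w" "q \<in> fibre_ideal w"
  shows "(\<lambda>z. p z - q z) \<in> fibre_ideal w"
  using fibre_ideal_add[OF assms(1) fibre_ideal_mult[OF assms(2) PF_const[of "-1"]]] by simp

lemma fibre_ideal_0: "(\<lambda>z. 0) \<in> fibre_ideal w"
  by (rule fibre_idealI[of "\<lambda>_. 0" "\<lambda>_. 0"]) auto

lemma fibre_ideal_sum: "(\<And>i. i \<in> A \<Longrightarrow> p i \<in> fibre_ideal w) \<Longrightarrow> (\<lambda>z. \<Sum>i\<in>A. p i z) \<in> fibre_ideal w"
  by (induction A rule: infinite_finite_induct) (auto intro: fibre_ideal_0 fibre_ideal_add)

lemma fibre_ideal_const_mult:
  assumes "(\<lambda>z. c * p z) \<in> fibre_ideal w" "c \<noteq> 0"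
  shows "p \<in> fibre_ideal w"
  using fibre_ideal_mult[OF assms(1) PF_const[of "inverse c"]] assms(2) by (simp add: mult.assoc[symmetric])

text \<open>Modulo the ideal, functions of f(z) become constants, so normal forms reduce to complex
  combinations of the z^\<beta>.\<close>

lemma fibre_ideal_eval:
  assumes "c \<in> PF"
  shows "(\<lambda>z. c (f z) - c w) \<in> fibre_ideal w"
proof -
  from PF_difference[OF assms, of w] obtain A B where *: "A \<in> PF" "B \<in> PF"
    "\<And>z. c z - c w = (fst z - fst w) * A z + (snd z - snd w) * B z" by blast
  show ?thesis
    by (rule fibre_idealI[of "\<lambda>z. A (f z)" "\<lambda>z. B (f z)"]) (use * PF_comp_f in auto)
qed

text \<open>Expanding both cofactors in normal form gives a relation whose coefficient at \<beta> is
  x_\<beta> minus multiples of u_1 - w_1 and u_2 - w_2. It vanishes for all u, and u = w leaves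
  x_\<beta> = 0. Together with \<open>fibre_ideal_eval\<close>, the quotient has dimension
  |I|.\<close>

lemma fibre_ideal_independent:
  assumes "(\<lambda>z. \<Sum>\<beta>\<in>I. x \<beta> * mon2 \<beta> z) \<in> fibre_ideal w" "\<beta> \<in> I"
  shows "x \<beta> = 0"
proof -
  from assms(1) obtain A B where AB: "A \<in> PF" "B \<in> PF" and
    eq: "\<And>z. (\<Sum>\<beta>\<in>I. x \<beta> * mon2 \<beta> z) = (fst (f z) - fst w) * A z + (snd (f z) - snd w) * B z"
    by (auto simp: fibre_ideal_def)
  obtain a where a: "\<And>\<beta>. a \<beta> \<in> PF" "\<And>z. A z = (\<Sum>\<beta>\<in>I. a \<beta> (f z) * mon2 \<beta> z)"
    using normal_form[OF AB(1)] by blast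
  obtain b where b: "\<And>\<beta>. b \<beta> \<in> PF" "\<And>z. B z = (\<Sum>\<beta>\<in>I. b \<beta> (f z) * mon2 \<beta> z)"
    using normal_form[OF AB(2)] by blast
  let ?c = "\<lambda>\<beta> u. x \<beta> - (fst u - fst w) * a \<beta> u - (snd u - snd w) * b \<beta> u"
  have "?c \<beta> w = 0"
  proof (rule normal_form_unique[of ?c, OF _ _ assms(2)])
    show "?c \<beta> \<in> PF" for \<beta> using a b by (intro PF_diff PF_mult) auto
    show "(\<Sum>\<beta>\<in>I. ?c \<beta> (f z) * mon2 \<beta> z) = 0" for z
      using eq[of z] by (simp add: a b sum_distrib_left algebra_simps sum_subtractf sum.distrib)
  qed
  then show ?thesis by simp
qed

lemma one_notin_fibre_ideal: "(\<lambda>z. 1) \<notin> fibre_ideal w"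
proof
  assume "(\<lambda>z. 1) \<in> fibre_ideal w"
  moreover have "(\<Sum>\<beta>\<in>I. (if \<beta> = (0, 0) then 1 else 0) * mon2 \<beta> z) = 1" for z
    using finite_I zero_in_I by (simp add: mult_delta_left)
  ultimately show False
    using fibre_ideal_independent[of "\<lambda>\<beta>. if \<beta> = (0, 0) then 1 else 0" w "(0, 0)"] zero_in_I by simp
qed

text \<open>The powers of g up to g^|I| outnumber the dimension of the quotient. A dependence
  between their coefficients at the single point w is enough, by
  \<open>fibre_ideal_eval\<close>.\<close>

lemma fibre_ideal_algebraic:
  assumes g: "g \<in> PF"
  shows "\<exists>\<rho>. \<rho> \<noteq> 0 \<and> (\<lambda>z. poly \<rho> (g z)) \<in> fibre_ideal w"
proof -
  have "\<forall>i. \<exists>c. (\<forall>\<beta>. c \<beta> \<in> PF) \<and> (\<forall>z. g z ^ i = (\<Sum>\<beta>\<in>I. c \<beta> (f z) * mon2 \<beta> z))"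
    using normal_form[OF PF_power[OF g]] by blast
  then obtain c where c: "\<And>i \<beta>. c i \<beta> \<in> PF" "\<And>i z. g z ^ i = (\<Sum>\<beta>\<in>I. c i \<beta> (f z) * mon2 \<beta> z)"
    by metis
  obtain x i where x: "i \<le> card I" "x i \<noteq> 0" "\<And>\<beta>. \<beta> \<in> I \<Longrightarrow> (\<Sum>i\<le>card I. x i * c i \<beta> w) = 0"
    using idom_dependent[OF finite_I, of "{..card I}" "\<lambda>i \<beta>. c i \<beta> w"] by auto
  define \<rho> where "\<rho> = (\<Sum>i\<le>card I. Polynomial.monom (x i) i)"
  have "coeff \<rho> i = x i" using x(1) by (simp add: \<rho>_def coeff_sum)
  then have "\<rho> \<noteq> 0" using x(2) by auto
  moreover have "(\<lambda>z. poly \<rho> (g z)) \<in> fibre_ideal w"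
  proof -
    have "poly \<rho> (g z) = (\<Sum>i\<le>card I. \<Sum>\<beta>\<in>I. (x i * mon2 \<beta> z) * (c i \<beta> (f z) - c i \<beta> w))" for z
    proof -
      have "(\<Sum>i\<le>card I. \<Sum>\<beta>\<in>I. (x i * mon2 \<beta> z) * c i \<beta> w) = (\<Sum>\<beta>\<in>I. mon2 \<beta> z * (\<Sum>i\<le>card I. x i * c i \<beta> w))"
        by (subst sum.swap) (simp add: sum_distrib_left algebra_simps)
      also have "\<dots> = 0" using x(3) by simp
      finally have "(\<Sum>i\<le>card I. \<Sum>\<beta>\<in>I. (x i * mon2 \<beta> z) * c i \<beta> w) = 0" .
      then show ?thesis
        by (simp add: \<rho>_def poly_sum poly_monom c(2) sum_distrib_left right_diff_distrib sum_subtractf algebra_simps)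
    qed
    moreover have "(\<lambda>z. \<Sum>i\<le>card I. \<Sum>\<beta>\<in>I. (x i * mon2 \<beta> z) * (c i \<beta> (f z) - c i \<beta> w)) \<in> fibre_ideal w"
      by (intro fibre_ideal_sum fibre_ideal_mult fibre_ideal_eval c PF_mult PF_const PF_mon2)
    ultimately show ?thesis by presburger
  qed
  ultimately show ?thesis by blast
qed

text \<open>Take the polynomial \<rho> of least degree such that \<rho>(g) kills the class of
  \<open>h0\<close>. Splitting off a linear factor leaves a multiple of \<open>h0\<close> that is
  nonzero in the quotient and killed by g - l.\<close>

lemma fibre_ideal_eigenvector:
  assumes h0: "h0 \<in> PF" "h0 \<notin> fibre_ideal w" and g: "g \<in> PF"
  obtains q l where "q \<in> PF" "(\<lambda>z. q z * h0 z) \<notin> fibre_ideal w" "(\<lambda>z. (g z - l) * (q z * h0 z)) \<in> fibre_ideal w"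
proof -
  let ?R = "\<lambda>\<rho>. \<rho> \<noteq> 0 \<and> (\<lambda>z. poly \<rho> (g z) * h0 z) \<in> fibre_ideal w"
  obtain \<rho>0 where "\<rho>0 \<noteq> 0" "(\<lambda>z. poly \<rho>0 (g z)) \<in> fibre_ideal w" using fibre_ideal_algebraic[OF g] by blast
  then have "?R \<rho>0" using fibre_ideal_mult[OF _ h0(1), of "\<lambda>z. poly \<rho>0 (g z)" w] by (simp add: mult.commute)
  then obtain \<rho> where \<rho>: "?R \<rho>" and min: "\<And>\<sigma>. ?R \<sigma> \<Longrightarrow> degree \<rho> \<le> degree \<sigma>"
    using ex_has_least_nat[of ?R \<rho>0 degree] by blast
  have "degree \<rho> \<noteq> 0"
  proof
    assume "degree \<rho> = 0"
    then obtain c where "\<rho> = [:c:]" by (metis degree_eq_zeroE)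
    then show False using \<rho> h0(2) fibre_ideal_const_mult[of c h0 w] by simp
  qed
  then obtain l where "poly \<rho> l = 0" using fundamental_theorem_of_algebra_alt[of \<rho>] by fastforce
  then obtain \<sigma> where \<sigma>: "\<rho> = [:-l, 1:] * \<sigma>" by (metis dvdE poly_eq_0_iff_dvd)
  have "\<sigma> \<noteq> 0" using \<sigma> \<rho> by auto
  moreover have "degree \<sigma> < degree \<rho>" using \<open>\<sigma> \<noteq> 0\<close> unfolding \<sigma> by (subst degree_mult_eq) auto
  ultimately have "(\<lambda>z. poly \<sigma> (g z) * h0 z) \<notin> fibre_ideal w" using min[of \<sigma>] by auto
  moreover have "(\<lambda>z. poly \<sigma> (g z)) \<in> PF"
    unfolding poly_altdef using g by (intro PF_sum PF_mult PF_power PF_const)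
  moreover have "(\<lambda>z. (g z - l) * (poly \<sigma> (g z) * h0 z)) \<in> fibre_ideal w"
    using \<rho> by (simp add: \<sigma> algebra_simps)
  ultimately show thesis using that by blast
qed

text \<open>A nonzero element of the quotient by the fibre ideal has a multiple which is a common
  eigenvector of the two coordinates; the eigenvalues form a point of the fibre.\<close>

lemma fibre_ideal_socle:
  assumes h0: "h0 \<in> PF" "h0 \<notin> fibre_ideal w"
  obtains q a where "q \<in> PF" "(\<lambda>z. q z * h0 z) \<notin> fibre_ideal w" "f a = w"
    "\<And>p. p \<in> PF \<Longrightarrow> (\<lambda>z. (p z - p a) * (q z * h0 z)) \<in> fibre_ideal w"
proof -
  obtain q1 l where q1: "q1 \<in> PF" "(\<lambda>z. q1 z * h0 z) \<notin> fibre_ideal w"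
    "(\<lambda>z. (fst z - l) * (q1 z * h0 z)) \<in> fibre_ideal w"
    using fibre_ideal_eigenvector[OF h0 PF_fst] by blast
  \<comment> \<open>Restarting from the eigenvector of z_1 keeps its eigenvalue equation, since the
    ideal is stable under multiplication by \<open>q2\<close>.\<close>
  obtain q2 m where q2: "q2 \<in> PF" "(\<lambda>z. q2 z * (q1 z * h0 z)) \<notin> fibre_ideal w"
    "(\<lambda>z. (snd z - m) * (q2 z * (q1 z * h0 z))) \<in> fibre_ideal w"
    using fibre_ideal_eigenvector[OF PF_mult[OF q1(1) h0(1)] q1(2) PF_snd] by blast
  define q where "q = (\<lambda>z. q2 z * q1 z)"
  define a where "a = (l, m)"
  have q: "q \<in> PF" "(\<lambda>z. q z * h0 z) \<notin> fibre_ideal w"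
    using q1 q2 by (auto simp: q_def mult.assoc)
  have eigen: "(\<lambda>z. (p z - p a) * (q z * h0 z)) \<in> fibre_ideal w" if p: "p \<in> PF" for p
  proof -
    obtain A B where AB: "A \<in> PF" "B \<in> PF" "\<And>z. p z - p a = (fst z - l) * A z + (snd z - m) * B z"
      using PF_difference[OF p, of a] unfolding a_def fst_conv snd_conv by blast
    have "(\<lambda>z. (A z * q2 z) * ((fst z - l) * (q1 z * h0 z)) + B z * ((snd z - m) * (q2 z * (q1 z * h0 z)))) \<in> fibre_ideal w"
      by (intro fibre_ideal_add fibre_ideal_mult q1 q2 AB PF_mult)
    then show ?thesis by (simp add: AB(3) q_def algebra_simps)
  qed
  \<comment> \<open>Multiplication by p acts on the eigenvector as p(a); if p is congruent to y it
    also acts as y. Applied to the components of f, which are congruent to those of w, this puts a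
    in the fibre.\<close>
  have "p a = y" if "p \<in> PF" "(\<lambda>z. p z - y) \<in> fibre_ideal w" for p y
  proof (rule ccontr)
    assume "p a \<noteq> y"
    have "(\<lambda>z. (q z * h0 z) * (p z - y) - (p z - p a) * (q z * h0 z)) \<in> fibre_ideal w"
      by (intro fibre_ideal_diff eigen that fibre_ideal_mult PF_mult q h0)
    moreover have "(q z * h0 z) * (p z - y) - (p z - p a) * (q z * h0 z) = (p a - y) * (q z * h0 z)" for z
      by (simp add: algebra_simps)
    ultimately show False using q(2) fibre_ideal_const_mult[of "p a - y" "\<lambda>z. q z * h0 z" w] \<open>p a \<noteq> y\<close> by simp
  qed
  from this[OF f_PF(1), of "fst w"] this[OF f_PF(2), of "snd w"] have "f a = w"
    using fibre_ideal_eval[of fst w] fibre_ideal_eval[of snd w] by (auto simp: prod_eq_iff)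
  with q eigen show thesis using that by blast
qed

lemma surj_f: "\<exists>z. f z = w"
  using fibre_ideal_socle[OF PF_const one_notin_fibre_ideal] by metis

text \<open>\<open>red\<close> says that the fibre is reduced at each of its points a: factors not
  vanishing at a kill z_1 - a_1 and z_2 - a_2. If p were outside the ideal, its multiple q p from
  the socle would vanish at a, so the product of \<open>A\<close> and \<open>B\<close> would kill
  it, although that product acts on it as the nonzero scalar A(a) B(a).\<close>

lemma fibre_ideal_radical:
  assumes p: "p \<in> PF" "\<And>a. f a = w \<Longrightarrow> p a = 0"
    and red: "\<And>a. f a = w \<Longrightarrow> \<exists>A\<in>PF. \<exists>B\<in>PF. A a \<noteq> 0 \<and> B a \<noteq> 0 \<and>
      (\<lambda>z. A z * (fst z - fst a)) \<in> fibre_ideal w \<and> (\<lambda>z. B z * (snd z - snd a)) \<in> fibre_ideal w"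
  shows "p \<in> fibre_ideal w"
proof (rule ccontr)
  assume "p \<notin> fibre_ideal w"
  from fibre_ideal_socle[OF p(1) this] obtain q a where q: "q \<in> PF" "(\<lambda>z. q z * p z) \<notin> fibre_ideal w" "f a = w"
    "\<And>r. r \<in> PF \<Longrightarrow> (\<lambda>z. (r z - r a) * (q z * p z)) \<in> fibre_ideal w" by blast
  from red[OF q(3)] obtain A B where AB: "A \<in> PF" "B \<in> PF" "A a \<noteq> 0" "B a \<noteq> 0"
    "(\<lambda>z. A z * (fst z - fst a)) \<in> fibre_ideal w" "(\<lambda>z. B z * (snd z - snd a)) \<in> fibre_ideal w" by blast
  from PF_difference[OF PF_mult[OF q(1) p(1)], of a] p(2)[OF q(3)] obtain X Y where XY: "X \<in> PF" "Y \<in> PF"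
    "\<And>z. q z * p z = (fst z - fst a) * X z + (snd z - snd a) * Y z" by auto
  have "(\<lambda>z. (B z * X z) * (A z * (fst z - fst a)) + (A z * Y z) * (B z * (snd z - snd a))) \<in> fibre_ideal w"
    by (intro fibre_ideal_add fibre_ideal_mult PF_mult AB XY)
  then have 1: "(\<lambda>z. (A z * B z) * (q z * p z)) \<in> fibre_ideal w"
    unfolding XY(3) by (simp add: algebra_simps)
  have diff_eq: "x * y - (x - c) * y = c * y" for x y c :: complex by (simp add: algebra_simps)
  have "(\<lambda>z. (A z * B z) * (q z * p z) - (A z * B z - A a * B a) * (q z * p z)) \<in> fibre_ideal w"
    by (intro fibre_ideal_diff 1 q(4)[of "\<lambda>z. A z * B z"] PF_mult AB)
  then have "(\<lambda>z. (A a * B a) * (q z * p z)) \<in> fibre_ideal w"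
    unfolding diff_eq .
  then show False using fibre_ideal_const_mult[of "A a * B a" "\<lambda>z. q z * p z" w] q(2) AB by simp
qed

end

declare split_paired_All [simp del] split_paired_Ex [simp del]

section \<open>Fibres with the maximal number of points\<close>

lemma ev2_sum: "ev2 (\<Sum>i\<in>A. P i) z = (\<Sum>i\<in>A. ev2 (P i) z)"
  by (simp add: ev2_def poly_sum)

text \<open>The divided difference (F(s) - F(t)) / (s - t) of F(X) = sum of c_i(w) X^i, written as a
  polynomial so that s = t is allowed; there it is F'(t).\<close>

definition dquot :: "(nat \<Rightarrow> C2 \<Rightarrow> complex) \<Rightarrow> nat \<Rightarrow> C2 \<Rightarrow> complex \<Rightarrow> complex \<Rightarrow> complex" where
  "dquot c m w s t = (\<Sum>i\<le>m. c i w * (\<Sum>j<i. t ^ (i - Suc j) * s ^ j))"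

lemma dquot_mult: "(s - t) * dquot c m w s t = (\<Sum>i\<le>m. c i w * s ^ i) - (\<Sum>i\<le>m. c i w * t ^ i)"
proof -
  have "(s - t) * dquot c m w s t = (\<Sum>i\<le>m. c i w * ((s - t) * (\<Sum>j<i. t ^ (i - Suc j) * s ^ j)))"
    unfolding dquot_def sum_distrib_left[of "s - t" _ "{..m}"] by (simp only: mult.left_commute)
  then show ?thesis
    by (simp only: power_diff_sumr2[symmetric] right_diff_distrib sum_subtractf)
qed

lemma dquot_diag: "dquot c m w t t = (\<Sum>i\<le>m. of_nat i * c i w * t ^ (i - 1))"
proof -
  have "(\<Sum>j<i. t ^ (i - Suc j) * t ^ j) = of_nat i * t ^ (i - 1)" for i
    by (simp add: power_add[symmetric])
  then show ?thesis by (simp add: dquot_def mult.assoc mult.left_commute)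
qed

context finite_cover
begin

text \<open>Properness of f. The vector of all z^\<beta> is an eigenvector, with eigenvalue g(z), of
  the matrix of multiplication by g over C[w], whose entries are bounded on \<open>K\<close>.
  Comparison at the largest entry of the vector bounds g(z); that entry has modulus at least 1
  because \<open>I\<close> contains the exponent of the constant 1.\<close>

lemma bounded_on_preimage:
  assumes g: "g \<in> PF" and K: "bounded K"
  obtains C where "C \<ge> 1" "\<And>z. f z \<in> K \<Longrightarrow> cmod (g z) \<le> C"
proof -
  have "\<forall>\<beta>. \<exists>c. (\<forall>\<gamma>. c \<gamma> \<in> PF) \<and> (\<forall>z. g z * mon2 \<beta> z = (\<Sum>\<gamma>\<in>I. c \<gamma> (f z) * mon2 \<gamma> z))"
    using normal_form[OF PF_mult[OF g PF_mon2]] by blast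
  then obtain c where c: "\<And>\<beta> \<gamma>. c \<beta> \<gamma> \<in> PF" "\<And>\<beta> z. g z * mon2 \<beta> z = (\<Sum>\<gamma>\<in>I. c \<beta> \<gamma> (f z) * mon2 \<gamma> z)"
    by metis
  obtain C where C: "C \<ge> 1" "\<And>i z. i \<in> I \<times> I \<Longrightarrow> z \<in> K \<Longrightarrow> cmod (c (fst i) (snd i) z) \<le> C"
    using PF_bounded_finite[of "I \<times> I" "\<lambda>i. c (fst i) (snd i)" K] finite_I c K by auto
  have n: "card I \<ge> 1" using finite_I zero_in_I by (simp add: Suc_le_eq card_gt_0_iff) blast
  show thesis
  proof (rule that[of "real (card I) * C"])
    show "1 \<le> real (card I) * C" using C(1) n mult_mono[of 1 "real (card I)" 1 C] by simp
    fix z assume z: "f z \<in> K"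
    obtain \<beta> where \<beta>: "\<beta> \<in> I" "\<And>\<gamma>. \<gamma> \<in> I \<Longrightarrow> cmod (mon2 \<gamma> z) \<le> cmod (mon2 \<beta> z)"
    proof -
      have "Max ((\<lambda>\<gamma>. cmod (mon2 \<gamma> z)) ` I) \<in> (\<lambda>\<gamma>. cmod (mon2 \<gamma> z)) ` I"
        using finite_I zero_in_I by (intro Max_in) auto
      then obtain \<beta> where "\<beta> \<in> I" "Max ((\<lambda>\<gamma>. cmod (mon2 \<gamma> z)) ` I) = cmod (mon2 \<beta> z)" by auto
      then show thesis
        using that[of \<beta>] Max_ge[of "(\<lambda>\<gamma>. cmod (mon2 \<gamma> z)) ` I"] finite_I by auto
    qed
    have pos: "cmod (mon2 \<beta> z) \<ge> 1" using \<beta>(2)[OF zero_in_I] by simp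
    have "cmod (g z) * cmod (mon2 \<beta> z) = cmod (\<Sum>\<gamma>\<in>I. c \<beta> \<gamma> (f z) * mon2 \<gamma> z)"
      by (simp add: c(2)[symmetric] norm_mult)
    also have "\<dots> \<le> (\<Sum>\<gamma>\<in>I. C * cmod (mon2 \<beta> z))"
      using C(2)[of "(\<beta>, _)" "f z"] \<beta> z C(1)
      by (intro order.trans[OF norm_sum] sum_mono) (auto simp: norm_mult intro!: mult_mono)
    also have "\<dots> = real (card I) * C * cmod (mon2 \<beta> z)" by simp
    finally show "cmod (g z) \<le> real (card I) * C"
      by (rule mult_right_le_imp_le) (use pos in linarith)
  qed
qed

text \<open>An equation for g over C[w] of degree at most m. Some coefficient has to be nonzero, not
  necessarily the leading one, so minimality of m excludes every shorter nontrivial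
  equation.\<close>

definition relation :: "(C2 \<Rightarrow> complex) \<Rightarrow> nat \<Rightarrow> (nat \<Rightarrow> C2 \<Rightarrow> complex) \<Rightarrow> bool" where
  "relation g m c \<longleftrightarrow> (\<forall>i. c i \<in> PF) \<and> (\<exists>i\<le>m. \<exists>w. c i w \<noteq> 0) \<and> (\<forall>z. (\<Sum>i\<le>m. c i (f z) * g z ^ i) = 0)"

text \<open>The |I| + 1 powers of g lie in a module of rank |I| and are therefore dependent over the
  domain C[w].\<close>

lemma relation_exists:
  assumes g: "g \<in> PF"
  shows "\<exists>m c. relation g m c"
proof -
  have "\<forall>i. \<exists>c. (\<forall>\<beta>. c \<beta> \<in> PF) \<and> (\<forall>z. g z ^ i = (\<Sum>\<beta>\<in>I. c \<beta> (f z) * mon2 \<beta> z))"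
    using normal_form[OF PF_power[OF g]] by blast
  then obtain c where c: "\<And>i \<beta>. c i \<beta> \<in> PF" "\<And>i z. g z ^ i = (\<Sum>\<beta>\<in>I. c i \<beta> (f z) * mon2 \<beta> z)"
    by metis
  have "\<forall>i \<beta>. \<exists>P. c i \<beta> = ev2 P" using c(1) unfolding PF_def by blast
  then obtain P where P: "\<And>i \<beta>. c i \<beta> = ev2 (P i \<beta>)" by metis
  obtain x i where x: "i \<le> card I" "x i \<noteq> 0" "\<And>\<beta>. \<beta> \<in> I \<Longrightarrow> (\<Sum>i\<le>card I. x i * P i \<beta>) = 0"
    using idom_dependent[OF finite_I, of "{..card I}" P] by auto
  have "(\<Sum>i\<le>card I. ev2 (x i) (f z) * g z ^ i) = 0" for z
  proof -
    have "(\<Sum>i\<le>card I. ev2 (x i) (f z) * g z ^ i) =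
        (\<Sum>\<beta>\<in>I. \<Sum>i\<le>card I. ev2 (x i * P i \<beta>) (f z) * mon2 \<beta> z)"
      by (subst sum.swap) (simp add: c(2) P ev2_mult sum_distrib_left mult.assoc)
    also have "\<dots> = (\<Sum>\<beta>\<in>I. ev2 (\<Sum>i\<le>card I. x i * P i \<beta>) (f z) * mon2 \<beta> z)"
      by (simp add: ev2_sum sum_distrib_right)
    also have "\<dots> = 0" using x(3) by (simp add: ev2_def)
    finally show ?thesis .
  qed
  moreover have "\<exists>w. ev2 (x i) w \<noteq> 0" using x(2) ev2_eq_0_iff by blast
  ultimately have "relation g (card I) (\<lambda>i. ev2 (x i))"
    using x(1) unfolding relation_def PF_def by blast
  then show ?thesis by blast
qed

lemma minimal_relation:
  assumes "g \<in> PF"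
  obtains m c where "relation g m c" "\<And>m' c'. m' < m \<Longrightarrow> \<not> relation g m' c'"
  using relation_exists[OF assms] LeastI_ex[of "\<lambda>m. \<exists>c. relation g m c"]
    not_less_Least[of _ "\<lambda>m. \<exists>c. relation g m c"] by metis

lemma vanishes_on_image: "(\<And>z. c (f z) = 0) \<Longrightarrow> c w = 0"
  using surj_f[of w] by auto

lemma relation_pos: "relation g m c \<Longrightarrow> m > 0"
  using vanishes_on_image[of "c 0"] by (cases m) (auto simp: relation_def)

text \<open>The derivative of the minimal equation is shorter, so if it held identically all its
  coefficients would vanish. In characteristic 0 only the constant coefficient would remain, and the
  equation kills that too, f being onto.\<close>

lemma minimal_relation_derivative:
  assumes rel: "relation g m c" and min: "\<And>m' c'. m' < m \<Longrightarrow> \<not> relation g m' c'"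
  shows "\<exists>z. dquot c m (f z) (g z) (g z) \<noteq> 0"
proof (rule ccontr)
  assume "\<nexists>z. dquot c m (f z) (g z) (g z) \<noteq> 0"
  then have zero: "(\<Sum>i\<le>m. of_nat i * c i (f z) * g z ^ (i - 1)) = 0" for z
    by (simp add: dquot_diag)
  obtain k where m: "m = Suc k" using relation_pos[OF rel] gr0_implies_Suc by blast
  let ?c' = "\<lambda>i w. of_nat (Suc i) * c (Suc i) w"
  have "(\<Sum>i\<le>k. ?c' i (f z) * g z ^ i) = 0" for z
    using zero[of z] by (simp add: m sum.atMost_Suc_shift del: sum.atMost_Suc)
  moreover have "?c' i \<in> PF" for i
    using rel by (intro PF_mult PF_const) (auto simp: relation_def)
  moreover have "\<not> relation g k ?c'" by (rule min) (simp add: m)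
  ultimately have "\<forall>i\<le>k. \<forall>w. ?c' i w = 0" unfolding relation_def by blast
  then have cS: "c (Suc i) w = 0" if "i \<le> k" for i w
    using that by (metis mult_eq_0_iff of_nat_eq_0_iff nat.distinct(1))
  have "c 0 (f z) = 0" for z
  proof -
    have "(\<Sum>i\<le>m. c i (f z) * g z ^ i) = 0" using rel by (simp add: relation_def)
    then show ?thesis using cS by (simp add: m sum.atMost_Suc_shift del: sum.atMost_Suc)
  qed
  then have c0: "c 0 w = 0" for w by (rule vanishes_on_image)
  have "c i w = 0" if "i \<le> m" for i w
    using that c0 cS by (cases i) (auto simp: m)
  then show False using rel by (auto simp: relation_def)
qed

text \<open>The constant coefficient of the minimal equation is a multiple of g, much like a norm.
  It is not zero: otherwise g could be cancelled in the domain C[z], leaving a shorter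
  equation.\<close>

lemma divides_image_polynomial:
  assumes g: "g \<in> PF" "\<exists>z. g z \<noteq> 0"
  obtains P h where "P \<in> PF" "h \<in> PF" "\<exists>w. P w \<noteq> 0" "\<And>z. P (f z) = g z * h z"
proof -
  obtain m c where rel: "relation g m c" and min: "\<And>m' c'. m' < m \<Longrightarrow> \<not> relation g m' c'"
    using minimal_relation[OF g(1)] by blast
  obtain k where m: "m = Suc k" using relation_pos[OF rel] gr0_implies_Suc by blast
  have c: "c i \<in> PF" for i using rel by (simp add: relation_def)
  define h where "h = (\<lambda>z. - 1 * (\<Sum>i\<le>k. c (Suc i) (f z) * g z ^ i))"
  have h: "h \<in> PF" unfolding h_def by (intro PF_mult PF_const PF_sum PF_power PF_comp_f c g)
  have eq: "c 0 (f z) = g z * h z" for z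
  proof -
    have "(\<Sum>i\<le>m. c i (f z) * g z ^ i) = 0" using rel by (simp add: relation_def)
    then show ?thesis
      by (simp add: m h_def sum.atMost_Suc_shift sum_distrib_left algebra_simps eq_neg_iff_add_eq_0 del: sum.atMost_Suc)
  qed
  have "\<exists>w. c 0 w \<noteq> 0"
  proof (rule ccontr)
    assume c0: "\<nexists>w. c 0 w \<noteq> 0"
    have "g z * h z = 0" for z using c0 eq[of z] by metis
    then have "\<forall>z. h z = 0" using PF_nonzero_mult[OF g(1) h g(2)] by blast
    then have "\<forall>z. (\<Sum>i\<le>k. c (Suc i) (f z) * g z ^ i) = 0" by (simp add: h_def)
    moreover have "\<not> relation g k (\<lambda>i. c (Suc i))" by (rule min) (simp add: m)
    ultimately have cS: "\<forall>i\<le>k. \<forall>w. c (Suc i) w = 0" unfolding relation_def using c by blast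
    have "c i w = 0" if "i \<le> m" for i w
      using that c0 cS by (cases i) (auto simp: m)
    then show False using rel by (auto simp: relation_def)
  qed
  with c h eq show thesis using that by blast
qed

text \<open>Kernels on pairs of points, given by a matrix over C[w] in the basis. Equality is
  demanded only for pairs in a common fibre, where both points can be reduced to normal form with
  the same w.\<close>

definition bipoly :: "(C2 \<Rightarrow> C2 \<Rightarrow> C2 \<Rightarrow> complex) \<Rightarrow> bool" where
  "bipoly k \<longleftrightarrow> (\<exists>b. (\<forall>\<beta> \<gamma>. b \<beta> \<gamma> \<in> PF) \<and> (\<forall>w z \<zeta>. f z = w \<longrightarrow> f \<zeta> = w \<longrightarrow>
     k w z \<zeta> = (\<Sum>\<beta>\<in>I. \<Sum>\<gamma>\<in>I. mon2 \<beta> z * (b \<beta> \<gamma> w * mon2 \<gamma> \<zeta>))))"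

lemma bipoly_mult:
  assumes c: "c \<in> PF" and p: "p \<in> PF" and q: "q \<in> PF"
  shows "bipoly (\<lambda>w z \<zeta>. c w * (p z * q \<zeta>))"
proof -
  obtain a where a: "\<And>\<beta>. a \<beta> \<in> PF" "\<And>z. p z = (\<Sum>\<beta>\<in>I. a \<beta> (f z) * mon2 \<beta> z)"
    using normal_form[OF p] by blast
  obtain b where b: "\<And>\<beta>. b \<beta> \<in> PF" "\<And>z. q z = (\<Sum>\<beta>\<in>I. b \<beta> (f z) * mon2 \<beta> z)"
    using normal_form[OF q] by blast
  show ?thesis
    unfolding bipoly_def
  proof (intro exI conjI allI impI)
    show "(\<lambda>w. c w * (a \<beta> w * b \<gamma> w)) \<in> PF" for \<beta> \<gamma> using a b c by (intro PF_mult)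
    fix w z \<zeta> assume "f z = w" "f \<zeta> = w"
    then show "c w * (p z * q \<zeta>) = (\<Sum>\<beta>\<in>I. \<Sum>\<gamma>\<in>I. mon2 \<beta> z * ((c w * (a \<beta> w * b \<gamma> w)) * mon2 \<gamma> \<zeta>))"
      by (simp add: a b sum_product sum_distrib_left mult_ac)
  qed
qed

lemma bipoly_add:
  assumes "bipoly k" "bipoly l"
  shows "bipoly (\<lambda>w z \<zeta>. k w z \<zeta> + l w z \<zeta>)"
proof -
  from assms obtain b c where *: "\<And>\<beta> \<gamma>. b \<beta> \<gamma> \<in> PF" "\<And>\<beta> \<gamma>. c \<beta> \<gamma> \<in> PF"
    "\<And>w z \<zeta>. f z = w \<Longrightarrow> f \<zeta> = w \<Longrightarrow> k w z \<zeta> = (\<Sum>\<beta>\<in>I. \<Sum>\<gamma>\<in>I. mon2 \<beta> z * (b \<beta> \<gamma> w * mon2 \<gamma> \<zeta>))"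
    "\<And>w z \<zeta>. f z = w \<Longrightarrow> f \<zeta> = w \<Longrightarrow> l w z \<zeta> = (\<Sum>\<beta>\<in>I. \<Sum>\<gamma>\<in>I. mon2 \<beta> z * (c \<beta> \<gamma> w * mon2 \<gamma> \<zeta>))"
    unfolding bipoly_def by blast
  show ?thesis
    unfolding bipoly_def
    by (rule exI[of _ "\<lambda>\<beta> \<gamma> w. b \<beta> \<gamma> w + c \<beta> \<gamma> w"])
       (simp add: PF_add * algebra_simps sum.distrib)
qed

lemma bipoly_sum:
  assumes "finite A" "\<And>i. i \<in> A \<Longrightarrow> bipoly (k i)"
  shows "bipoly (\<lambda>w z \<zeta>. \<Sum>i\<in>A. k i w z \<zeta>)"
  using assms
proof (induction A rule: finite_induct)
  case empty
  then show ?case using bipoly_mult[of "\<lambda>_. 0" "\<lambda>_. 0" "\<lambda>_. 0"] by simp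
next
  case (insert i A)
  then show ?case using bipoly_add[of "k i"] by simp
qed

lemma bipoly_dquot:
  assumes c: "\<And>i. c i \<in> PF" and e: "\<And>i. e i \<in> PF"
  shows "bipoly (\<lambda>w z \<zeta>. dquot c m w (fst z) (fst \<zeta>) * dquot e n w (snd z) (snd \<zeta>))"
proof -
  have "(\<lambda>w z \<zeta>. dquot c m w (fst z) (fst \<zeta>) * dquot e n w (snd z) (snd \<zeta>)) =
    (\<lambda>w z \<zeta>. \<Sum>i\<le>m. \<Sum>i'\<le>n. \<Sum>j<i. \<Sum>j'<i'. (c i w * e i' w) *
        ((fst z ^ j * snd z ^ j') * (fst \<zeta> ^ (i - Suc j) * snd \<zeta> ^ (i' - Suc j'))))"
  proof (intro ext)
    fix w z \<zeta>
    have 1: "(x * (\<Sum>j<i. y j)) * (x' * (\<Sum>j<i'. y' j)) = (\<Sum>j<i. \<Sum>j'<i'. (x * x') * (y j * y' j'))"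
      for x x' :: complex and y y' i i'
    proof -
      have "(x * (\<Sum>j<i. y j)) * (x' * (\<Sum>j<i'. y' j)) = (x * x') * ((\<Sum>j<i. y j) * (\<Sum>j<i'. y' j))"
        by (simp only: mult_ac)
      also have "\<dots> = (\<Sum>j<i. \<Sum>j'<i'. (x * x') * (y j * y' j'))"
        by (simp only: sum_product) (simp only: sum_distrib_left)
      finally show ?thesis .
    qed
    show "dquot c m w (fst z) (fst \<zeta>) * dquot e n w (snd z) (snd \<zeta>) =
      (\<Sum>i\<le>m. \<Sum>i'\<le>n. \<Sum>j<i. \<Sum>j'<i'. (c i w * e i' w) *
        ((fst z ^ j * snd z ^ j') * (fst \<zeta> ^ (i - Suc j) * snd \<zeta> ^ (i' - Suc j'))))"
      unfolding dquot_def sum_product 1 by (simp only: mult_ac)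
  qed
  moreover have "bipoly \<dots>"
    by (intro bipoly_sum finite_atMost finite_lessThan bipoly_mult PF_mult PF_power c e PF_fst PF_snd)
  ultimately show ?thesis by simp
qed

text \<open>A combination of the z^\<beta> that vanishes on a reduced fibre lies in the ideal, hence
  is trivial; fewer than |I| points would admit a nontrivial one. An infinite fibre is not excluded,
  it would simply supply enough points.\<close>

lemma fibre_separates:
  assumes red: "\<And>a. f a = w \<Longrightarrow> \<exists>A\<in>PF. \<exists>B\<in>PF. A a \<noteq> 0 \<and> B a \<noteq> 0 \<and>
      (\<lambda>z. A z * (fst z - fst a)) \<in> fibre_ideal w \<and> (\<lambda>z. B z * (snd z - snd a)) \<in> fibre_ideal w"
  obtains \<zeta> :: "mindex \<Rightarrow> C2" where "inj_on \<zeta> I" "\<And>i. i \<in> I \<Longrightarrow> f (\<zeta> i) = w"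
proof -
  let ?F = "{a. f a = w}"
  have "infinite ?F \<or> card I \<le> card ?F"
  proof (rule ccontr)
    assume "\<not> (infinite ?F \<or> card I \<le> card ?F)"
    then obtain x \<beta> where x: "\<beta> \<in> I" "x \<beta> \<noteq> 0" "\<And>a. f a = w \<Longrightarrow> (\<Sum>\<beta>\<in>I. x \<beta> * mon2 \<beta> a) = 0"
      using idom_dependent[of ?F I mon2] finite_I by auto
    have "(\<lambda>z. \<Sum>\<beta>\<in>I. x \<beta> * mon2 \<beta> z) \<in> fibre_ideal w"
      by (rule fibre_ideal_radical[OF _ x(3) red]) (intro PF_sum PF_mult PF_const PF_mon2)
    then show False using fibre_ideal_independent x by blast
  qed
  then obtain T where T: "T \<subseteq> ?F" "card T = card I" "finite T"
    using infinite_arbitrarily_large[of ?F "card I"] obtain_subset_with_card_n[of "card I" ?F]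
    by metis
  then obtain \<zeta> where "bij_betw \<zeta> I T" using finite_same_card_bij[OF finite_I, of T] by auto
  then show thesis using T that[of \<zeta>] by (auto simp: bij_betw_def)
qed

text \<open>The matrix \<open>E\<close> of the basis at the points of the fibre satisfies \<open>E\<^sup>T B E = diag G\<close>, where \<open>B\<close> holds
  the coefficients of the product of the two difference quotients and \<open>G\<close> is its value on the diagonal.\<close>

lemma fibre_determinant:
  obtains P where "P \<in> PF" "\<exists>w. P w \<noteq> 0"
    "\<And>K. bounded K \<Longrightarrow> \<exists>C>0. \<forall>w\<in>K. P w \<noteq> 0 \<longrightarrow> (\<exists>\<zeta>. (\<forall>i\<in>I. f (\<zeta> i) = w) \<and>
       cmod (P w) ^ card I \<le> C * cmod (sdet I (\<lambda>\<beta> i. mon2 \<beta> (\<zeta> i))) ^ 2)"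
proof -
  obtain m c where c: "relation fst m c" "\<And>m' c'. m' < m \<Longrightarrow> \<not> relation fst m' c'"
    using minimal_relation[OF PF_fst] by blast
  obtain n e where e: "relation snd n e" "\<And>m' c'. m' < n \<Longrightarrow> \<not> relation snd m' c'"
    using minimal_relation[OF PF_snd] by blast
  have cPF: "c i \<in> PF" and ePF: "e i \<in> PF" for i using c e by (auto simp: relation_def)
  have crel: "(\<Sum>i\<le>m. c i (f z) * fst z ^ i) = 0" and erel: "(\<Sum>i\<le>n. e i (f z) * snd z ^ i) = 0" for z
    using c e by (auto simp: relation_def)
  \<comment> \<open>Distinct points of a fibre differ in z_1 or in z_2, and the divided difference
    of that coordinate then vanishes, both values being roots of the same equation.\<close>
  define \<kappa> where "\<kappa> = (\<lambda>w z \<zeta>. dquot c m w (fst z) (fst \<zeta>) * dquot e n w (snd z) (snd \<zeta>))"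
  define G where "G = (\<lambda>z. \<kappa> (f z) z z)"
  have d_PF: "(\<lambda>z. dquot c m (f z) (fst z) (fst z)) \<in> PF" "(\<lambda>z. dquot e n (f z) (snd z) (snd z)) \<in> PF"
    unfolding dquot_diag
    by (intro PF_sum PF_mult PF_const PF_power PF_comp_f cPF PF_fst)
       (intro PF_sum PF_mult PF_const PF_power PF_comp_f ePF PF_snd)
  have G: "G \<in> PF" "\<exists>z. G z \<noteq> 0"
    unfolding G_def \<kappa>_def
    using PF_mult[OF d_PF] PF_nonzero_mult[OF d_PF] minimal_relation_derivative[OF c]
      minimal_relation_derivative[OF e] by auto
  \<comment> \<open>One polynomial on the base controls the diagonal values at all points over w at
    once.\<close>
  obtain P h where P: "P \<in> PF" "h \<in> PF" "\<exists>w. P w \<noteq> 0" "\<And>z. P (f z) = G z * h z"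
    using divides_image_polynomial[OF G] by blast
  have "bipoly \<kappa>" unfolding \<kappa>_def by (rule bipoly_dquot[OF cPF ePF])
  then obtain b where b: "\<And>\<beta> \<gamma>. b \<beta> \<gamma> \<in> PF" "\<And>w z \<zeta>. f z = w \<Longrightarrow> f \<zeta> = w \<Longrightarrow>
     \<kappa> w z \<zeta> = (\<Sum>\<beta>\<in>I. \<Sum>\<gamma>\<in>I. mon2 \<beta> z * (b \<beta> \<gamma> w * mon2 \<gamma> \<zeta>))"
    unfolding bipoly_def by blast
  have off_diag: "\<kappa> w z \<zeta> = 0" if "f z = w" "f \<zeta> = w" "z \<noteq> \<zeta>" for w z \<zeta>
  proof -
    have "(fst z - fst \<zeta>) * dquot c m w (fst z) (fst \<zeta>) = 0" "(snd z - snd \<zeta>) * dquot e n w (snd z) (snd \<zeta>) = 0"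
      unfolding dquot_mult using crel[of z] crel[of \<zeta>] erel[of z] erel[of \<zeta>] that by auto
    then show ?thesis using that(3) by (auto simp: \<kappa>_def prod_eq_iff)
  qed
  have sep: "\<exists>A\<in>PF. \<exists>B\<in>PF. A a \<noteq> 0 \<and> B a \<noteq> 0 \<and>
      (\<lambda>z. A z * (fst z - fst a)) \<in> fibre_ideal w \<and> (\<lambda>z. B z * (snd z - snd a)) \<in> fibre_ideal w"
    if Pw: "P w \<noteq> 0" and a: "f a = w" for w a
  proof (rule bexI[of _ "\<lambda>z. dquot c m w (fst z) (fst a)"], rule bexI[of _ "\<lambda>z. dquot e n w (snd z) (snd a)"], intro conjI)
    let ?A = "\<lambda>z. dquot c m w (fst z) (fst a)" and ?B = "\<lambda>z. dquot e n w (snd z) (snd a)"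
    have "G a \<noteq> 0" using P(4)[of a] Pw a by auto
    then show "?A a \<noteq> 0" "?B a \<noteq> 0" using a by (auto simp: G_def \<kappa>_def)
    show "?A \<in> PF" "?B \<in> PF"
      unfolding dquot_def by (intro PF_sum PF_mult PF_const PF_power PF_fst PF_snd)+
    have diff: "(\<lambda>z. \<Sum>i\<le>k. (-1 * g z ^ i) * (x i (f z) - x i w)) \<in> fibre_ideal w"
      if "\<And>i. x i \<in> PF" "g \<in> PF" for x k g
      by (intro fibre_ideal_sum fibre_ideal_mult fibre_ideal_eval PF_mult PF_const PF_power that)
    \<comment> \<open>Since a lies over w, the product is the equation at z_1 with coefficients
      frozen at w. Subtracting the true relation, with coefficients at f(z), leaves differences that
      lie in the ideal.\<close>
    have "?A z * (fst z - fst a) = (\<Sum>i\<le>m. (-1 * fst z ^ i) * (c i (f z) - c i w))" for z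
    proof -
      have "?A z * (fst z - fst a) = (\<Sum>i\<le>m. c i w * fst z ^ i) - (\<Sum>i\<le>m. c i (f z) * fst z ^ i)"
        using dquot_mult[of "fst z" "fst a" c m w] crel[of z] crel[of a] a by (simp add: mult.commute)
      then show ?thesis by (simp add: sum_subtractf[symmetric] algebra_simps)
    qed
    then show "(\<lambda>z. ?A z * (fst z - fst a)) \<in> fibre_ideal w"
      using diff[of c fst m] cPF by simp
    have "?B z * (snd z - snd a) = (\<Sum>i\<le>n. (-1 * snd z ^ i) * (e i (f z) - e i w))" for z
    proof -
      have "?B z * (snd z - snd a) = (\<Sum>i\<le>n. e i w * snd z ^ i) - (\<Sum>i\<le>n. e i (f z) * snd z ^ i)"
        using dquot_mult[of "snd z" "snd a" e n w] erel[of z] erel[of a] a by (simp add: mult.commute)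
      then show ?thesis by (simp add: sum_subtractf[symmetric] algebra_simps)
    qed
    then show "(\<lambda>z. ?B z * (snd z - snd a)) \<in> fibre_ideal w"
      using diff[of e snd n] ePF by simp
  qed
  show thesis
  proof (rule that[OF P(1,3)])
    fix K :: "C2 set" assume K: "bounded K"
    obtain H where H: "H \<ge> 1" "\<And>z. f z \<in> K \<Longrightarrow> cmod (h z) \<le> H"
      using bounded_on_preimage[OF P(2) K] by blast
    obtain C where C: "C \<ge> 1" "\<And>i z. i \<in> I \<times> I \<Longrightarrow> z \<in> K \<Longrightarrow> cmod (b (fst i) (snd i) z) \<le> C"
      using PF_bounded_finite[of "I \<times> I" "\<lambda>i. b (fst i) (snd i)" K] finite_I b K by auto
    let ?D = "fact (card I) * C ^ card I"
    have D: "?D > 0" using C by simp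
    show "\<exists>C>0. \<forall>w\<in>K. P w \<noteq> 0 \<longrightarrow> (\<exists>\<zeta>. (\<forall>i\<in>I. f (\<zeta> i) = w) \<and>
       cmod (P w) ^ card I \<le> C * cmod (sdet I (\<lambda>\<beta> i. mon2 \<beta> (\<zeta> i))) ^ 2)"
    proof (intro exI[of _ "H ^ card I * ?D"] conjI ballI impI)
      show "H ^ card I * ?D > 0" using H D by simp
      fix w assume w: "w \<in> K" "P w \<noteq> 0"
      obtain \<zeta> where inj: "inj_on \<zeta> I" and \<zeta>: "\<And>i. i \<in> I \<Longrightarrow> f (\<zeta> i) = w"
        using fibre_separates[OF sep[OF w(2)]] by blast
      let ?E = "\<lambda>\<beta> i. mon2 \<beta> (\<zeta> i)"
      let ?M = "\<lambda>i j. \<Sum>\<beta>\<in>I. ?E \<beta> i * (\<Sum>\<gamma>\<in>I. b \<beta> \<gamma> w * ?E \<gamma> j)"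
      have M: "?M i j = (if i = j then G (\<zeta> i) else 0)" if "i \<in> I" "j \<in> I" for i j
      proof -
        have "?M i j = \<kappa> w (\<zeta> i) (\<zeta> j)"
          using b(2)[OF \<zeta>[OF that(1)] \<zeta>[OF that(2)]] by (simp add: sum_distrib_left)
        then show ?thesis
          using off_diag[OF \<zeta>[OF that(1)] \<zeta>[OF that(2)]] inj that \<zeta> by (auto simp: G_def inj_on_def)
      qed
      have "sdet I ?M = sdet I (\<lambda>i \<beta>. ?E \<beta> i) * (sdet I (\<lambda>\<beta> \<gamma>. b \<beta> \<gamma> w) * sdet I ?E)"
        by (simp only: sdet_mult[OF finite_I])
      also have "\<dots> = sdet I (\<lambda>\<beta> \<gamma>. b \<beta> \<gamma> w) * sdet I ?E ^ 2"
        by (simp add: sdet_transpose[OF finite_I, of ?E] power2_eq_square)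
      finally have det1: "sdet I ?M = sdet I (\<lambda>\<beta> \<gamma>. b \<beta> \<gamma> w) * sdet I ?E ^ 2" .
      obtain key :: "mindex \<Rightarrow> nat" where key: "inj_on key I"
        using finite_imp_inj_to_nat_seg[OF finite_I] by blast
      have "sdet I ?M = (\<Prod>i\<in>I. ?M i i)"
      proof (rule sdet_triangular[OF finite_I key])
        fix i j assume "i \<in> I" "j \<in> I" "key i < key j"
        then show "?M i j = 0" using M[of i j] by (cases "i = j") simp_all
      qed
      then have det2: "sdet I ?M = (\<Prod>i\<in>I. G (\<zeta> i))" by (simp add: M cong: prod.cong)
      have "cmod (P w) ^ card I = (\<Prod>i\<in>I. cmod (P w))" by simp
      also have "\<dots> \<le> (\<Prod>i\<in>I. H * cmod (G (\<zeta> i)))"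
      proof (rule prod_mono, intro conjI)
        fix i assume "i \<in> I"
        then show "cmod (P w) \<le> H * cmod (G (\<zeta> i))"
          using P(4)[of "\<zeta> i"] \<zeta> H(2)[of "\<zeta> i"] w by (simp add: norm_mult mult.commute mult_right_mono)
      qed simp
      also have "\<dots> = H ^ card I * cmod (sdet I ?M)"
        unfolding det2 by (simp add: prod.distrib prod_norm)
      also have "\<dots> \<le> H ^ card I * (?D * cmod (sdet I ?E) ^ 2)"
      proof -
        have "cmod (b \<beta> \<gamma> w) \<le> C" if "\<beta> \<in> I" "\<gamma> \<in> I" for \<beta> \<gamma>
          using C(2)[of "(\<beta>, \<gamma>)" w] that w by simp
        then have "cmod (sdet I (\<lambda>\<beta> \<gamma>. b \<beta> \<gamma> w)) \<le> ?D" by (intro norm_sdet_le finite_I)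
        then show ?thesis
          unfolding det1 norm_mult norm_power using H(1) by (intro mult_left_mono mult_right_mono) auto
      qed
      finally show "\<exists>\<zeta>. (\<forall>i\<in>I. f (\<zeta> i) = w) \<and>
          cmod (P w) ^ card I \<le> H ^ card I * ?D * cmod (sdet I (\<lambda>\<beta> i. mon2 \<beta> (\<zeta> i))) ^ 2"
        using \<zeta> by (intro exI[of _ \<zeta>]) (simp add: mult.assoc)
    qed
  qed
qed

end

section \<open>Vandermonde suprema\<close>

text \<open>\<open>Van\<close> for a family indexed by a set; the points carry the same labels as
  the rows.\<close>

definition vand :: "'i set \<Rightarrow> ('i \<Rightarrow> 'x \<Rightarrow> complex) \<Rightarrow> 'x set \<Rightarrow> real" where
  "vand A e E = (SUP \<zeta> \<in> {\<zeta>. \<forall>a\<in>A. \<zeta> a \<in> E}. cmod (sdet A (\<lambda>i j. e i (\<zeta> j))))"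

lemma Van_eq_vand:
  assumes g: "bij_betw g {..<n} A" and e': "\<And>j. j < n \<Longrightarrow> e' j = e (g j)"
  shows "Van e' n E = vand A e E"
proof -
  have det: "sdet A (\<lambda>i j. e i (\<xi> j)) = sdet {..<n} (\<lambda>i j. e' i (\<xi> (g j)))" for \<xi>
    unfolding sdet_reindex[OF g finite_lessThan] by (rule sdet_cong) (simp add: e')
  have "(\<lambda>\<zeta>. cmod (sdet {..<n} (\<lambda>i j. e' i (\<zeta> j)))) ` {\<zeta>. \<forall>k<n. \<zeta> k \<in> E} =
    (\<lambda>\<xi>. cmod (sdet A (\<lambda>i j. e i (\<xi> j)))) ` {\<xi>. \<forall>a\<in>A. \<xi> a \<in> E}" (is "?l ` ?X = ?r ` ?Y")
  proof (intro equalityI subsetI)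
    fix y assume "y \<in> ?l ` ?X"
    then obtain \<zeta> where \<zeta>: "\<forall>k<n. \<zeta> k \<in> E" and y: "y = ?l \<zeta>" by auto
    let ?\<xi> = "\<zeta> \<circ> inv_into {..<n} g"
    have inv: "inv_into {..<n} g (g j) = j" if "j < n" for j
      using g that by (simp add: bij_betw_def)
    have "?r ?\<xi> = ?l \<zeta>"
      unfolding det by (intro arg_cong[of _ _ cmod] sdet_cong) (simp add: inv)
    moreover have "?\<xi> \<in> ?Y"
      using \<zeta> bij_betw_inv_into[OF g] by (auto simp: bij_betw_def)
    ultimately show "y \<in> ?r ` ?Y" unfolding y by (intro image_eqI[of _ _ ?\<xi>]) simp_all
  next
    fix y assume "y \<in> ?r ` ?Y"
    then obtain \<xi> where \<xi>: "\<forall>a\<in>A. \<xi> a \<in> E" and y: "y = ?r \<xi>" by auto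
    have "\<forall>k<n. \<xi> (g k) \<in> E" using \<xi> g by (auto simp: bij_betw_def)
    then show "y \<in> ?l ` ?X" unfolding y det by (intro image_eqI[of _ _ "\<lambda>k. \<xi> (g k)"]) auto
  qed
  then show ?thesis by (simp add: Van_def vand_def sdet_eq_det)
qed

lemma vand_reindex:
  assumes "bij_betw g A B" "finite A"
  shows "vand B e E = vand A (\<lambda>i. e (g i)) E"
proof -
  obtain b where b: "bij_betw b {..<card A} A"
    using ex_bij_betw_nat_finite[OF assms(2)] by (auto simp: atLeast0LessThan)
  have "vand A (\<lambda>i. e (g i)) E = Van (\<lambda>j. e (g (b j))) (card A) E"
    by (rule Van_eq_vand[OF b, symmetric]) simp
  also have "\<dots> = vand B e E"
    by (rule Van_eq_vand[OF bij_betw_trans[OF b assms(1)]]) simp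
  finally show ?thesis by simp
qed

lemma vand_cong:
  assumes "\<And>i x. i \<in> A \<Longrightarrow> x \<in> E \<Longrightarrow> e i x = e' i x"
  shows "vand A e E = vand A e' E"
  unfolding vand_def
  by (intro arg_cong[where f=Sup] image_cong refl arg_cong[where f=cmod] sdet_cong) (auto simp: assms)

text \<open>Guarantees that the set of determinants is bounded above, without which a real supremum
  carries no information.\<close>

definition bounded_rows :: "'i set \<Rightarrow> ('i \<Rightarrow> 'x \<Rightarrow> complex) \<Rightarrow> 'x set \<Rightarrow> bool" where
  "bounded_rows A e E \<longleftrightarrow> (\<exists>C. \<forall>i\<in>A. \<forall>x\<in>E. cmod (e i x) \<le> C)"

lemma bounded_rows_subset: "bounded_rows A e E \<Longrightarrow> B \<subseteq> A \<Longrightarrow> bounded_rows B e E"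
  unfolding bounded_rows_def by blast

lemma vand_upper:
  assumes "finite A" "bounded_rows A e E" "\<And>a. a \<in> A \<Longrightarrow> \<zeta> a \<in> E"
  shows "cmod (sdet A (\<lambda>i j. e i (\<zeta> j))) \<le> vand A e E"
  unfolding vand_def
proof (rule cSUP_upper)
  obtain C where "\<forall>i\<in>A. \<forall>x\<in>E. cmod (e i x) \<le> C" using assms(2) by (auto simp: bounded_rows_def)
  then show "bdd_above ((\<lambda>\<zeta>. cmod (sdet A (\<lambda>i j. e i (\<zeta> j)))) ` {\<zeta>. \<forall>a\<in>A. \<zeta> a \<in> E})"
    by (intro bdd_aboveI2[where M="fact (card A) * C ^ card A"] norm_sdet_le assms) auto
qed (use assms in auto)

lemma vand_least:
  assumes "E \<noteq> {}" "\<And>\<zeta>. (\<And>a. a \<in> A \<Longrightarrow> \<zeta> a \<in> E) \<Longrightarrow> cmod (sdet A (\<lambda>i j. e i (\<zeta> j))) \<le> M"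
  shows "vand A e E \<le> M"
  unfolding vand_def
proof (rule cSUP_least)
  obtain x where "x \<in> E" using assms(1) by auto
  then show "{\<zeta>. \<forall>a\<in>A. \<zeta> a \<in> E} \<noteq> {}" by (auto intro!: exI[of _ "\<lambda>_. x"])
qed (use assms in auto)

lemma vand_nonneg:
  assumes "finite A" "bounded_rows A e E" "E \<noteq> {}"
  shows "0 \<le> vand A e E"
proof -
  obtain x where "x \<in> E" using assms(3) by auto
  then show ?thesis using vand_upper[OF assms(1,2), of "\<lambda>_. x"] by (meson norm_ge_zero order.trans)
qed

text \<open>Both minors in the Laplace expansion use points of the given configuration, so each is
  bounded by its own supremum.\<close>

lemma vand_union_le:
  assumes fin: "finite A" "finite B" "A \<inter> B = {}" and bd: "bounded_rows (A \<union> B) e E" and "E \<noteq> {}"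
  shows "vand (A \<union> B) e E \<le> 2 ^ (card A + card B) * (vand A e E * vand B e E)"
proof (rule vand_least[OF \<open>E \<noteq> {}\<close>])
  fix \<zeta> assume \<zeta>: "\<And>a. a \<in> A \<union> B \<Longrightarrow> \<zeta> a \<in> E"
  have bdA: "bounded_rows A e E" and bdB: "bounded_rows B e E"
    using bounded_rows_subset[OF bd] by auto
  show "cmod (sdet (A \<union> B) (\<lambda>i j. e i (\<zeta> j))) \<le> 2 ^ (card A + card B) * (vand A e E * vand B e E)"
  proof (rule norm_sdet_union_le[OF fin])
    fix q assume q: "q permutes A \<union> B"
    have "\<zeta> (q j) \<in> E" if "j \<in> A \<union> B" for j using \<zeta> permutes_in_image[OF q, of j] that by blast
    then show "cmod (sdet A (\<lambda>i j. e i (\<zeta> (q j)))) \<le> vand A e E"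
      "cmod (sdet B (\<lambda>i j. e i (\<zeta> (q j)))) \<le> vand B e E"
      using vand_upper[OF fin(1) bdA, of "\<lambda>j. \<zeta> (q j)"] vand_upper[OF fin(2) bdB, of "\<lambda>j. \<zeta> (q j)"] by auto
  qed
qed

text \<open>O(k) rows with entries of size M^O(k) contribute only exp(O(k^2)). One \<open>c\<close>
  serves both for the number of rows and for the exponent.\<close>

lemma vand_few_rows:
  fixes M :: real and c k :: nat
  assumes fin: "finite B" and card: "card B \<le> c * (k + 1)" and M: "M \<ge> 1"
    and bd: "\<And>i x. i \<in> B \<Longrightarrow> x \<in> E \<Longrightarrow> cmod (e i x) \<le> M ^ (c * (k + 1))" and E: "E \<noteq> {}"
  shows "vand B e E \<le> ((exp (real c) * M ^ c) ^ c) ^ ((k + 1)\<^sup>2)"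
proof -
  let ?r = "card B"
  have "vand B e E \<le> fact ?r * (M ^ (c * (k + 1))) ^ ?r"
    by (intro vand_least[OF E] norm_sdet_le fin bd) auto
  \<comment> \<open>Wasteful but sufficient: r! is at most r^r, and r is at most exp(c(k +
    1)).\<close>
  also have "fact ?r \<le> exp (real c * real (k + 1)) ^ ?r"
  proof -
    have "(fact ?r :: real) \<le> real ?r ^ ?r" using fact_le_power[of ?r, where 'a=real] by simp
    also have "\<dots> \<le> exp (real c * real (k + 1)) ^ ?r"
    proof (rule power_mono)
      have "real ?r \<le> real (c * (k + 1))" using card of_nat_le_iff by blast
      also have "\<dots> \<le> exp (real c * real (k + 1))"
        using exp_ge_add_one_self[of "real c * real (k + 1)"] unfolding of_nat_mult by linarith
      finally show "real ?r \<le> exp (real c * real (k + 1))" .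
    qed simp
    finally show ?thesis .
  qed
  also have "exp (real c * real (k + 1)) ^ ?r * (M ^ (c * (k + 1))) ^ ?r = ((exp (real c) * M ^ c) ^ (k + 1)) ^ ?r"
    by (simp only: power_mult_distrib power_mult exp_of_nat_mult[symmetric] mult.commute[of "real c"])
  also have "\<dots> \<le> ((exp (real c) * M ^ c) ^ (k + 1)) ^ (c * (k + 1))"
  proof (rule power_increasing[OF card one_le_power])
    show "1 \<le> exp (real c) * M ^ c" using mult_mono[of 1 "exp (real c)" 1 "M ^ c"] M by simp
  qed
  also have "\<dots> = ((exp (real c) * M ^ c) ^ c) ^ ((k + 1)\<^sup>2)"
  proof -
    have "(k + 1) * (c * (k + 1)) = c * (k + 1)\<^sup>2" by (simp only: power2_eq_square mult_ac)
    then show ?thesis by (simp only: power_mult[symmetric])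
  qed
  finally show ?thesis using M by simp
qed

lemma sdet_scale_columns: "sdet A (\<lambda>i j. c j * M i j) = (\<Prod>j\<in>A. c j) * sdet A M"
  unfolding sdet_def sum_distrib_left
proof (intro sum.cong refl, clarify)
  fix p assume "p permutes A"
  then have "(\<Prod>i\<in>A. c (p i)) = (\<Prod>j\<in>A. c j)"
    by (intro prod.reindex_bij_betw permutes_imp_bij)
  then show "of_int (sign p) * (\<Prod>i\<in>A. c (p i) * M i (p i)) = (\<Prod>j\<in>A. c j) * (of_int (sign p) * (\<Prod>i\<in>A. M i (p i)))"
    by (simp add: prod.distrib)
qed

lemma sdet_scale_rows:
  assumes "finite A"
  shows "sdet A (\<lambda>i j. c * M i j) = c ^ card A * sdet A M"
  using sdet_scale_columns[of A "\<lambda>_. c" M] by simp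

subsection \<open>Counting multi-indices\<close>

lemma card_midx_Suc: "card (midx (Suc k)) = card (midx k) + (k + 2)"
proof -
  have level: "{\<alpha>::mindex. mdeg \<alpha> = j} = (\<lambda>i. (i, j - i)) ` {..j}" for j
    by (force simp: mdeg_def image_iff)
  have "card {\<alpha>::mindex. mdeg \<alpha> = Suc k} = k + 2" "finite {\<alpha>::mindex. mdeg \<alpha> = Suc k}"
    unfolding level by (subst card_image) (auto simp: inj_on_def)
  moreover have "midx (Suc k) = midx k \<union> {\<alpha>. mdeg \<alpha> = Suc k}" by (auto simp: midx_def)
  moreover have "midx k \<inter> {\<alpha>. mdeg \<alpha> = Suc k} = {}" by (auto simp: midx_def)
  ultimately show ?thesis by (simp add: card_Un_disjoint)
qed

lemma card_midx: "2 * card (midx k) = (k + 1) * (k + 2)"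
proof (induction k)
  case 0
  have "midx 0 = {(0, 0)}" by (auto simp: midx_def mdeg_def)
  then show ?case by simp
qed (simp add: card_midx_Suc)

lemma card_midx_le: "card (midx k) \<le> (k + 1)\<^sup>2"
proof -
  have "2 * card (midx k) \<le> (k + 1) * (2 * (k + 1))" unfolding card_midx by (intro mult_le_mono) auto
  then show ?thesis by (simp add: power2_eq_square)
qed

text \<open>Growth linear in k, against a quadratic total, is what makes bounded shifts of the
  degree cheap.\<close>

lemma card_midx_add_le: "card (midx (k + s)) \<le> card (midx k) + s * (s + 1) * (k + 1)"
proof -
  have "card (midx (k + s)) \<le> card (midx k) + s * (k + s + 1)"
    by (induction s) (auto simp: card_midx_Suc algebra_simps)
  also have "s * (k + s + 1) \<le> s * (s + 1) * (k + 1)" by (simp add: algebra_simps)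
  finally show ?thesis by simp
qed

lemma midx_mono: "k \<le> l \<Longrightarrow> midx k \<subseteq> midx l"
  by (auto simp: midx_def)

lemma card_midx_diff_le: "card (midx (k + s) - midx k) \<le> s * (s + 1) * (k + 1)"
  using card_midx_add_le[of k s] midx_mono[of k "k + s"] by (simp add: card_Diff_subset)

lemma norm_mon2_le:
  assumes "cmod (fst z) \<le> M" "cmod (snd z) \<le> M" "M \<ge> 1" "mdeg \<alpha> \<le> k"
  shows "cmod (mon2 \<alpha> z) \<le> M ^ k"
proof -
  have "cmod (mon2 \<alpha> z) \<le> M ^ fst \<alpha> * M ^ snd \<alpha>"
    unfolding mon2_def norm_mult norm_power using assms by (intro mult_mono power_mono) auto
  also have "\<dots> = M ^ mdeg \<alpha>" by (simp add: power_add mdeg_def)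
  also have "\<dots> \<le> M ^ k" using assms by (intro power_increasing) auto
  finally show ?thesis .
qed

lemma bounded_coordinates:
  assumes "bounded (K :: C2 set)"
  obtains M where "M \<ge> 1" "\<And>z. z \<in> K \<Longrightarrow> cmod (fst z) \<le> M" "\<And>z. z \<in> K \<Longrightarrow> cmod (snd z) \<le> M"
proof -
  obtain M N where "M \<ge> 1" "\<And>z. z \<in> K \<Longrightarrow> cmod (fst z) \<le> M" "N \<ge> 1" "\<And>z. z \<in> K \<Longrightarrow> cmod (snd z) \<le> N"
    using PF_bounded[OF PF_fst assms] PF_bounded[OF PF_snd assms] by metis
  then show thesis by (intro that[of "max M N"]) (auto intro: max.coboundedI1 max.coboundedI2)
qed

lemma bounded_rows_PF:
  assumes "finite A" "\<And>i. i \<in> A \<Longrightarrow> e i \<in> PF" "bounded K"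
  shows "bounded_rows A e K"
proof -
  obtain C where "\<And>i z. i \<in> A \<Longrightarrow> z \<in> K \<Longrightarrow> cmod (e i z) \<le> C"
    using PF_bounded_finite[of A e K] assms by metis
  then show ?thesis unfolding bounded_rows_def by (intro exI[of _ C]) simp
qed

lemma bounded_rows_mon2:
  assumes "finite A" "bounded K"
  shows "bounded_rows A mon2 K"
  by (rule bounded_rows_PF) (use assms in auto)

subsection \<open>Multiplying by a fixed polynomial\<close>

abbreviation (input) madd :: "mindex \<Rightarrow> mindex \<Rightarrow> mindex" where
  "madd \<alpha> \<beta> \<equiv> (fst \<alpha> + fst \<beta>, snd \<alpha> + snd \<beta>)"

lemma mindex_less_trans: "trans mindex_less"
  unfolding mindex_less_def by (intro trans_inv_image trans_lex_prod trans_less_than)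

lemma mindex_less_iff:
  "(\<alpha>, \<beta>) \<in> mindex_less \<longleftrightarrow> mdeg \<alpha> < mdeg \<beta> \<or> mdeg \<alpha> = mdeg \<beta> \<and> snd \<alpha> < snd \<beta>"
  by (simp add: mindex_less_def)

lemma mindex_less_total: "\<alpha> \<noteq> \<beta> \<Longrightarrow> (\<alpha>, \<beta>) \<in> mindex_less \<or> (\<beta>, \<alpha>) \<in> mindex_less"
  by (cases \<alpha>; cases \<beta>) (auto simp: mindex_less_iff mdeg_def)

lemma mindex_less_madd: "(\<alpha>, \<beta>) \<in> mindex_less \<Longrightarrow> (madd \<gamma> \<alpha>, madd \<gamma> \<beta>) \<in> mindex_less"
  by (auto simp: mindex_less_iff mdeg_def)

lemma PF_leading_monomial:
  assumes "P \<in> PF" "\<exists>w. P w \<noteq> 0"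
  obtains a T \<mu> where "finite T" "\<mu> \<in> T" "a \<mu> \<noteq> 0" "\<And>w. P w = (\<Sum>\<alpha>\<in>T. a \<alpha> * mon2 \<alpha> w)"
    "\<And>\<alpha>. \<alpha> \<in> T \<Longrightarrow> \<alpha> \<noteq> \<mu> \<Longrightarrow> (\<alpha>, \<mu>) \<in> mindex_less"
proof -
  obtain k where "P \<in> polys_le k" using PF_polys_le[OF assms(1)] .
  then obtain a where a: "\<And>w. P w = (\<Sum>\<alpha>\<in>midx k. a \<alpha> * mon2 \<alpha> w)" unfolding polys_le_iff by blast
  define T where "T = {\<alpha>\<in>midx k. a \<alpha> \<noteq> 0}"
  have T: "finite T" by (simp add: T_def)
  have PT: "P w = (\<Sum>\<alpha>\<in>T. a \<alpha> * mon2 \<alpha> w)" for w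
    unfolding a by (rule sum.mono_neutral_right) (auto simp: T_def)
  then have "T \<noteq> {}" using assms(2) by auto
  then obtain \<mu> where "\<mu> \<in> T" "\<And>\<alpha>. \<alpha> \<in> T \<Longrightarrow> \<alpha> \<noteq> \<mu> \<Longrightarrow> (\<alpha>, \<mu>) \<in> mindex_less"
    using finite_total_max[OF T _ mindex_less_trans mindex_less_total] by blast
  then show thesis using that[of T \<mu> a] T PT by (auto simp: T_def)
qed

text \<open>Passing from the monomials \<open>w\<^bsup>\<alpha> + \<mu>\<^esup>\<close> to \<open>P w\<^sup>\<alpha>\<close>, with \<open>\<mu>\<close> the leading exponent of \<open>P\<close>, is a
  unitriangular change of basis up to the leading coefficient; only \<open>O(k)\<close> monomials are left over.\<close>

lemma vand_multiply_polynomial: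
  assumes P: "P \<in> PF" "\<exists>w. P w \<noteq> 0" and K: "bounded K" "K \<noteq> {}"
  obtains C :: real and \<delta> :: nat where "C \<ge> 1"
    "\<And>k. vand (midx (k + \<delta>)) mon2 K \<le> C ^ ((k + 1)\<^sup>2) * vand (midx k) (\<lambda>\<alpha> w. P w * mon2 \<alpha> w) K"
proof -
  obtain a T \<mu> where lead: "finite T" "\<mu> \<in> T" "a \<mu> \<noteq> 0" "\<And>w. P w = (\<Sum>\<alpha>\<in>T. a \<alpha> * mon2 \<alpha> w)"
    "\<And>\<alpha>. \<alpha> \<in> T \<Longrightarrow> \<alpha> \<noteq> \<mu> \<Longrightarrow> (\<alpha>, \<mu>) \<in> mindex_less"
    by (rule PF_leading_monomial[OF P]) (rule that)
  obtain M where M: "M \<ge> 1" "\<And>z. z \<in> K \<Longrightarrow> cmod (fst z) \<le> M" "\<And>z. z \<in> K \<Longrightarrow> cmod (snd z) \<le> M"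
    using bounded_coordinates[OF K(1)] by blast
  define \<delta> where "\<delta> = mdeg \<mu>"
  \<comment> \<open>The first summand accounts for the number of leftover rows, the rest for the
    degree k + \<delta> of their monomials.\<close>
  define c where "c = \<delta> * (\<delta> + 1) + \<delta> + 1"
  define D where "D = (exp (real c) * M ^ c) ^ c"
  define C where "C = (2 ^ (\<delta> + 1)\<^sup>2) * (max 1 (1 / cmod (a \<mu>)) * D)"
  have "1 \<le> exp (real c) * M ^ c" using mult_mono[of 1 "exp (real c)" 1 "M ^ c"] M by simp
  then have D: "D \<ge> 1" unfolding D_def by (rule one_le_power)
  have mD: "max 1 (1 / cmod (a \<mu>)) * D \<ge> 1" using mult_mono[of 1 "max 1 (1 / cmod (a \<mu>))" 1 D] D by simp
  have "C \<ge> 1" unfolding C_def using mult_mono[of 1 "2 ^ (\<delta> + 1)\<^sup>2" 1 "max 1 (1 / cmod (a \<mu>)) * D"] mD by simp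
  moreover have "vand (midx (k + \<delta>)) mon2 K \<le> C ^ ((k + 1)\<^sup>2) * vand (midx k) (\<lambda>\<alpha> w. P w * mon2 \<alpha> w) K" for k
  proof -
    let ?N = "midx (k + \<delta>)"
    \<comment> \<open>\<open>S\<close> consists of the exponents in range whose monomials are
      divisible by w^\<mu>; \<open>R\<close> holds the others.\<close>
    define S where "S = (\<lambda>\<alpha>. madd \<alpha> \<mu>) ` midx k"
    define R where "R = ?N - S"
    define q where "q = (\<lambda>\<gamma>::mindex. (fst \<gamma> - fst \<mu>, snd \<gamma> - snd \<mu>))"
    \<comment> \<open>The new rows, divided by the leading coefficient so that the transition matrix
      \<open>t\<close> has ones on its diagonal.\<close>
    define e where "e = (\<lambda>\<gamma> w. if \<gamma> \<in> S then P w * mon2 (q \<gamma>) w / a \<mu> else mon2 \<gamma> w)"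
    define t where "t = (\<lambda>\<gamma> \<gamma>'. if \<gamma> \<in> S then (\<Sum>\<alpha>\<in>T. if madd (q \<gamma>) \<alpha> = \<gamma>' then a \<alpha> / a \<mu> else 0)
        else if \<gamma> = \<gamma>' then 1 else 0)"
    have SN: "S \<subseteq> ?N" by (auto simp: S_def midx_def \<delta>_def mdeg_def)
    have inj: "inj_on (\<lambda>\<alpha>. madd \<alpha> \<mu>) (midx k)" by (auto simp: inj_on_def prod_eq_iff)
    have cardS: "card S = card (midx k)" unfolding S_def by (rule card_image[OF inj])
    have finS: "finite S" by (simp add: S_def)
    have qS: "madd (q \<gamma>) \<mu> = \<gamma>" "q \<gamma> \<in> midx k" if "\<gamma> \<in> S" for \<gamma>
      using that by (auto simp: S_def q_def)
    have less: "(madd (q \<gamma>) \<alpha>, \<gamma>) \<in> mindex_less" if "\<gamma> \<in> S" "\<alpha> \<in> T" "\<alpha> \<noteq> \<mu>" for \<gamma> \<alpha>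
      using mindex_less_madd[OF lead(5)[OF that(2,3)], of "q \<gamma>"] qS(1)[OF that(1)] by simp
    \<comment> \<open>Replacing the leading monomial of P by another one gives a smaller exponent,
      so no degree leaves the range.\<close>
    have in_N: "madd (q \<gamma>) \<alpha> \<in> ?N" if "\<gamma> \<in> S" "\<alpha> \<in> T" for \<gamma> \<alpha>
    proof (cases "\<alpha> = \<mu>")
      case True
      then show ?thesis using qS(1)[OF that(1)] SN that(1) by auto
    next
      case False
      have "\<gamma> \<in> ?N" using SN that by auto
      then show ?thesis using less[OF that False] by (auto simp: mindex_less_iff midx_def)
    qed
    have e_t: "e \<gamma> w = (\<Sum>\<gamma>'\<in>?N. t \<gamma> \<gamma>' * mon2 \<gamma>' w)" if "\<gamma> \<in> ?N" for \<gamma> w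
    proof (cases "\<gamma> \<in> S")
      case True
      have "(\<Sum>\<gamma>'\<in>?N. t \<gamma> \<gamma>' * mon2 \<gamma>' w) =
          (\<Sum>\<alpha>\<in>T. \<Sum>\<gamma>'\<in>?N. (if madd (q \<gamma>) \<alpha> = \<gamma>' then a \<alpha> / a \<mu> else 0) * mon2 \<gamma>' w)"
        using True by (subst sum.swap) (simp add: t_def sum_distrib_right)
      also have "\<dots> = (\<Sum>\<alpha>\<in>T. a \<alpha> / a \<mu> * mon2 (madd (q \<gamma>) \<alpha>) w)"
        using in_N[OF True] by (intro sum.cong refl) (simp add: mult_delta_left)
      also have "\<dots> = e \<gamma> w"
        using True unfolding e_def lead(4)
        by (simp add: mon2_mult[symmetric] sum_distrib_left sum_distrib_right sum_divide_distrib mult_ac)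
      finally show ?thesis by simp
    next
      case False
      then show ?thesis using that by (simp add: e_def t_def mult_delta_left)
    qed
    \<comment> \<open>Degree first, then second exponent, in one number; second exponents in range
      stay below k + \<delta> + 1.\<close>
    let ?key = "\<lambda>\<gamma>. (k + \<delta> + 1) * mdeg \<gamma> + snd \<gamma>"
    have key_less: "?key \<gamma> < ?key \<gamma>'" if "(\<gamma>, \<gamma>') \<in> mindex_less" "\<gamma> \<in> ?N" for \<gamma> \<gamma>'
    proof (cases "mdeg \<gamma> < mdeg \<gamma>'")
      case True
      have "snd \<gamma> < k + \<delta> + 1" using that(2) by (simp add: midx_def mdeg_def)
      then have "?key \<gamma> < (k + \<delta> + 1) * (mdeg \<gamma> + 1)" by simp
      also have "\<dots> \<le> (k + \<delta> + 1) * mdeg \<gamma>'" using True by (intro mult_le_mono) auto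
      finally show ?thesis by simp
    qed (use that in \<open>auto simp: mindex_less_iff\<close>)
    have inj_key: "inj_on ?key ?N"
      using key_less mindex_less_total by (intro inj_onI) (metis less_irrefl)
    have "sdet ?N t = (\<Prod>\<gamma>\<in>?N. t \<gamma> \<gamma>)"
    proof (rule sdet_triangular[OF finite_midx inj_key])
      fix \<gamma> \<gamma>' assume \<gamma>: "\<gamma> \<in> ?N" "\<gamma>' \<in> ?N" "?key \<gamma> < ?key \<gamma>'"
      show "t \<gamma> \<gamma>' = 0"
      proof (cases "\<gamma> \<in> S")
        case True
        have "madd (q \<gamma>) \<alpha> \<noteq> \<gamma>'" if "\<alpha> \<in> T" for \<alpha>
        proof
          assume eq: "madd (q \<gamma>) \<alpha> = \<gamma>'"
          then have "\<alpha> \<noteq> \<mu>" using qS(1)[OF True] \<gamma>(3) by auto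
          then have "?key \<gamma>' < ?key \<gamma>" using key_less[OF less[OF True that]] eq \<gamma>(2) by simp
          then show False using \<gamma>(3) by simp
        qed
        then show ?thesis using True by (simp add: t_def)
      next
        case False
        then show ?thesis using \<gamma>(3) by (auto simp: t_def)
      qed
    qed
    also have "\<dots> = 1"
    proof (rule prod.neutral, rule ballI)
      fix \<gamma> assume "\<gamma> \<in> ?N"
      show "t \<gamma> \<gamma> = 1"
      proof (cases "\<gamma> \<in> S")
        case True
        have "madd (q \<gamma>) \<alpha> = \<gamma> \<longleftrightarrow> \<alpha> = \<mu>" for \<alpha>
          using qS(1)[OF True] by (auto simp: prod_eq_iff)
        then show ?thesis using True lead by (simp add: t_def)
      qed (simp add: t_def)
    qed
    finally have det_t: "sdet ?N t = 1" .
    have N: "?N = S \<union> R" "S \<inter> R = {}" "finite R" using SN by (auto simp: R_def)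
    have e_PF: "e \<gamma> \<in> PF" for \<gamma>
    proof (cases "\<gamma> \<in> S")
      case True
      have "(\<lambda>w. (1 / a \<mu>) * (P w * mon2 (q \<gamma>) w)) \<in> PF" by (intro PF_mult PF_const P PF_mon2)
      then show ?thesis using True by (simp add: e_def)
    qed (simp add: e_def)
    have bd: "bounded_rows (S \<union> R) e K"
      by (intro bounded_rows_PF finite_UnI finS N(3) e_PF K)
    have bdP: "bounded_rows (midx k) (\<lambda>\<alpha> w. P w * mon2 \<alpha> w) K"
      by (intro bounded_rows_PF finite_midx PF_mult P PF_mon2 K)
    let ?Y = "vand (midx k) (\<lambda>\<alpha> w. P w * mon2 \<alpha> w) K"
    have Y: "?Y \<ge> 0" by (rule vand_nonneg[OF finite_midx bdP K(2)])
    have "vand ?N mon2 K = vand ?N e K"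
      unfolding vand_def
    proof (intro arg_cong[where f=Sup] image_cong refl arg_cong[where f=cmod])
      fix \<zeta> :: "mindex \<Rightarrow> C2"
      have "sdet ?N (\<lambda>i j. e i (\<zeta> j)) = sdet ?N (\<lambda>i j. \<Sum>\<gamma>'\<in>?N. t i \<gamma>' * mon2 \<gamma>' (\<zeta> j))"
        by (rule sdet_cong) (rule e_t)
      then show "sdet ?N (\<lambda>i j. mon2 i (\<zeta> j)) = sdet ?N (\<lambda>i j. e i (\<zeta> j))"
        using sdet_mult[OF finite_midx, of "k + \<delta>" t "\<lambda>i j. mon2 i (\<zeta> j)"] det_t by simp
    qed
    also have "\<dots> = vand (S \<union> R) e K" by (simp only: N(1))
    also have "\<dots> \<le> 2 ^ (card S + card R) * (vand S e K * vand R e K)"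
      by (rule vand_union_le[OF finS N(3,2) bd K(2)])
    also have "\<dots> \<le> (2 ^ (\<delta> + 1)\<^sup>2) ^ ((k + 1)\<^sup>2) *
        ((max 1 (1 / cmod (a \<mu>)) ^ ((k + 1)\<^sup>2) * ?Y) * D ^ ((k + 1)\<^sup>2))"
    proof (intro mult_mono)
      have "card S + card R = card ?N"
        unfolding N(1) using N(2,3) finS by (simp add: card_Un_disjoint)
      also have "\<dots> \<le> (k + \<delta> + 1)\<^sup>2" by (rule card_midx_le)
      also have "\<dots> \<le> ((\<delta> + 1) * (k + 1))\<^sup>2" by (intro power_mono) (auto simp: algebra_simps)
      finally have "card S + card R \<le> (\<delta> + 1)\<^sup>2 * (k + 1)\<^sup>2" by (simp only: power_mult_distrib)
      then have "(2::real) ^ (card S + card R) \<le> 2 ^ ((\<delta> + 1)\<^sup>2 * (k + 1)\<^sup>2)"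
        by (intro power_increasing) auto
      then show "(2::real) ^ (card S + card R) \<le> (2 ^ (\<delta> + 1)\<^sup>2) ^ ((k + 1)\<^sup>2)"
        by (simp only: power_mult)
      show "vand R e K \<le> D ^ ((k + 1)\<^sup>2)"
        unfolding D_def
      proof (rule vand_few_rows)
        show "finite R" by (rule N)
        have "card R \<le> \<delta> * (\<delta> + 1) * (k + 1)"
          using card_midx_add_le[of k \<delta>] SN finS cardS by (simp add: R_def card_Diff_subset)
        also have "\<dots> \<le> c * (k + 1)" unfolding c_def by (intro mult_le_mono) auto
        finally show "card R \<le> c * (k + 1)" .
        fix \<gamma> w assume \<gamma>: "\<gamma> \<in> R" "w \<in> K"
        have "mdeg \<gamma> \<le> k + \<delta>" using \<gamma> by (auto simp: R_def midx_def)
        also have "\<dots> \<le> c * (k + 1)" by (simp add: c_def algebra_simps)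
        finally show "cmod (e \<gamma> w) \<le> M ^ (c * (k + 1))"
          using \<gamma> norm_mon2_le[of w M \<gamma> "c * (k + 1)"] M by (simp add: e_def R_def)
      qed (use M K in auto)
      have "vand S e K = vand (midx k) (\<lambda>\<alpha>. e (madd \<alpha> \<mu>)) K"
        by (rule vand_reindex) (auto simp: bij_betw_def inj S_def)
      also have "\<dots> = vand (midx k) (\<lambda>\<alpha> w. (1 / a \<mu>) * (P w * mon2 \<alpha> w)) K"
        by (rule vand_cong) (simp add: e_def S_def q_def)
      also have "\<dots> \<le> max 1 (1 / cmod (a \<mu>)) ^ ((k + 1)\<^sup>2) * ?Y"
      proof (rule vand_least[OF K(2)])
        fix \<zeta> assume \<zeta>: "\<And>\<alpha>. \<alpha> \<in> midx k \<Longrightarrow> \<zeta> \<alpha> \<in> K"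
        \<comment> \<open>The maximum with 1 allows the number of rows to be replaced by its upper
          bound.\<close>
        have "(1 / cmod (a \<mu>)) ^ card (midx k) \<le> max 1 (1 / cmod (a \<mu>)) ^ ((k + 1)\<^sup>2)"
          by (rule order.trans[OF power_mono power_increasing[OF card_midx_le]]) auto
        then show "cmod (sdet (midx k) (\<lambda>i j. (1 / a \<mu>) * (P (\<zeta> j) * mon2 i (\<zeta> j))))
          \<le> max 1 (1 / cmod (a \<mu>)) ^ ((k + 1)\<^sup>2) * ?Y"
          unfolding sdet_scale_rows[OF finite_midx] norm_mult norm_power
          using vand_upper[OF finite_midx bdP \<zeta>] by (intro mult_mono) (auto simp: norm_divide)
      qed
      finally show "vand S e K \<le> max 1 (1 / cmod (a \<mu>)) ^ ((k + 1)\<^sup>2) * ?Y" .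
      show "0 \<le> vand S e K * vand R e K" "0 \<le> vand R e K"
        using vand_nonneg[OF finS bounded_rows_subset[OF bd] K(2)] vand_nonneg[OF N(3) bounded_rows_subset[OF bd] K(2)]
        by auto
    qed (use Y in auto)
    also have "\<dots> = C ^ ((k + 1)\<^sup>2) * ?Y"
      by (simp only: C_def power_mult_distrib mult_ac)
    finally show ?thesis .
  qed
  ultimately show thesis using that by blast
qed

section \<open>Comparison of the Vandermonde suprema\<close>

context finite_cover
begin

definition lift :: "C2 set \<Rightarrow> (C2 \<times> C2) set" where
  "lift K = {(w, z) \<in> graphV f. w \<in> K}"

lemma in_lift_iff: "x \<in> lift K \<longleftrightarrow> fst x = f (snd x) \<and> f (snd x) \<in> K"
  by (auto simp: lift_def graphV_def)

lemma lift_nonempty: "K \<noteq> {} \<Longrightarrow> lift K \<noteq> {}"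
proof -
  assume "K \<noteq> {}"
  then obtain w where "w \<in> K" by blast
  moreover obtain z where "f z = w" using surj_f by blast
  ultimately have "(w, z) \<in> lift K" by (simp add: in_lift_iff)
  then show ?thesis by blast
qed

lemma lift_bounded_coordinates:
  assumes "bounded K"
  obtains M where "M \<ge> 1"
    "\<And>x. x \<in> lift K \<Longrightarrow> cmod (fst (fst x)) \<le> M" "\<And>x. x \<in> lift K \<Longrightarrow> cmod (snd (fst x)) \<le> M"
    "\<And>x. x \<in> lift K \<Longrightarrow> cmod (fst (snd x)) \<le> M" "\<And>x. x \<in> lift K \<Longrightarrow> cmod (snd (snd x)) \<le> M"
proof -
  obtain A where A: "A \<ge> 1" "\<And>w. w \<in> K \<Longrightarrow> cmod (fst w) \<le> A" "\<And>w. w \<in> K \<Longrightarrow> cmod (snd w) \<le> A"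
    using bounded_coordinates[OF assms] by blast
  obtain B where B: "B \<ge> 1" "\<And>z. f z \<in> K \<Longrightarrow> cmod (fst z) \<le> B"
    using bounded_on_preimage[OF PF_fst assms] by blast
  obtain C where C: "C \<ge> 1" "\<And>z. f z \<in> K \<Longrightarrow> cmod (snd z) \<le> C"
    using bounded_on_preimage[OF PF_snd assms] by blast
  show thesis
  proof (rule that[of "max A (max B C)"])
    show "max A (max B C) \<ge> 1" using A by simp
    fix x assume "x \<in> lift K"
    then have x: "fst x = f (snd x)" "f (snd x) \<in> K" by (auto simp: in_lift_iff)
    show "cmod (fst (fst x)) \<le> max A (max B C)" "cmod (snd (fst x)) \<le> max A (max B C)"
      "cmod (fst (snd x)) \<le> max A (max B C)" "cmod (snd (snd x)) \<le> max A (max B C)"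
      using A(2,3)[OF x(2)] B(2)[OF x(2)] C(2)[OF x(2)] x(1) by auto
  qed
qed

lemma lift_bounded_mon4:
  assumes "bounded K"
  obtains M where "M \<ge> 1" "\<And>x \<mu> k. x \<in> lift K \<Longrightarrow> mdeg (fst \<mu>) + mdeg (snd \<mu>) \<le> k \<Longrightarrow> cmod (mon4 \<mu> x) \<le> M ^ k"
    "\<And>x \<beta> k. x \<in> lift K \<Longrightarrow> mdeg \<beta> \<le> k \<Longrightarrow> cmod (mon2 \<beta> (snd x)) \<le> M ^ k"
proof -
  obtain M where M: "M \<ge> 1"
    "\<And>x. x \<in> lift K \<Longrightarrow> cmod (fst (fst x)) \<le> M" "\<And>x. x \<in> lift K \<Longrightarrow> cmod (snd (fst x)) \<le> M"
    "\<And>x. x \<in> lift K \<Longrightarrow> cmod (fst (snd x)) \<le> M" "\<And>x. x \<in> lift K \<Longrightarrow> cmod (snd (snd x)) \<le> M"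
    using lift_bounded_coordinates[OF assms] by blast
  show thesis
  proof (rule that[OF M(1)])
    fix x :: "C2 \<times> C2" and \<mu> k assume x: "x \<in> lift K" and k: "mdeg (fst \<mu>) + mdeg (snd \<mu>) \<le> k"
    have "cmod (mon4 \<mu> x) \<le> M ^ mdeg (fst \<mu>) * M ^ mdeg (snd \<mu>)"
      unfolding mon4_def norm_mult using M(1) M(2-5)[OF x] by (intro mult_mono norm_mon2_le) auto
    also have "\<dots> \<le> M ^ k" unfolding power_add[symmetric] using M(1) k by (intro power_increasing) auto
    finally show "cmod (mon4 \<mu> x) \<le> M ^ k" .
  next
    fix x :: "C2 \<times> C2" and \<beta> k assume x: "x \<in> lift K" and "mdeg \<beta> \<le> k"
    then show "cmod (mon2 \<beta> (snd x)) \<le> M ^ k"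
      using M(1) M(4,5)[OF x] by (intro norm_mon2_le) auto
  qed
qed

lemma bounded_rows_mon4:
  assumes "finite A" "bounded K"
  shows "bounded_rows A mon4 (lift K)"
proof -
  obtain M where M: "M \<ge> 1" "\<And>x \<mu> k. x \<in> lift K \<Longrightarrow> mdeg (fst \<mu>) + mdeg (snd \<mu>) \<le> k \<Longrightarrow> cmod (mon4 \<mu> x) \<le> M ^ k"
    using lift_bounded_mon4[OF assms(2)] by metis
  define N where "N = (\<Sum>\<mu>\<in>A. mdeg (fst \<mu>) + mdeg (snd \<mu>))"
  have "cmod (mon4 \<mu> x) \<le> M ^ N" if "\<mu> \<in> A" "x \<in> lift K" for \<mu> x
    by (rule M(2)[OF that(2)]) (use member_le_sum[OF that(1), of "\<lambda>\<mu>. mdeg (fst \<mu>) + mdeg (snd \<mu>)"] assms(1) in \<open>simp add: N_def\<close>)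
  then show ?thesis unfolding bounded_rows_def by blast
qed

text \<open>The block of rows \<open>w\<^sup>\<alpha> z\<^sup>\<beta>\<close> with fixed \<open>\<beta>\<close> contributes the Vandermonde determinant of the \<open>w\<close>
  with its columns scaled by \<open>z\<^sup>\<beta>\<close>.\<close>

lemma vand_block_le:
  assumes K: "bounded K" "K \<noteq> {}"
    and M: "M \<ge> 1" "\<And>x. x \<in> lift K \<Longrightarrow> cmod (mon2 \<beta> (snd x)) \<le> M"
  shows "vand (midx k \<times> {\<beta>}) mon4 (lift K) \<le> M ^ card (midx k) * vand (midx k) mon2 K"
proof -
  have "vand (midx k \<times> {\<beta>}) mon4 (lift K) = vand (midx k) (\<lambda>\<alpha>. mon4 (\<alpha>, \<beta>)) (lift K)"
    by (rule vand_reindex) (auto simp: bij_betw_def inj_on_def)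
  also have "\<dots> \<le> M ^ card (midx k) * vand (midx k) mon2 K"
  proof (rule vand_least[OF lift_nonempty[OF K(2)]])
    fix \<zeta> assume \<zeta>: "\<And>\<alpha>. \<alpha> \<in> midx k \<Longrightarrow> \<zeta> \<alpha> \<in> lift K"
    have "sdet (midx k) (\<lambda>i j. mon4 (i, \<beta>) (\<zeta> j)) =
        (\<Prod>j\<in>midx k. mon2 \<beta> (snd (\<zeta> j))) * sdet (midx k) (\<lambda>i j. mon2 i (fst (\<zeta> j)))"
      unfolding sdet_scale_columns[symmetric] by (simp add: mon4_def mult.commute)
    moreover have "(\<Prod>j\<in>midx k. cmod (mon2 \<beta> (snd (\<zeta> j)))) \<le> (\<Prod>j\<in>midx k. M)"
      using M \<zeta> by (intro prod_mono) auto
    moreover have "cmod (sdet (midx k) (\<lambda>i j. mon2 i (fst (\<zeta> j)))) \<le> vand (midx k) mon2 K"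
      using vand_upper[OF finite_midx bounded_rows_mon2[OF finite_midx K(1)], of k "\<lambda>j. fst (\<zeta> j)"] \<zeta>
      by (auto simp: in_lift_iff)
    ultimately show "cmod (sdet (midx k) (\<lambda>i j. mon4 (i, \<beta>) (\<zeta> j))) \<le> M ^ card (midx k) * vand (midx k) mon2 K"
      using M(1) by (simp add: norm_mult prod_norm[symmetric] mult_mono)
  qed
  finally show ?thesis .
qed

text \<open>One block is split off at a time. Each costs a Laplace factor and a bound for z^\<beta>
  over \<open>K\<close>, both exp(O(k^2)), and the number of blocks is fixed.\<close>

lemma vand_product_le:
  assumes K: "bounded K" "K \<noteq> {}"
  obtains C where "C \<ge> 1"
    "\<And>k. vand (midx k \<times> I) mon4 (lift K) \<le> C ^ ((k + 1)\<^sup>2) * vand (midx k) mon2 K ^ card I"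
proof -
  obtain M where M: "M \<ge> 1" "\<And>x \<beta> k. x \<in> lift K \<Longrightarrow> mdeg \<beta> \<le> k \<Longrightarrow> cmod (mon2 \<beta> (snd x)) \<le> M ^ k"
    using lift_bounded_mon4[OF K(1)] by metis
  define s where "s = (\<Sum>\<beta>\<in>I. mdeg \<beta>)"
  define D where "D = M ^ s"
  have D: "D \<ge> 1" "\<And>x \<beta>. \<beta> \<in> I \<Longrightarrow> x \<in> lift K \<Longrightarrow> cmod (mon2 \<beta> (snd x)) \<le> D"
    using M member_le_sum[of _ I mdeg] finite_I by (auto simp: D_def s_def)
  let ?n = "card I" and ?v = "\<lambda>k. vand (midx k) mon2 K"
  have v: "?v k \<ge> 0" for k by (rule vand_nonneg[OF finite_midx bounded_rows_mon2[OF finite_midx K(1)] K(2)])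
  \<comment> \<open>The base of the constant involves |I| rather than |J|, so it does not change
    during the induction.\<close>
  have ind: "vand (midx k \<times> J) mon4 (lift K) \<le> ((2 ^ ?n * D) ^ ((k + 1)\<^sup>2)) ^ card J * ?v k ^ card J"
    if "J \<subseteq> I" for J k
    using finite_subset[OF that finite_I] that
  proof (induction J rule: finite_induct)
    case empty
    have "vand {} mon4 (lift K) \<le> 1" by (rule vand_least[OF lift_nonempty[OF K(2)]]) simp
    then show ?case by simp
  next
    case (insert \<beta> J)
    let ?h = "card (midx k)" and ?E = "(2 ^ ?n * D) ^ ((k + 1)\<^sup>2)"
    have Un: "midx k \<times> insert \<beta> J = midx k \<times> {\<beta>} \<union> midx k \<times> J" by auto
    have fin: "finite (midx k \<times> {\<beta>})" "finite (midx k \<times> J)" using insert by auto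
    have "vand (midx k \<times> insert \<beta> J) mon4 (lift K) \<le> 2 ^ (card (midx k \<times> {\<beta>}) + card (midx k \<times> J)) *
        (vand (midx k \<times> {\<beta>}) mon4 (lift K) * vand (midx k \<times> J) mon4 (lift K))"
      unfolding Un using insert
      by (intro vand_union_le fin bounded_rows_mon4 K lift_nonempty finite_UnI) auto
    also have "\<dots> \<le> (2 ^ ?n) ^ ((k + 1)\<^sup>2) * ((D ^ ((k + 1)\<^sup>2) * ?v k) * (?E ^ card J * ?v k ^ card J))"
    proof (intro mult_mono)
      have "card (insert \<beta> J) \<le> ?n" using insert finite_I by (intro card_mono) auto
      then have "card J + 1 \<le> ?n" using insert by simp
      have "card (midx k \<times> {\<beta>}) + card (midx k \<times> J) = ?h * (card J + 1)"
        by (simp add: card_cartesian_product)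
      also have "\<dots> \<le> (k + 1)\<^sup>2 * ?n" using card_midx_le \<open>card J + 1 \<le> ?n\<close> by (intro mult_le_mono)
      finally have "(2::real) ^ (card (midx k \<times> {\<beta>}) + card (midx k \<times> J)) \<le> 2 ^ (?n * (k + 1)\<^sup>2)"
        by (intro power_increasing) (auto simp: mult.commute)
      then show "(2::real) ^ (card (midx k \<times> {\<beta>}) + card (midx k \<times> J)) \<le> (2 ^ ?n) ^ ((k + 1)\<^sup>2)"
        by (simp only: power_mult)
      have "vand (midx k \<times> {\<beta>}) mon4 (lift K) \<le> D ^ ?h * ?v k"
        using insert by (intro vand_block_le K D) auto
      also have "\<dots> \<le> D ^ ((k + 1)\<^sup>2) * ?v k"
        using v card_midx_le D by (intro mult_right_mono power_increasing) auto
      finally show "vand (midx k \<times> {\<beta>}) mon4 (lift K) \<le> D ^ ((k + 1)\<^sup>2) * ?v k" .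
      show "vand (midx k \<times> J) mon4 (lift K) \<le> ?E ^ card J * ?v k ^ card J" using insert by auto
      have "0 \<le> vand (midx k \<times> J) mon4 (lift K)" "0 \<le> vand (midx k \<times> {\<beta>}) mon4 (lift K)"
        by (intro vand_nonneg fin bounded_rows_mon4 K lift_nonempty)+
      then show "0 \<le> vand (midx k \<times> J) mon4 (lift K)"
        "0 \<le> vand (midx k \<times> {\<beta>}) mon4 (lift K) * vand (midx k \<times> J) mon4 (lift K)" by auto
    qed (use v D in auto)
    also have "\<dots> = ?E ^ card (insert \<beta> J) * ?v k ^ card (insert \<beta> J)"
      using insert by (simp add: power_mult_distrib mult_ac)
    finally show ?case .
  qed
  have "vand (midx k \<times> I) mon4 (lift K) \<le> ((2 ^ ?n * D) ^ ?n) ^ ((k + 1)\<^sup>2) * ?v k ^ ?n" for k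
    using ind[OF order.refl, of k] by (simp only: power_mult[symmetric] mult.commute[of ?n])
  moreover have "(2 ^ ?n * D) ^ ?n \<ge> 1"
    using mult_mono[of 1 "2 ^ ?n" 1 D] D(1) by (intro one_le_power) simp
  ultimately show thesis using that by blast
qed

text \<open>Full fibres over \<open>|midx k|\<close> points \<open>w\<close> give a determinant which factors, since its matrix is
  \<open>(W \<otimes> 1) diag(E\<^sub>j)\<close>, with \<open>W\<close> the Vandermonde matrix of the points and \<open>E\<^sub>j\<close> the basis on the fibres.\<close>

lemma sdet_fibres:
  fixes A :: "mindex set" and w :: "mindex \<Rightarrow> C2" and \<zeta> :: "mindex \<Rightarrow> mindex \<Rightarrow> C2"
  assumes "finite A"
  shows "sdet (A \<times> I) (\<lambda>\<mu> \<nu>. mon4 \<mu> (w (fst \<nu>), \<zeta> (fst \<nu>) (snd \<nu>))) =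
    sdet A (\<lambda>\<alpha> j. mon2 \<alpha> (w j)) ^ card I * (\<Prod>j\<in>A. sdet I (\<lambda>\<beta> i. mon2 \<beta> (\<zeta> j i)))"
proof -
  let ?W = "\<lambda>\<mu> \<nu>. if snd \<mu> = snd \<nu> then mon2 (fst \<mu>) (w (fst \<nu>)) else 0"
  let ?E = "\<lambda>\<mu> \<nu>. if fst \<mu> = fst \<nu> then mon2 (snd \<mu>) (\<zeta> (fst \<nu>) (snd \<nu>)) else 0"
  have "(\<Sum>\<kappa>\<in>A \<times> I. ?W \<mu> \<kappa> * ?E \<kappa> \<nu>) = mon4 \<mu> (w (fst \<nu>), \<zeta> (fst \<nu>) (snd \<nu>))"
    if "\<mu> \<in> A \<times> I" "\<nu> \<in> A \<times> I" for \<mu> \<nu>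
  proof -
    \<comment> \<open>Only the middle index made of the base label of the column and the exponent
      \<beta> of the row survives.\<close>
    have "(\<Sum>\<kappa>\<in>A \<times> I. ?W \<mu> \<kappa> * ?E \<kappa> \<nu>) = (\<Sum>\<kappa>\<in>{(fst \<nu>, snd \<mu>)}. ?W \<mu> \<kappa> * ?E \<kappa> \<nu>)"
      using that assms finite_I by (intro sum.mono_neutral_right) auto
    then show ?thesis by (simp add: mon4_def)
  qed
  then have "sdet (A \<times> I) (\<lambda>\<mu> \<nu>. mon4 \<mu> (w (fst \<nu>), \<zeta> (fst \<nu>) (snd \<nu>))) =
      sdet (A \<times> I) (\<lambda>\<mu> \<nu>. \<Sum>\<kappa>\<in>A \<times> I. ?W \<mu> \<kappa> * ?E \<kappa> \<nu>)"
    by (intro sdet_cong) simp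
  also have "\<dots> = sdet (A \<times> I) ?W * sdet (A \<times> I) ?E"
    using assms finite_I by (intro sdet_mult) auto
  also have "sdet (A \<times> I) ?W = (\<Prod>b\<in>I. sdet A (\<lambda>\<alpha> j. mon2 \<alpha> (w j)))"
    by (subst sdet_block_diagonal[OF assms finite_I]) auto
  also have "sdet (A \<times> I) ?E = (\<Prod>j\<in>A. sdet I (\<lambda>\<beta> i. mon2 \<beta> (\<zeta> j i)))"
    by (subst sdet_block_diagonal'[OF assms finite_I]) auto
  finally show ?thesis by simp
qed

text \<open>A base point with P(w) nonzero supplies |I| fibre points with controlled basis
  determinant, and together they form an admissible configuration in the lift. If P vanishes at some
  base point, the weighted determinant is zero.\<close>

lemma vand_product_ge:
  assumes K: "bounded K" "K \<noteq> {}"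
  obtains C P where "C \<ge> 1" "P \<in> PF" "\<exists>w. P w \<noteq> 0"
    "\<And>k. vand (midx k) (\<lambda>\<alpha> w. P w * mon2 \<alpha> w) K ^ card I \<le> C ^ ((k + 1)\<^sup>2) * vand (midx k \<times> I) mon4 (lift K)"
proof -
  let ?n = "card I"
  obtain P where P: "P \<in> PF" "\<exists>w. P w \<noteq> 0" and
    fibres: "\<And>K. bounded K \<Longrightarrow> \<exists>C>0. \<forall>w\<in>K. P w \<noteq> 0 \<longrightarrow> (\<exists>\<zeta>. (\<forall>i\<in>I. f (\<zeta> i) = w) \<and>
       cmod (P w) ^ ?n \<le> C * cmod (sdet I (\<lambda>\<beta> i. mon2 \<beta> (\<zeta> i))) ^ 2)"
    by (rule fibre_determinant) (rule that)
  from fibres[OF K(1)] obtain C0 where C0: "C0 > 0" "\<And>w. w \<in> K \<Longrightarrow> P w \<noteq> 0 \<Longrightarrow> \<exists>\<zeta>. (\<forall>i\<in>I. f (\<zeta> i) = w) \<and>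
       cmod (P w) ^ ?n \<le> C0 * cmod (sdet I (\<lambda>\<beta> i. mon2 \<beta> (\<zeta> i))) ^ 2" by blast
  obtain B where B: "B \<ge> 1" "\<And>w. w \<in> K \<Longrightarrow> cmod (P w) \<le> B" using PF_bounded[OF P(1) K(1)] by blast
  define C where "C = max 1 (B ^ ?n * C0)"
  have n: "?n > 0" using finite_I zero_in_I by (auto simp: card_gt_0_iff)
  have "vand (midx k) (\<lambda>\<alpha> w. P w * mon2 \<alpha> w) K ^ ?n \<le> C ^ ((k + 1)\<^sup>2) * vand (midx k \<times> I) mon4 (lift K)" for k
  proof -
    let ?A = "midx k" and ?X = "vand (midx k \<times> I) mon4 (lift K)"
    have bd: "bounded_rows (?A \<times> I) mon4 (lift K)" by (intro bounded_rows_mon4 K) (simp add: finite_I)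
    have X: "?X \<ge> 0" by (intro vand_nonneg bd lift_nonempty K) (simp add: finite_I)
    have CX: "0 \<le> C ^ ((k + 1)\<^sup>2) * ?X" using X by (simp add: C_def)
    \<comment> \<open>The root lets an estimate for the n-th power at each configuration pass to the
      supremum.\<close>
    have "vand ?A (\<lambda>\<alpha> w. P w * mon2 \<alpha> w) K \<le> root ?n (C ^ ((k + 1)\<^sup>2) * ?X)"
    proof (rule vand_least[OF K(2)])
      fix w assume w: "\<And>\<alpha>. \<alpha> \<in> ?A \<Longrightarrow> w \<alpha> \<in> K"
      let ?W = "sdet ?A (\<lambda>\<alpha> j. mon2 \<alpha> (w j))"
      let ?y = "cmod (sdet ?A (\<lambda>i j. P (w j) * mon2 i (w j)))"
      have y: "?y = (\<Prod>j\<in>?A. cmod (P (w j))) * cmod ?W"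
        by (simp add: sdet_scale_columns norm_mult prod_norm)
      have "?y ^ ?n \<le> C ^ ((k + 1)\<^sup>2) * ?X"
      proof (cases "\<exists>j\<in>?A. P (w j) = 0")
        case True
        then have "?y = 0" unfolding y by (auto simp: prod_zero_iff)
        then show ?thesis using n CX by (simp add: zero_power)
      next
        case False
        have "\<forall>j\<in>?A. \<exists>\<zeta>. (\<forall>i\<in>I. f (\<zeta> i) = w j) \<and>
            cmod (P (w j)) ^ ?n \<le> C0 * cmod (sdet I (\<lambda>\<beta> i. mon2 \<beta> (\<zeta> i))) ^ 2"
          using C0(2) w False by blast
        then obtain \<zeta> where \<zeta>: "\<And>j i. j \<in> ?A \<Longrightarrow> i \<in> I \<Longrightarrow> f (\<zeta> j i) = w j"
          "\<And>j. j \<in> ?A \<Longrightarrow> cmod (P (w j)) ^ ?n \<le> C0 * cmod (sdet I (\<lambda>\<beta> i. mon2 \<beta> (\<zeta> j i))) ^ 2"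
          by metis
        let ?E = "\<lambda>j. cmod (sdet I (\<lambda>\<beta> i. mon2 \<beta> (\<zeta> j i)))"
        have le_X: "cmod ?W ^ ?n * (\<Prod>j\<in>?A. ?E j) \<le> ?X"
        proof -
          have "cmod (sdet (?A \<times> I) (\<lambda>\<mu> \<nu>. mon4 \<mu> (w (fst \<nu>), \<zeta> (fst \<nu>) (snd \<nu>)))) \<le> ?X"
            by (rule vand_upper[OF _ bd]) (use \<zeta> w finite_I in \<open>auto simp: in_lift_iff\<close>)
          then show ?thesis
            unfolding sdet_fibres[OF finite_midx] by (simp add: norm_mult norm_power prod_norm)
        qed
        \<comment> \<open>Squaring matches the fibre estimate, which bounds |P|^n by the square of
          the basis determinant; the second factor |P|^n is bounded by B^n.\<close>
        have "(?y ^ ?n)\<^sup>2 = (cmod ?W ^ ?n)\<^sup>2 * (\<Prod>j\<in>?A. cmod (P (w j)) ^ ?n * cmod (P (w j)) ^ ?n)"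
          unfolding y by (simp add: power_mult_distrib prod_power_distrib prod.distrib power2_eq_square)
        also have "\<dots> \<le> (cmod ?W ^ ?n)\<^sup>2 * (\<Prod>j\<in>?A. C * ?E j ^ 2)"
        proof (intro mult_left_mono prod_mono conjI)
          fix j assume j: "j \<in> ?A"
          have "cmod (P (w j)) ^ ?n * cmod (P (w j)) ^ ?n \<le> B ^ ?n * (C0 * ?E j ^ 2)"
            using B(2)[OF w[OF j]] \<zeta>(2)[OF j] B(1) by (intro mult_mono power_mono) auto
          also have "\<dots> = (B ^ ?n * C0) * ?E j ^ 2" by simp
          also have "\<dots> \<le> C * ?E j ^ 2" unfolding C_def by (intro mult_right_mono) auto
          finally show "cmod (P (w j)) ^ ?n * cmod (P (w j)) ^ ?n \<le> C * ?E j ^ 2" .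
        qed auto
        also have "\<dots> = C ^ card ?A * (cmod ?W ^ ?n * (\<Prod>j\<in>?A. ?E j))\<^sup>2"
          by (simp add: prod.distrib prod_power_distrib power_mult_distrib)
        also have "\<dots> \<le> (C ^ card ?A)\<^sup>2 * ?X\<^sup>2"
        proof (intro mult_mono power_mono le_X)
          \<comment> \<open>Enlarging the power of \<open>C\<close> completes a square, so that
            square roots can be taken.\<close>
          show "C ^ card ?A \<le> (C ^ card ?A)\<^sup>2"
            unfolding power_mult[symmetric] by (intro power_increasing) (auto simp: C_def)
        qed (auto simp: C_def intro!: mult_nonneg_nonneg prod_nonneg)
        also have "\<dots> = (C ^ card ?A * ?X)\<^sup>2" by (simp add: power_mult_distrib)
        finally have "?y ^ ?n \<le> C ^ card ?A * ?X"
          by (rule power2_le_imp_le) (use X in \<open>auto simp: C_def\<close>)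
        also have "\<dots> \<le> C ^ ((k + 1)\<^sup>2) * ?X"
          using X card_midx_le by (intro mult_right_mono power_increasing) (auto simp: C_def)
        finally show ?thesis .
      qed
      then have "root ?n (?y ^ ?n) \<le> root ?n (C ^ ((k + 1)\<^sup>2) * ?X)"
        using n by (intro real_root_le_mono)
      then show "?y \<le> root ?n (C ^ ((k + 1)\<^sup>2) * ?X)"
        using n by (simp add: real_root_power_cancel)
    qed
    moreover have "vand ?A (\<lambda>\<alpha> w. P w * mon2 \<alpha> w) K \<ge> 0"
      by (intro vand_nonneg bounded_rows_PF finite_midx PF_mult P PF_mon2 K)
    ultimately have "vand ?A (\<lambda>\<alpha> w. P w * mon2 \<alpha> w) K ^ ?n \<le> root ?n (C ^ ((k + 1)\<^sup>2) * ?X) ^ ?n"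
      by (intro power_mono)
    then show ?thesis using n CX by (simp add: real_root_pow_pos2)
  qed
  moreover have "C \<ge> 1" by (simp add: C_def)
  ultimately show thesis using P that by blast
qed

section \<open>The weight filtration between two product index sets\<close>

definition weight_idx :: "nat \<Rightarrow> nat \<Rightarrow> (mindex \<times> mindex) set" where
  "weight_idx d k = {(\<alpha>, \<beta>). \<beta> \<in> I \<and> d * mdeg \<alpha> + mdeg \<beta> \<le> d * k}"

text \<open>A sum in place of a maximum: any uniform bound for |\<beta>| serves the purpose.\<close>

definition max_degree :: nat where
  "max_degree = (\<Sum>\<beta>\<in>I. mdeg \<beta>)"

lemma mdeg_le_max_degree: "\<beta> \<in> I \<Longrightarrow> mdeg \<beta> \<le> max_degree"
  unfolding max_degree_def using member_le_sum[of \<beta> I mdeg] finite_I by auto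

lemma weight_idx_subset:
  assumes "d \<ge> 1"
  shows "weight_idx d k \<subseteq> midx k \<times> I"
proof clarify
  fix a b c e assume "((a, b), (c, e)) \<in> weight_idx d k"
  then have *: "(c, e) \<in> I" "d * mdeg (a, b) + mdeg (c, e) \<le> d * k" by (auto simp: weight_idx_def)
  then have "d * mdeg (a, b) \<le> d * k" by linarith
  then show "(a, b) \<in> midx k \<and> (c, e) \<in> I" using * assms by (auto simp: midx_def)
qed

text \<open>Raising k by \<open>max_degree\<close> raises the weight bound by d times as much, which
  covers |\<beta>| because d is at least 1.\<close>

lemma weight_idx_supset:
  assumes "d \<ge> 1"
  shows "midx k \<times> I \<subseteq> weight_idx d (k + max_degree)"
proof clarify
  fix a b c e assume *: "(a, b) \<in> midx k" "(c, e) \<in> I"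
  have "mdeg (c, e) \<le> d * max_degree"
    using mdeg_le_max_degree[OF *(2)] mult_le_mono1[OF assms, of max_degree] by linarith
  then have "d * mdeg (a, b) + mdeg (c, e) \<le> d * k + d * max_degree"
    using *(1) by (intro add_mono) (auto simp: midx_def)
  then show "((a, b), (c, e)) \<in> weight_idx d (k + max_degree)"
    using * by (simp add: weight_idx_def algebra_simps)
qed

lemma finite_weight_idx: "d \<ge> 1 \<Longrightarrow> finite (weight_idx d k)"
  using finite_subset[OF weight_idx_subset] finite_I by blast

text \<open>Both index sets \<open>weight_idx d (k + max_degree)\<close> and \<open>midx (k + max_degree) \<times> I\<close> arise from
  a smaller one by adding a set \<open>R\<close> of \<open>O(k)\<close> rows.\<close>

lemma vand_add_rows:
  assumes K: "bounded K" "K \<noteq> {}"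
  obtains C where "C \<ge> 1"
    "\<And>k S T. S \<subseteq> T \<Longrightarrow> midx k \<times> I \<subseteq> S \<Longrightarrow> T \<subseteq> midx (k + max_degree) \<times> I \<Longrightarrow>
      vand T mon4 (lift K) \<le> C ^ ((k + 1)\<^sup>2) * vand S mon4 (lift K)"
proof -
  obtain M where M: "M \<ge> 1" "\<And>x \<mu> k. x \<in> lift K \<Longrightarrow> mdeg (fst \<mu>) + mdeg (snd \<mu>) \<le> k \<Longrightarrow> cmod (mon4 \<mu> x) \<le> M ^ k"
    using lift_bounded_mon4[OF K(1)] by metis
  let ?n = "card I" and ?s = max_degree
  \<comment> \<open>The first summand bounds the number of added rows, the others the total degree k
    + 2s of their monomials.\<close>
  define c where "c = ?s * (?s + 1) * ?n + 2 * ?s + 1"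
  define D where "D = (exp (real c) * M ^ c) ^ c"
  define C where "C = 2 ^ ((?s + 1)\<^sup>2 * ?n) * D"
  have "1 \<le> exp (real c) * M ^ c" using mult_mono[of 1 "exp (real c)" 1 "M ^ c"] M by simp
  then have D: "D \<ge> 1" unfolding D_def by (rule one_le_power)
  have "C \<ge> 1" unfolding C_def using mult_mono[of 1 "2 ^ ((?s + 1)\<^sup>2 * ?n)" 1 D] D by simp
  moreover have "vand T mon4 (lift K) \<le> C ^ ((k + 1)\<^sup>2) * vand S mon4 (lift K)"
    if ST: "S \<subseteq> T" "midx k \<times> I \<subseteq> S" "T \<subseteq> midx (k + ?s) \<times> I" for k S T
  proof -
    let ?R = "T - S"
    have "finite T" using finite_subset[OF ST(3)] finite_I by simp
    then have fin: "finite T" "finite S" "finite ?R" using finite_subset[OF ST(1)] by auto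
    have R: "?R \<subseteq> (midx (k + ?s) - midx k) \<times> I" using ST by auto
    have "vand (S \<union> ?R) mon4 (lift K) \<le> 2 ^ (card S + card ?R) * (vand S mon4 (lift K) * vand ?R mon4 (lift K))"
      by (intro vand_union_le fin bounded_rows_mon4 K lift_nonempty finite_UnI) auto
    moreover have "S \<union> ?R = T" using ST by auto
    ultimately have "vand T mon4 (lift K) \<le> 2 ^ (card S + card ?R) * (vand S mon4 (lift K) * vand ?R mon4 (lift K))"
      by simp
    also have "\<dots> \<le> (2 ^ ((?s + 1)\<^sup>2 * ?n)) ^ ((k + 1)\<^sup>2) * (vand S mon4 (lift K) * D ^ ((k + 1)\<^sup>2))"
    proof (intro mult_mono)
      have "card S + card ?R = card T" using card_Un_disjoint[of S ?R] fin \<open>S \<union> ?R = T\<close> by auto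
      also have "\<dots> \<le> card (midx (k + ?s) \<times> I)" using ST(3) finite_I by (intro card_mono) auto
      also have "\<dots> = card (midx (k + ?s)) * ?n" by (rule card_cartesian_product)
      also have "\<dots> \<le> (k + ?s + 1)\<^sup>2 * ?n" by (intro mult_le_mono card_midx_le order.refl)
      also have "\<dots> \<le> ((?s + 1) * (k + 1))\<^sup>2 * ?n" by (intro mult_le_mono power_mono) (auto simp: algebra_simps)
      also have "\<dots> = (?s + 1)\<^sup>2 * ?n * (k + 1)\<^sup>2" by (simp only: power_mult_distrib mult_ac)
      finally have "(2::real) ^ (card S + card ?R) \<le> 2 ^ ((?s + 1)\<^sup>2 * ?n * (k + 1)\<^sup>2)"
        by (intro power_increasing) auto
      then show "(2::real) ^ (card S + card ?R) \<le> (2 ^ ((?s + 1)\<^sup>2 * ?n)) ^ ((k + 1)\<^sup>2)"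
        by (simp only: power_mult)
      show "vand ?R mon4 (lift K) \<le> D ^ ((k + 1)\<^sup>2)"
        unfolding D_def
      proof (rule vand_few_rows[OF fin(3)])
        have "card ?R \<le> card ((midx (k + ?s) - midx k) \<times> I)" using R finite_I by (intro card_mono) auto
        also have "\<dots> \<le> (?s * (?s + 1) * (k + 1)) * ?n"
          unfolding card_cartesian_product by (intro mult_le_mono card_midx_diff_le order.refl)
        also have "\<dots> = ?s * (?s + 1) * ?n * (k + 1)" by (simp only: mult_ac)
        also have "\<dots> \<le> c * (k + 1)" unfolding c_def by (intro mult_le_mono) auto
        finally show "card ?R \<le> c * (k + 1)" .
        fix \<mu> x assume \<mu>: "\<mu> \<in> ?R" "x \<in> lift K"
        then have "mdeg (fst \<mu>) \<le> k + ?s" "mdeg (snd \<mu>) \<le> ?s"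
          using R mdeg_le_max_degree by (auto simp: midx_def)
        then have "mdeg (fst \<mu>) + mdeg (snd \<mu>) \<le> (2 * ?s + 1) * (k + 1)" by (simp add: algebra_simps)
        also have "\<dots> \<le> c * (k + 1)" unfolding c_def by (intro mult_le_mono) auto
        finally show "cmod (mon4 \<mu> x) \<le> M ^ (c * (k + 1))" by (rule M(2)[OF \<mu>(2)])
      qed (use M lift_nonempty K in auto)
      have "0 \<le> vand S mon4 (lift K)" "0 \<le> vand ?R mon4 (lift K)"
        by (intro vand_nonneg fin bounded_rows_mon4 K lift_nonempty)+
      then show "0 \<le> vand S mon4 (lift K)" "0 \<le> vand ?R mon4 (lift K)"
        "0 \<le> vand S mon4 (lift K) * vand ?R mon4 (lift K)" by auto
    qed auto
    also have "\<dots> = C ^ ((k + 1)\<^sup>2) * vand S mon4 (lift K)"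
      by (simp only: C_def power_mult_distrib mult_ac)
    finally show ?thesis .
  qed
  ultimately show thesis by (rule that)
qed

lemma vand_weight_le:
  assumes K: "bounded K" "K \<noteq> {}" and d: "d \<ge> 1"
  obtains C where "C \<ge> 1"
    "\<And>k. vand (weight_idx d (k + max_degree)) mon4 (lift K) \<le> C ^ ((k + 1)\<^sup>2) * vand (midx k) mon2 K ^ card I"
proof -
  obtain A where A: "A \<ge> 1" "\<And>k S T. S \<subseteq> T \<Longrightarrow> midx k \<times> I \<subseteq> S \<Longrightarrow> T \<subseteq> midx (k + max_degree) \<times> I \<Longrightarrow>
      vand T mon4 (lift K) \<le> A ^ ((k + 1)\<^sup>2) * vand S mon4 (lift K)"
    by (rule vand_add_rows[OF K]) (rule that)
  obtain B where B: "B \<ge> 1"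
    "\<And>k. vand (midx k \<times> I) mon4 (lift K) \<le> B ^ ((k + 1)\<^sup>2) * vand (midx k) mon2 K ^ card I"
    by (rule vand_product_le[OF K]) (rule that)
  show thesis
  proof (rule that[of "A * B"])
    show "A * B \<ge> 1" using mult_mono[of 1 A 1 B] A B by simp
    fix k
    have "vand (weight_idx d (k + max_degree)) mon4 (lift K) \<le> A ^ ((k + 1)\<^sup>2) * vand (midx k \<times> I) mon4 (lift K)"
      by (rule A(2)[OF weight_idx_supset[OF d] order.refl weight_idx_subset[OF d]])
    also have "\<dots> \<le> A ^ ((k + 1)\<^sup>2) * (B ^ ((k + 1)\<^sup>2) * vand (midx k) mon2 K ^ card I)"
      using A(1) B(2) by (intro mult_left_mono) auto
    finally show "vand (weight_idx d (k + max_degree)) mon4 (lift K) \<le> (A * B) ^ ((k + 1)\<^sup>2) * vand (midx k) mon2 K ^ card I"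
      by (simp add: power_mult_distrib mult.assoc)
  qed
qed

lemma power_square_shift:
  fixes A :: real
  assumes "A \<ge> 1"
  shows "A ^ ((k + s + 1)\<^sup>2) \<le> (A ^ ((s + 1)\<^sup>2)) ^ ((k + 1)\<^sup>2)"
proof -
  have "(k + s + 1)\<^sup>2 \<le> ((s + 1) * (k + 1))\<^sup>2" by (intro power_mono) (auto simp: algebra_simps)
  then show ?thesis
    unfolding power_mult[symmetric] using assms by (intro power_increasing) (simp_all only: power_mult_distrib)
qed

text \<open>Three losses are chained: multiplication by P shifts the degree by \<delta>, full fibres
  lead to the product index set at level k + s with s = \<open>max_degree\<close>, and the rows
  outside the weight set are then removed. Hence t = s + \<delta>.\<close>

lemma vand_weight_ge:
  assumes K: "bounded K" "K \<noteq> {}" and d: "d \<ge> 1"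
  obtains C t where "C \<ge> 1"
    "\<And>k. vand (midx (k + t)) mon2 K ^ card I \<le> C ^ ((k + 1)\<^sup>2) * vand (weight_idx d (k + max_degree)) mon4 (lift K)"
proof -
  obtain A where A: "A \<ge> 1" "\<And>k S T. S \<subseteq> T \<Longrightarrow> midx k \<times> I \<subseteq> S \<Longrightarrow> T \<subseteq> midx (k + max_degree) \<times> I \<Longrightarrow>
      vand T mon4 (lift K) \<le> A ^ ((k + 1)\<^sup>2) * vand S mon4 (lift K)"
    by (rule vand_add_rows[OF K]) (rule that)
  obtain B P where B: "B \<ge> 1" "P \<in> PF" "\<exists>w. P w \<noteq> 0"
    "\<And>k. vand (midx k) (\<lambda>\<alpha> w. P w * mon2 \<alpha> w) K ^ card I \<le> B ^ ((k + 1)\<^sup>2) * vand (midx k \<times> I) mon4 (lift K)"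
    by (rule vand_product_ge[OF K]) (rule that)
  obtain D \<delta> where D: "D \<ge> 1"
    "\<And>k. vand (midx (k + \<delta>)) mon2 K \<le> D ^ ((k + 1)\<^sup>2) * vand (midx k) (\<lambda>\<alpha> w. P w * mon2 \<alpha> w) K"
    by (rule vand_multiply_polynomial[OF B(2,3) K]) (rule that)
  let ?s = max_degree and ?n = "card I"
  define C where "C = (D ^ ?n * B) ^ ((?s + 1)\<^sup>2) * A"
  have DB: "D ^ ?n * B \<ge> 1" using mult_mono[of 1 "D ^ ?n" 1 B] B(1) D(1) by simp
  show thesis
  proof (rule that[of C "?s + \<delta>"])
    show "C \<ge> 1" unfolding C_def using mult_mono[of 1 "(D ^ ?n * B) ^ ((?s + 1)\<^sup>2)" 1 A] A(1) DB by simp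
    fix k
    let ?k = "k + ?s"
    let ?v = "vand (midx (?k + \<delta>)) mon2 K" and ?Y = "vand (midx ?k) (\<lambda>\<alpha> w. P w * mon2 \<alpha> w) K"
    let ?X = "vand (midx ?k \<times> I) mon4 (lift K)" and ?Z = "vand (weight_idx d ?k) mon4 (lift K)"
    have "?v \<ge> 0" by (rule vand_nonneg[OF finite_midx bounded_rows_mon2[OF finite_midx K(1)] K(2)])
    have Z: "?Z \<ge> 0" by (intro vand_nonneg finite_weight_idx bounded_rows_mon4 K lift_nonempty d)
    have "?v ^ ?n \<le> (D ^ ((?k + 1)\<^sup>2) * ?Y) ^ ?n" by (rule power_mono[OF D(2) \<open>?v \<ge> 0\<close>])
    also have "\<dots> = (D ^ ?n) ^ ((?k + 1)\<^sup>2) * ?Y ^ ?n"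
      by (simp only: power_mult_distrib power_mult[symmetric] mult.commute)
    also have "\<dots> \<le> (D ^ ?n) ^ ((?k + 1)\<^sup>2) * (B ^ ((?k + 1)\<^sup>2) * ?X)"
      using B(4) D(1) by (intro mult_left_mono) auto
    also have "\<dots> \<le> (D ^ ?n) ^ ((?k + 1)\<^sup>2) * (B ^ ((?k + 1)\<^sup>2) * (A ^ ((k + 1)\<^sup>2) * ?Z))"
      using B(1) D(1) by (intro mult_left_mono A(2) weight_idx_supset weight_idx_subset d order.refl) auto
    also have "\<dots> = (D ^ ?n * B) ^ ((k + ?s + 1)\<^sup>2) * (A ^ ((k + 1)\<^sup>2) * ?Z)"
      by (simp only: power_mult_distrib mult.assoc)
    also have "\<dots> \<le> ((D ^ ?n * B) ^ ((?s + 1)\<^sup>2)) ^ ((k + 1)\<^sup>2) * (A ^ ((k + 1)\<^sup>2) * ?Z)"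
      using Z A(1) by (intro mult_right_mono power_square_shift DB) auto
    also have "\<dots> = C ^ ((k + 1)\<^sup>2) * ?Z"
      by (simp only: C_def power_mult_distrib mult.assoc)
    finally show "vand (midx (k + (?s + \<delta>))) mon2 K ^ ?n \<le> C ^ ((k + 1)\<^sup>2) * ?Z"
      by (simp add: add.assoc)
  qed
qed

end

section \<open>Enumerations and filtrations\<close>

text \<open>Orders of type omega on \<open>S\<close>; here the definite description in
  \<open>enum_by\<close> has exactly one solution for each n.\<close>

locale omega_order =
  fixes r :: "('i \<times> 'i) set" and S :: "'i set"
  assumes trans_r: "trans r" and irrefl_r: "(x, x) \<notin> r"
    and total_r: "x \<in> S \<Longrightarrow> y \<in> S \<Longrightarrow> x \<noteq> y \<Longrightarrow> (x, y) \<in> r \<or> (y, x) \<in> r"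
    and finite_below: "s \<in> S \<Longrightarrow> finite {t \<in> S. (t, s) \<in> r}"
    and infinite_S: "infinite S"
begin

definition rank :: "'i \<Rightarrow> nat" where
  "rank s = card {t \<in> S. (t, s) \<in> r}"

text \<open>Finite down-closed sets. Each consists of the first entries of the enumeration, which
  expresses compatibility of a filtration with the ordering.\<close>

definition initial :: "'i set \<Rightarrow> bool" where
  "initial B \<longleftrightarrow> B \<subseteq> S \<and> finite B \<and> (\<forall>t\<in>B. \<forall>s\<in>S. (s, t) \<in> r \<longrightarrow> s \<in> B)"

lemma rank_less: "s \<in> S \<Longrightarrow> t \<in> S \<Longrightarrow> (s, t) \<in> r \<Longrightarrow> rank s < rank t"
  unfolding rank_def
  by (rule psubset_card_mono[OF finite_below]) (use trans_r irrefl_r in \<open>auto dest: transD\<close>)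

lemma rank_inj: "inj_on rank S"
  using rank_less total_r by (intro inj_onI) (metis less_irrefl)

lemma rank_image:
  assumes "initial B"
  shows "rank ` B = {..<card B}"
proof (rule card_subset_eq)
  show "rank ` B \<subseteq> {..<card B}"
  proof clarsimp
    fix t assume t: "t \<in> B"
    have "rank t < card B"
      unfolding rank_def using assms t irrefl_r
      by (intro psubset_card_mono) (auto simp: initial_def)
    then show "rank t < card B" .
  qed
  have "inj_on rank B" using inj_on_subset[OF rank_inj] assms by (auto simp: initial_def)
  then show "card (rank ` B) = card {..<card B}" by (simp add: card_image)
qed simp

text \<open>The down-closure of any n + 1 elements is an initial set with at least n + 1 elements,
  and the ranks of an initial set leave no gaps.\<close>

lemma rank_surj: "\<exists>s\<in>S. rank s = n"
proof -
  obtain T where T: "finite T" "card T = Suc n" "T \<subseteq> S"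
    using infinite_arbitrarily_large[OF infinite_S] by blast
  define D where "D = T \<union> (\<Union>s\<in>T. {t \<in> S. (t, s) \<in> r})"
  have D: "initial D"
    unfolding initial_def D_def using T finite_below trans_r by (auto dest: transD)
  have "card T \<le> card D" using D by (intro card_mono) (auto simp: D_def initial_def)
  then have "n \<in> rank ` D" unfolding rank_image[OF D] using T by simp
  then show ?thesis using D by (auto simp: initial_def)
qed

lemma enum_by: "enum_by r S n \<in> S" "rank (enum_by r S n) = n"
proof -
  have "\<exists>!s. s \<in> S \<and> rank s = n" using rank_surj rank_inj by (metis inj_onD)
  from theI'[OF this] show "enum_by r S n \<in> S" "rank (enum_by r S n) = n"
    unfolding enum_by_def rank_def by auto
qed

lemma enum_by_in_initial_iff:
  assumes "initial B"
  shows "enum_by r S j \<in> B \<longleftrightarrow> j < card B"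
proof
  assume "enum_by r S j \<in> B"
  then have "rank (enum_by r S j) \<in> {..<card B}" using rank_image[OF assms] by blast
  then show "j < card B" by (simp add: enum_by)
next
  assume "j < card B"
  then obtain s where s: "s \<in> B" "rank s = j" using rank_image[OF assms] by (metis imageE lessThan_iff)
  then have "s = enum_by r S j"
    using inj_onD[OF rank_inj, of s "enum_by r S j"] enum_by assms by (auto simp: initial_def)
  then show "enum_by r S j \<in> B" using s by simp
qed

lemma enum_by_bij:
  assumes "initial B"
  shows "bij_betw (enum_by r S) {..<card B} B"
proof (rule bij_betwI[where g=rank])
  have "B \<subseteq> S" using assms by (simp add: initial_def)
  show "enum_by r S \<in> {..<card B} \<rightarrow> B" using enum_by_in_initial_iff[OF assms] by auto
  show "rank \<in> B \<rightarrow> {..<card B}" using rank_image[OF assms] by blast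
  show "enum_by r S (rank s) = s" if "s \<in> B" for s
    using inj_onD[OF rank_inj, of "enum_by r S (rank s)" s] enum_by that \<open>B \<subseteq> S\<close> by auto
qed (simp add: enum_by)

lemma filtration:
  assumes "\<And>k. initial (B k)" "\<And>j k. e j \<in> A k \<longleftrightarrow> enum_by r S j \<in> B k"
    and "\<And>j. e j = g (enum_by r S j)"
  shows "filt_m e A k = card (B k)" "Van e (filt_m e A k) E = vand (B k) g E"
proof -
  have "{j. e j \<in> A k} = {..<card (B k)}"
    using assms(2) enum_by_in_initial_iff[OF assms(1)] by auto
  then show m: "filt_m e A k = card (B k)" by (simp add: filt_m_def)
  show "Van e (filt_m e A k) E = vand (B k) g E"
    unfolding m by (rule Van_eq_vand[OF enum_by_bij[OF assms(1)]]) (rule assms(3))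
qed

end

lemma omega_order_mindex: "omega_order mindex_less UNIV"
proof
  show "trans mindex_less" by (rule mindex_less_trans)
  show "(x, x) \<notin> mindex_less" for x by (simp add: mindex_less_iff)
  show "finite {t \<in> UNIV. (t, s) \<in> mindex_less}" for s
    by (rule finite_subset[OF _ finite_midx[of "mdeg s"]]) (auto simp: mindex_less_iff midx_def)
  show "infinite (UNIV :: mindex set)" by (simp add: finite_prod)
qed (use mindex_less_total in auto)

lemma weight_less_iff:
  "(\<mu>, \<nu>) \<in> weight_less d \<longleftrightarrow>
    (d * mdeg (fst \<mu>) + mdeg (snd \<mu>) < d * mdeg (fst \<nu>) + mdeg (snd \<nu>) \<or>
     d * mdeg (fst \<mu>) + mdeg (snd \<mu>) = d * mdeg (fst \<nu>) + mdeg (snd \<nu>) \<and>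
      ((fst \<mu>, fst \<nu>) \<in> mindex_less \<or> fst \<mu> = fst \<nu> \<and> (snd \<mu>, snd \<nu>) \<in> mindex_less))"
  by (cases \<mu>; cases \<nu>) (simp add: weight_less_def)

context finite_cover
begin

lemma omega_order_weight:
  assumes d: "d \<ge> 1"
  shows "omega_order (weight_less d) {(\<alpha>, \<beta>). \<beta> \<in> I}"
proof
  show "trans (weight_less d)"
    unfolding weight_less_def
    by (intro trans_inv_image trans_lex_prod trans_less_than mindex_less_trans)
  show "(x, x) \<notin> weight_less d" for x by (simp add: weight_less_iff mindex_less_iff)
  show "(x, y) \<in> weight_less d \<or> (y, x) \<in> weight_less d" if "x \<noteq> y" for x y
    using that mindex_less_total[of "fst x" "fst y"] mindex_less_total[of "snd x" "snd y"]
    unfolding weight_less_iff by (metis linorder_neqE_nat prod_eqI)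
  show "finite {t \<in> {(\<alpha>, \<beta>). \<beta> \<in> I}. (t, s) \<in> weight_less d}" for s
  \<comment> \<open>Replacing |\<beta>| by d|\<beta>| rounds the weight of \<open>s\<close> up to a
    multiple of d, the only kind of bound that \<open>weight_idx\<close> expresses.\<close>
  proof (rule finite_subset[OF _ finite_weight_idx[OF d, of "mdeg (fst s) + mdeg (snd s)"]])
    have "mdeg (snd s) \<le> d * mdeg (snd s)" using mult_le_mono1[OF d, of "mdeg (snd s)"] by linarith
    then have "d * mdeg (fst t) + mdeg (snd t) \<le> d * mdeg (fst s) + d * mdeg (snd s)"
      if "(t, s) \<in> weight_less d" for t
      using that unfolding weight_less_iff by linarith
    then show "{t \<in> {(\<alpha>, \<beta>). \<beta> \<in> I}. (t, s) \<in> weight_less d} \<subseteq> weight_idx d (mdeg (fst s) + mdeg (snd s))"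
      unfolding weight_idx_def distrib_left by fastforce
  qed
  show "infinite {(\<alpha>::mindex, \<beta>). \<beta> \<in> I}"
  proof
    assume "finite {(\<alpha>::mindex, \<beta>). \<beta> \<in> I}"
    then have "finite (fst ` {(\<alpha>::mindex, \<beta>). \<beta> \<in> I})" by (rule finite_imageI)
    moreover have "fst ` {(\<alpha>::mindex, \<beta>). \<beta> \<in> I} = UNIV" using zero_in_I by force
    ultimately show False by (simp add: finite_prod)
  qed
qed

end

section \<open>Asymptotics of the filtrations\<close>

lemma summation_by_parts:
  fixes x :: "nat \<Rightarrow> real"
  shows "(\<Sum>\<nu>=1..k. real \<nu> * (x \<nu> - x (\<nu> - 1))) = real k * x k - (\<Sum>\<nu><k. x \<nu>)"
  by (induction k) (auto simp: algebra_simps)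

text \<open>Degree \<nu> has \<nu> + 1 monomials, so this is the sum of \<nu>(\<nu> + 1).\<close>

lemma midx_weighted_sum:
  "(\<Sum>\<nu>=1..k. real \<nu> * (real (card (midx \<nu>)) - real (card (midx (\<nu> - 1))))) =
    real k * (real k + 1) * (real k + 2) / 3"
  by (induction k) (auto simp: card_midx_Suc field_simps)

text \<open>An O(k) error in the dimensions becomes an O(k^2) error in l_k: after summation by parts
  the errors enter through their size, not through their increments.\<close>

lemma weighted_sum_limit:
  assumes "\<And>k. \<bar>real (m k) - n * real (card (midx k))\<bar> \<le> c * (real k + 1)"
  shows "(\<lambda>k. (\<Sum>\<nu>=1..k. real \<nu> * (real (m \<nu>) - real (m (\<nu> - 1)))) / real k ^ 3) \<longlonglongrightarrow> n / 3"
proof -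
  let ?l = "\<lambda>k. \<Sum>\<nu>=1..k. real \<nu> * (real (m \<nu>) - real (m (\<nu> - 1)))"
  let ?h = "\<lambda>k. n * (real k * (real k + 1) * (real k + 2) / 3)"
  define x where "x = (\<lambda>k. real (m k) - n * real (card (midx k)))"
  have diff: "?l k - ?h k = real k * x k - (\<Sum>\<nu><k. x \<nu>)" for k
    unfolding summation_by_parts[symmetric] midx_weighted_sum[symmetric]
    by (simp add: x_def sum_distrib_left sum_subtractf[symmetric] algebra_simps)
  have c: "c \<ge> 0" using order.trans[OF abs_ge_zero assms[of 0]] by simp
  have bound: "\<bar>?l k - ?h k\<bar> \<le> 2 * c * (real k + 1)\<^sup>2" for k
  proof -
    have x: "\<bar>x \<nu>\<bar> \<le> c * (real k + 1)" if "\<nu> \<le> k" for \<nu>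
    proof -
      have "\<bar>x \<nu>\<bar> \<le> c * (real \<nu> + 1)" unfolding x_def by (rule assms)
      also have "\<dots> \<le> c * (real k + 1)" using that c by (intro mult_left_mono) auto
      finally show ?thesis .
    qed
    have "\<bar>\<Sum>\<nu><k. x \<nu>\<bar> \<le> (\<Sum>\<nu><k. c * (real k + 1))"
      by (rule order.trans[OF sum_abs sum_mono]) (use x in auto)
    moreover have "\<bar>real k * x k\<bar> \<le> real k * (c * (real k + 1))"
      using x[of k] by (simp add: abs_mult mult_left_mono)
    ultimately have "\<bar>?l k - ?h k\<bar> \<le> 2 * (real k * (c * (real k + 1)))"
      unfolding diff by simp
    also have "\<dots> \<le> 2 * c * (real k + 1)\<^sup>2"
      using c by (simp add: power2_eq_square algebra_simps)
    finally show ?thesis .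
  qed
  have "(\<lambda>k. (?l k - ?h k) / real k ^ 3) \<longlonglongrightarrow> 0"
  proof (rule Lim_null_comparison)
    show "\<forall>\<^sub>F k in sequentially. norm ((?l k - ?h k) / real k ^ 3) \<le> 2 * c * ((real k + 1)\<^sup>2 / real k ^ 3)"
      using bound by (intro always_eventually allI) (simp add: divide_right_mono)
    have "(\<lambda>k. (real k + 1)\<^sup>2 / real k ^ 3) \<longlonglongrightarrow> 0" by real_asymp
    then show "(\<lambda>k. 2 * c * ((real k + 1)\<^sup>2 / real k ^ 3)) \<longlonglongrightarrow> 0" by (rule tendsto_mult_right_zero)
  qed
  moreover have "(\<lambda>k. n * ((real k * (real k + 1) * (real k + 2) / 3) / real k ^ 3)) \<longlonglongrightarrow> n * (1 / 3)"
    by (intro tendsto_mult tendsto_const) real_asymp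
  ultimately have "(\<lambda>k. (?l k - ?h k) / real k ^ 3 + n * ((real k * (real k + 1) * (real k + 2) / 3) / real k ^ 3)) \<longlonglongrightarrow> 0 + n * (1 / 3)"
    by (rule tendsto_add)
  then show ?thesis by (simp add: diff_divide_distrib)
qed

lemma cubic_imp_at_top:
  assumes "(\<lambda>k. l k / real k ^ 3) \<longlonglongrightarrow> c" "c > 0"
  shows "filterlim l at_top sequentially"
proof -
  have "filterlim (\<lambda>k. l k / real k ^ 3 * real k ^ 3) at_top sequentially"
    by (rule filterlim_tendsto_pos_mult_at_top[OF assms]) real_asymp
  moreover have "\<forall>\<^sub>F k in sequentially. l k / real k ^ 3 * real k ^ 3 = l k"
    using eventually_gt_at_top[of 0] by eventually_elim simp
  ultimately show ?thesis by (rule filterlim_cong[THEN iffD1, OF refl refl, rotated])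
qed

text \<open>Factors \<open>exp (O(k\<^sup>2))\<close> and bounded index shifts disappear in the \<open>l\<close>-th roots, as \<open>l\<close> is cubic.\<close>

lemma limsup_root_le:
  fixes a b la lb :: "nat \<Rightarrow> real"
  assumes a: "\<And>k. a k \<ge> 0" and b: "\<And>k. b k \<ge> 0" and C: "C \<ge> 1" and p: "p > 0"
    and le: "\<And>k. b (k + t) \<le> C ^ ((k + 1)\<^sup>2) * a (k + s) powr p"
    and la: "(\<lambda>k. la k / real k ^ 3) \<longlonglongrightarrow> c" and lb: "(\<lambda>k. lb k / real k ^ 3) \<longlonglongrightarrow> p * c" and c: "c > 0"
  shows "limsup (\<lambda>k. ereal (b k powr (1 / lb k))) \<le> limsup (\<lambda>k. ereal (a k powr (1 / la k)))"
proof (rule ccontr)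
  let ?A = "limsup (\<lambda>k. ereal (a k powr (1 / la k)))" and ?B = "limsup (\<lambda>k. ereal (b k powr (1 / lb k)))"
  assume "\<not> ?B \<le> ?A"
  then have "?A < ?B" by simp
  then obtain x where x: "?A < ereal x" "ereal x < ?B" using ereal_dense2 by blast
  have "0 \<le> ?A" by (rule le_Limsup) (auto intro!: always_eventually)
  then have x0: "x > 0" using x(1) by (metis ereal_less(2) le_less_trans)
  have pos_a: "\<forall>\<^sub>F k in sequentially. la k > 0"
    using filterlim_at_top_dense[THEN iffD1, OF cubic_imp_at_top[OF la c]] by blast
  have pos_b: "\<forall>\<^sub>F k in sequentially. lb k > 0"
    using filterlim_at_top_dense[THEN iffD1, OF cubic_imp_at_top[OF lb]] p c by simp
  have "\<forall>\<^sub>F k in sequentially. ereal (a k powr (1 / la k)) < ereal x" by (rule Limsup_lessD[OF x(1)])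
  then have a_le: "\<forall>\<^sub>F k in sequentially. a k \<le> x powr la k"
    using pos_a
  proof eventually_elim
    case (elim k)
    have "a k = (a k powr (1 / la k)) powr la k"
      using elim a[of k] by (simp add: powr_powr)
    also have "\<dots> \<le> x powr la k" using elim by (intro powr_mono2) auto
    finally show ?case .
  qed
  \<comment> \<open>The bound after taking the \<open>lb\<close>-th root. The first exponent tends
    to 0 like k^2 / k^3, the second to 1 because \<open>lb\<close> is asymptotic to p times
    \<open>la\<close>.\<close>
  define u where "u = (\<lambda>k. C powr (real ((k + 1)\<^sup>2) / lb (k + t)) * x powr (p * la (k + s) / lb (k + t)))"
  have "\<forall>\<^sub>F k in sequentially. ereal (b (k + t) powr (1 / lb (k + t))) \<le> ereal (u k)"
    using a_le[THEN sequentially_offset, of s] pos_b[THEN sequentially_offset, of t]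
  proof eventually_elim
    case (elim k)
    have "b (k + t) \<le> C ^ ((k + 1)\<^sup>2) * a (k + s) powr p" by (rule le)
    also have "\<dots> \<le> C powr real ((k + 1)\<^sup>2) * x powr (p * la (k + s))"
    proof (intro mult_mono)
      show "C ^ ((k + 1)\<^sup>2) \<le> C powr real ((k + 1)\<^sup>2)" using C by (simp only: powr_realpow)
      have "a (k + s) powr p \<le> (x powr la (k + s)) powr p" using elim a p by (intro powr_mono2) auto
      then show "a (k + s) powr p \<le> x powr (p * la (k + s))" by (simp add: powr_powr mult.commute)
    qed auto
    finally have "b (k + t) powr (1 / lb (k + t)) \<le>
        (C powr real ((k + 1)\<^sup>2) * x powr (p * la (k + s))) powr (1 / lb (k + t))"
      using elim b by (intro powr_mono2) auto
    also have "\<dots> = u k" using C x0 by (simp add: u_def powr_mult powr_powr)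
    finally show ?case by simp
  qed
  then have "limsup (\<lambda>k. ereal (b (k + t) powr (1 / lb (k + t)))) \<le> limsup (\<lambda>k. ereal (u k))"
    by (rule Limsup_mono)
  moreover have "u \<longlonglongrightarrow> C powr 0 * x powr 1"
    unfolding u_def
  proof (intro tendsto_mult tendsto_powr tendsto_const)
    have lbt: "(\<lambda>k. lb (k + t) / real (k + t) ^ 3) \<longlonglongrightarrow> p * c" by (rule LIMSEQ_ignore_initial_segment[OF lb])
    have las: "(\<lambda>k. la (k + s) / real (k + s) ^ 3) \<longlonglongrightarrow> c" by (rule LIMSEQ_ignore_initial_segment[OF la])
    have "(\<lambda>k. (real ((k + 1)\<^sup>2) / real (k + t) ^ 3) / (lb (k + t) / real (k + t) ^ 3)) \<longlonglongrightarrow> 0 / (p * c)"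
    proof (rule tendsto_divide[OF _ lbt])
      show "(\<lambda>k. real ((k + 1)\<^sup>2) / real (k + t) ^ 3) \<longlonglongrightarrow> 0" by real_asymp
    qed (use p c in auto)
    moreover have "\<forall>\<^sub>F k in sequentially. (real ((k + 1)\<^sup>2) / real (k + t) ^ 3) / (lb (k + t) / real (k + t) ^ 3) =
        real ((k + 1)\<^sup>2) / lb (k + t)"
      using eventually_gt_at_top[of 0] by eventually_elim simp
    ultimately show "(\<lambda>k. real ((k + 1)\<^sup>2) / lb (k + t)) \<longlonglongrightarrow> 0"
      by (simp add: Lim_transform_eventually)
    have "(\<lambda>k. (p * (la (k + s) / real (k + s) ^ 3) * (real (k + s) ^ 3 / real (k + t) ^ 3)) / (lb (k + t) / real (k + t) ^ 3))
        \<longlonglongrightarrow> (p * c * 1) / (p * c)"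
    proof (rule tendsto_divide[OF tendsto_mult[OF tendsto_mult[OF tendsto_const las]] lbt])
      show "(\<lambda>k. real (k + s) ^ 3 / real (k + t) ^ 3) \<longlonglongrightarrow> 1" by real_asymp
    qed (use p c in auto)
    moreover have "\<forall>\<^sub>F k in sequentially. (p * (la (k + s) / real (k + s) ^ 3) * (real (k + s) ^ 3 / real (k + t) ^ 3)) / (lb (k + t) / real (k + t) ^ 3)
        = p * la (k + s) / lb (k + t)"
      using eventually_gt_at_top[of 0] by eventually_elim simp
    ultimately show "(\<lambda>k. p * la (k + s) / lb (k + t)) \<longlonglongrightarrow> 1"
      using p c by (simp add: Lim_transform_eventually)
  qed (use C x0 in auto)
  then have "(\<lambda>k. ereal (u k)) \<longlonglongrightarrow> ereal x" using C x0 by simp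
  then have "limsup (\<lambda>k. ereal (u k)) = ereal x" by (rule lim_imp_Limsup[OF trivial_limit_sequentially])
  moreover have "limsup (\<lambda>k. ereal (b (k + t) powr (1 / lb (k + t)))) = ?B" by (rule limsup_shift_k)
  ultimately show False using x(2) by simp
qed

text \<open>For empty K all Vandermonde suprema equal \<open>Sup {}\<close>, one fixed real about
  which nothing need be known; both diameters then take the same value.\<close>

lemma limsup_const_root:
  assumes "filterlim l at_top sequentially"
  shows "limsup (\<lambda>k. ereal (x powr (1 / l k))) = (if x = 0 then 0 else 1)"
proof (cases "x = 0")
  case True
  then show ?thesis by (simp add: Limsup_const zero_ereal_def[symmetric])
next
  case False
  have "(\<lambda>k. 1 / l k) \<longlonglongrightarrow> 0" using assms by (intro tendsto_divide_0[OF tendsto_const] filterlim_at_top_imp_at_infinity)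
  then have "(\<lambda>k. x powr (1 / l k)) \<longlonglongrightarrow> x powr 0" using False by (intro tendsto_powr tendsto_const)
  then have "(\<lambda>k. ereal (x powr (1 / l k))) \<longlonglongrightarrow> ereal 1" using False by simp
  from lim_imp_Limsup[OF trivial_limit_sequentially this] show ?thesis
    using False by (simp add: one_ereal_def)
qed

section \<open>The transfinite diameters\<close>

lemma fekete_leja_eq:
  "fekete_leja K = limsup (\<lambda>k. ereal (vand (midx k) mon2 K powr (1 / (\<Sum>\<nu>=1..k. real \<nu> * (real (card (midx \<nu>)) - real (card (midx (\<nu> - 1))))))))"
proof -
  interpret omega_order mindex_less UNIV by (rule omega_order_mindex)
  let ?e = "\<lambda>j. mon2 (enum_by mindex_less UNIV j)"
  have "initial (midx k)" for k by (auto simp: initial_def midx_def mindex_less_iff finite_midx[unfolded midx_def])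
  moreover have "?e j \<in> polys_le k \<longleftrightarrow> enum_by mindex_less UNIV j \<in> midx k" for j k
    by (simp add: mon2_in_polys_le_iff midx_def)
  ultimately have *: "filt_m ?e polys_le k = card (midx k)" "Van ?e (filt_m ?e polys_le k) K = vand (midx k) mon2 K" for k
    using filtration[of midx ?e polys_le mon2] by auto
  show ?thesis
    unfolding fekete_leja_def transfinite_diameter_def filt_l_def *(2) unfolding *(1) ..
qed

context finite_cover
begin

lemma tdiam3_eq_fekete_leja: "tdiam3 (lift K) = fekete_leja K"
proof -
  let ?e = "\<lambda>j. mon2 (enum_by mindex_less UNIV j)"
  let ?e' = "\<lambda>j (w :: C2, z :: C2). mon2 (enum_by mindex_less UNIV j) w"
  let ?A = "\<lambda>k. {q :: C2 \<times> C2 \<Rightarrow> complex. \<exists>p\<in>polys_le k. q = (\<lambda>(w, z). p w)}"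
  have "?e' j \<in> ?A k \<longleftrightarrow> ?e j \<in> polys_le k" for j k
  proof
    assume "?e' j \<in> ?A k"
    then obtain p where p: "p \<in> polys_le k" "?e' j = (\<lambda>(w, z). p w)" by blast
    have "?e j w = p w" for w using fun_cong[OF p(2), of "(w, w)"] by simp
    then show "?e j \<in> polys_le k" using p(1) by (metis ext)
  qed blast
  then have m: "filt_m ?e' ?A = filt_m ?e polys_le" by (simp add: filt_m_def fun_eq_iff)
  have "Van ?e' n (lift K) = Van ?e n K" for n
  proof -
    have "(\<lambda>\<zeta>. cmod (sdet {..<n} (\<lambda>i j. ?e' i (\<zeta> j)))) ` {\<zeta>. \<forall>k<n. \<zeta> k \<in> lift K} =
      (\<lambda>\<zeta>. cmod (sdet {..<n} (\<lambda>i j. ?e i (\<zeta> j)))) ` {\<zeta>. \<forall>k<n. \<zeta> k \<in> K}" (is "?l ` ?X = ?r ` ?Y")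
    proof (intro equalityI subsetI)
      fix y assume "y \<in> ?l ` ?X"
      then obtain \<zeta> where \<zeta>: "\<forall>k<n. \<zeta> k \<in> lift K" and y: "y = ?l \<zeta>" by auto
      have "y = ?r (\<lambda>k. fst (\<zeta> k))" unfolding y by (simp add: case_prod_beta)
      moreover have "(\<lambda>k. fst (\<zeta> k)) \<in> ?Y" using \<zeta> by (auto simp: in_lift_iff)
      ultimately show "y \<in> ?r ` ?Y" by (rule image_eqI)
    next
      fix y assume "y \<in> ?r ` ?Y"
      then obtain \<zeta> where \<zeta>: "\<forall>k<n. \<zeta> k \<in> K" and y: "y = ?r \<zeta>" by auto
      \<comment> \<open>A section of f lifts any configuration from \<open>K\<close>; only the
        w-coordinates enter the determinant.\<close>
      obtain g where g: "\<And>w. f (g w) = w" using surj_f by metis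
      have "y = ?l (\<lambda>k. (\<zeta> k, g (\<zeta> k)))" unfolding y by simp
      moreover have "(\<lambda>k. (\<zeta> k, g (\<zeta> k))) \<in> ?X" using \<zeta> g by (auto simp: in_lift_iff)
      ultimately show "y \<in> ?l ` ?X" by (rule image_eqI)
    qed
    then show ?thesis by (simp only: Van_def sdet_eq_det)
  qed
  then show ?thesis
    by (simp add: tdiam3_def fekete_leja_def transfinite_diameter_def filt_l_def m)
qed

lemma tdiam2_eq:
  assumes d: "d \<ge> 1" and f: "poly_of_degree d (\<lambda>z. fst (f z))" "poly_of_degree d (\<lambda>z. snd (f z))"
    and nb: "normal_basis f = {(\<alpha>, \<beta>). \<beta> \<in> I}"
  shows "tdiam2 f d E = limsup (\<lambda>k. ereal (vand (weight_idx d k) mon4 E powr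
    (1 / (\<Sum>\<nu>=1..k. real \<nu> * (real (card (weight_idx d \<nu>)) - real (card (weight_idx d (\<nu> - 1))))))))"
proof -
  let ?S = "{(\<alpha>, \<beta>). \<beta> \<in> I}"
  interpret omega_order "weight_less d" ?S by (rule omega_order_weight[OF d])
  let ?e = "\<lambda>j. mon4 (enum_by (weight_less d) ?S j)"
  let ?A = "\<lambda>k. {q \<in> normal_forms f. (\<lambda>z. q (f z, z)) \<in> polys_le (d * k)}"
  have initial: "initial (weight_idx d k)" for k
    using finite_weight_idx[OF d] by (auto simp: initial_def weight_idx_def weight_less_iff)
  have in_A: "?e j \<in> ?A k \<longleftrightarrow> enum_by (weight_less d) ?S j \<in> weight_idx d k" for j k
  proof -
    obtain \<alpha> \<beta> where \<mu>: "enum_by (weight_less d) ?S j = (\<alpha>, \<beta>)" by (metis surj_pair)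
    then have "\<beta> \<in> I" using enum_by(1)[of j] by simp
    then have "mon4 (\<alpha>, \<beta>) \<in> normal_forms f"
      unfolding normal_forms_def nb by (intro cfun.span_base) auto
    then show ?thesis
      using \<open>\<beta> \<in> I\<close> weight_monomial_in_polys_le_iff[OF d f, of \<alpha> \<beta> "d * k"]
      by (simp add: \<mu> mon4_def weight_idx_def)
  qed
  have *: "filt_m ?e ?A k = card (weight_idx d k)" "Van ?e (filt_m ?e ?A k) E = vand (weight_idx d k) mon4 E" for k
    using filtration[of "weight_idx d" ?e ?A mon4, OF initial in_A] by auto
  show ?thesis
    unfolding tdiam2_def transfinite_diameter_def filt_l_def nb *(2) unfolding *(1) ..
qed

text \<open>With s = \<open>max_degree\<close>, the count lies between |I| times those of
  \<open>midx (k - s)\<close> and \<open>midx k\<close>, which differ by O(k). For k < s there is no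
  lower inclusion, but the constant then absorbs the whole count.\<close>

lemma weight_idx_card:
  assumes d: "d \<ge> 1"
  shows "\<bar>real (card (weight_idx d k)) - real (card I) * real (card (midx k))\<bar> \<le>
    real (card I * (max_degree + 1)\<^sup>2) * (real k + 1)"
proof -
  let ?s = max_degree and ?n = "card I"
  have up: "card (weight_idx d k) \<le> ?n * card (midx k)"
    using card_mono[OF _ weight_idx_subset[OF d, of k]] finite_I by (simp add: card_cartesian_product mult.commute)
  have "?n * card (midx k) \<le> card (weight_idx d k) + ?n * (?s + 1)\<^sup>2 * (k + 1)"
  proof (cases "k < ?s")
    case True
    have "card (midx k) \<le> (k + 1) * (k + 1)" using card_midx_le[of k] by (simp add: power2_eq_square)
    also have "\<dots> \<le> (?s + 1)\<^sup>2 * (k + 1)"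
      using True by (intro mult_le_mono) (auto simp: power2_eq_square)
    finally have "?n * card (midx k) \<le> ?n * ((?s + 1)\<^sup>2 * (k + 1))" by (rule mult_le_mono2)
    then show ?thesis by (simp only: mult.assoc trans_le_add2)
  next
    case False
    then obtain j where k: "k = j + ?s" by (metis le_add_diff_inverse2 not_less)
    have "?n * card (midx k) \<le> ?n * (card (midx j) + ?s * (?s + 1) * (j + 1))"
      unfolding k by (intro mult_le_mono2 card_midx_add_le)
    also have "\<dots> = card (midx j \<times> I) + ?n * (?s * (?s + 1)) * (j + 1)"
      by (simp add: card_cartesian_product algebra_simps)
    also have "\<dots> \<le> card (weight_idx d k) + ?n * (?s + 1)\<^sup>2 * (k + 1)"
      unfolding k
      by (intro add_mono card_mono finite_weight_idx weight_idx_supset d mult_le_mono)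
         (auto simp: power2_eq_square finite_I)
    finally show ?thesis .
  qed
  then have "real (?n * card (midx k)) \<le> real (card (weight_idx d k) + ?n * (?s + 1)\<^sup>2 * (k + 1))"
    by (rule of_nat_mono)
  moreover have "real (card (weight_idx d k)) \<le> real (?n * card (midx k))" using up by (rule of_nat_mono)
  moreover have "real (?n * (?s + 1)\<^sup>2 * (k + 1)) = real (?n * (?s + 1)\<^sup>2) * (real k + 1)"
    by (simp only: of_nat_mult of_nat_add of_nat_1)
  ultimately show ?thesis unfolding of_nat_add of_nat_mult[of ?n "card _"] by linarith
qed

text \<open>Both inequalities come from one comparison of roots, used with exponent n and, with the
  roles exchanged, with exponent 1/n.\<close>

lemma tdiam2_lift:
  assumes d: "d \<ge> 1" and f: "poly_of_degree d (\<lambda>z. fst (f z))" "poly_of_degree d (\<lambda>z. snd (f z))"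
    and nb: "normal_basis f = {(\<alpha>, \<beta>). \<beta> \<in> I}" and K: "bounded K"
  shows "tdiam2 f d (lift K) = fekete_leja K"
proof -
  let ?n = "real (card I)"
  define l where "l = (\<lambda>k. \<Sum>\<nu>=1..k. real \<nu> * (real (card (midx \<nu>)) - real (card (midx (\<nu> - 1)))))"
  define l' where "l' = (\<lambda>k. \<Sum>\<nu>=1..k. real \<nu> * (real (card (weight_idx d \<nu>)) - real (card (weight_idx d (\<nu> - 1)))))"
  define v where "v = (\<lambda>k. vand (midx k) mon2 K)"
  define X where "X = (\<lambda>k. vand (weight_idx d k) mon4 (lift K))"
  have n: "card I > 0" using finite_I zero_in_I by (auto simp: card_gt_0_iff)
  have l: "(\<lambda>k. l k / real k ^ 3) \<longlonglongrightarrow> 1 / 3"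
    unfolding l_def by (rule weighted_sum_limit[of _ _ 0]) simp
  have l': "(\<lambda>k. l' k / real k ^ 3) \<longlonglongrightarrow> ?n / 3"
    unfolding l'_def by (rule weighted_sum_limit[OF weight_idx_card[OF d]])
  have t2: "tdiam2 f d (lift K) = limsup (\<lambda>k. ereal (X k powr (1 / l' k)))"
    unfolding X_def l'_def by (rule tdiam2_eq[OF d f nb])
  have fl: "fekete_leja K = limsup (\<lambda>k. ereal (v k powr (1 / l k)))"
    unfolding v_def l_def by (rule fekete_leja_eq)
  show ?thesis
  proof (cases "K = {}")
    case True
    have "lift K = {}" using True by (auto simp: lift_def)
    \<comment> \<open>Every level contains an index, so the empty set admits no configuration and
      all suprema range over the empty set.\<close>
    have ne: "(0, 0) \<in> midx k" "((0, 0), (0, 0)) \<in> weight_idx d k" for k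
      using zero_in_I by (auto simp: midx_def weight_idx_def mdeg_def)
    have "v k = Sup {}" for k using ne(1)[of k] True by (auto simp: v_def vand_def intro!: arg_cong[of _ _ Sup])
    moreover have "X k = Sup {}" for k
      using ne(2)[of k] \<open>lift K = {}\<close> by (auto simp: X_def vand_def intro!: arg_cong[of _ _ Sup])
    ultimately show ?thesis
      using limsup_const_root[OF cubic_imp_at_top[OF l]] limsup_const_root[OF cubic_imp_at_top[OF l']] n
      by (simp add: t2 fl)
  next
    case False
    have v0: "v k \<ge> 0" for k
      unfolding v_def by (rule vand_nonneg[OF finite_midx bounded_rows_mon2[OF finite_midx K] False])
    have X0: "X k \<ge> 0" for k
      unfolding X_def by (intro vand_nonneg finite_weight_idx bounded_rows_mon4 K lift_nonempty d False)
    obtain C where C: "C \<ge> 1" "\<And>k. X (k + max_degree) \<le> C ^ ((k + 1)\<^sup>2) * v k ^ card I"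
      unfolding X_def v_def using vand_weight_le[OF K False d] by metis
    obtain D t where D: "D \<ge> 1" "\<And>k. v (k + t) ^ card I \<le> D ^ ((k + 1)\<^sup>2) * X (k + max_degree)"
      unfolding X_def v_def using vand_weight_ge[OF K False d] by metis
    have "tdiam2 f d (lift K) \<le> fekete_leja K"
      unfolding t2 fl
    proof (rule limsup_root_le[of v X C ?n max_degree 0 l "1 / 3" l'])
      show "X (k + max_degree) \<le> C ^ ((k + 1)\<^sup>2) * v (k + 0) powr ?n" for k
        using C(2)[of k] v0[of k] n by (simp add: powr_realpow')
    qed (use v0 X0 C n l l' in auto)
    moreover have "fekete_leja K \<le> tdiam2 f d (lift K)"
      unfolding t2 fl
    proof (rule limsup_root_le[of X v D "1 / ?n" t max_degree l' "?n / 3" l])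
      show "v (k + t) \<le> D ^ ((k + 1)\<^sup>2) * X (k + max_degree) powr (1 / ?n)" for k
      proof -
        have "v (k + t) = (v (k + t) ^ card I) powr (1 / ?n)"
          using v0[of "k + t"] n by (simp add: powr_powr powr_realpow'[symmetric])
        also have "\<dots> \<le> (D ^ ((k + 1)\<^sup>2) * X (k + max_degree)) powr (1 / ?n)"
          using D(2)[of k] v0 n by (intro powr_mono2) auto
        also have "\<dots> = (D ^ ((k + 1)\<^sup>2)) powr (1 / ?n) * X (k + max_degree) powr (1 / ?n)"
          by (rule powr_mult)
        also have "\<dots> \<le> D ^ ((k + 1)\<^sup>2) * X (k + max_degree) powr (1 / ?n)"
        proof (rule mult_right_mono)
          \<comment> \<open>Since \<open>D\<close> is at least 1, taking the n-th root only
            decreases the constant.\<close>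
          have "(D ^ ((k + 1)\<^sup>2)) powr (1 / ?n) \<le> (D ^ ((k + 1)\<^sup>2)) powr 1"
            using D(1) n by (intro powr_mono) (auto simp: one_le_power)
          then show "(D ^ ((k + 1)\<^sup>2)) powr (1 / ?n) \<le> D ^ ((k + 1)\<^sup>2)" using D(1) by simp
        qed simp
        finally show ?thesis .
      qed
    qed (use v0 X0 D n l l' in auto)
    ultimately show ?thesis by (rule antisym)
  qed
qed

end

theorem corollary5p6:
  fixes f :: "C2 \<Rightarrow> C2" and d :: nat and I :: "mindex set" and K :: "C2 set"
  assumes "d \<ge> 1"
    and "poly_of_degree d (\<lambda>z. fst (f z))"
    and "poly_of_degree d (\<lambda>z. snd (f z))"
    and "finite I" and "(0, 0) \<in> I"
    and "normal_basis f = {(\<alpha>, \<beta>). \<beta> \<in> I}"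
    and "\<forall>\<beta> \<in> I. \<exists>\<beta>' \<gamma> C. C \<noteq> 0 \<and>
           (\<exists>r \<in> lower_terms f d (\<gamma>, (0, 0)). \<forall>(w, z) \<in> graphV f.
              mon2 \<beta> z * mon2 \<beta>' z = C * mon2 \<gamma> w + r (w, z))"
    and "compact K"
  shows "tdiam2 f d {(w, z) \<in> graphV f. w \<in> K} = tdiam3 {(w, z) \<in> graphV f. w \<in> K}
       \<and> tdiam3 {(w, z) \<in> graphV f. w \<in> K} = fekete_leja K"
proof -
  have "(\<lambda>z. fst (f z)) \<in> PF" "(\<lambda>z. snd (f z)) \<in> PF"
    using assms(2,3) polys_le_PF by (auto simp: poly_of_degree_def)
  then interpret finite_cover f I
    using assms(4-6) by (rule finite_cover_normal_basis)
  have "bounded K" using assms(8) by (rule compact_imp_bounded)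
  then show ?thesis
    using tdiam2_lift[OF assms(1-3,6)] tdiam3_eq_fekete_leja unfolding lift_def by simp
qed

end
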